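(* Let $(X,Y)$ and $(V,W)$ be two Banach couples with $\operatorname{R1\text{-}Int}_1(X,Y)=\operatorname{R1\text{-}Int}_1(V,W)$. Then $(X,Y)\cong(V,W)$, i.e. either ($X\cong V$ and $Y\cong W$) or ($X\cong W$ and $Y\cong V$).
   Context: All Banach spaces are over the same scalar field ($\mathbb{R}$ or $\mathbb{C}$). $E\hookrightarrow F$ means that the Banach space $E$ is a linear subspace of the Banach space $F$ and the inclusion is continuous. $E\cong F$ means that $E$ and $F$ coincide as linear spaces and their norms are proportional (one is a positive constant multiple of the other). A Banach couple $(X,Y)$ is a pair of Banach spaces, both linearly and continuously embedded (as linear subspaces) in some Hausdorff topological vector space. $X\cap Y$ is a Banach space with norm $\|z\|_{X\cap Y}=\max\{\|z\|_X,\|z\|_Y\}$, and $X+Y$ is a Banach space with norm $\|z\|_{X+Y}=\inf\{\|x\|_X+\|y\|_Y: x\in X,\ y\in Y,\ z=x+y\}$. $\operatorname{I}(X,Y)$ is the collection of intermediate spaces, i.e. Banach spaces $Z$ with $X\cap Y\hookrightarrow Z\hookrightarrow X+Y$. $L((X,Y))$ is the set of linear operators $T$ in $X+Y$ that map $X$ into $X$ and $Y$ into $Y$ boundedly, with norm $\|T\|_{L((X,Y))}=\max\{\|T\|_{X\to X},\|T\|_{Y\to Y}\}$. $R1((X,Y))$ is the subset of operators of rank one in $L((X,Y))$. $\operatorname{R1\text{-}Int}_1(X,Y)$ (exact interpolation spaces for the operators of rank one) is the collection of all $Z\in\operatorname{I}(X,Y)$ such that for every $T\in R1((X,Y))$ one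 has $T(Z)\subset Z$ and $\|T\|_{Z\to Z}\le\|T\|_{L((X,Y))}$. *)

theory Defs
  imports "HOL-Analysis.Analysis" "HOL-Algebra.Module"
begin

text \<open>
  The scalar field is \<real> or \<complex>. The following class contains exactly these two fields, up to
  isometric isomorphism.
\<close>

class real_or_complex = real_normed_field +
  assumes real_or_complex:
    "\<exists>\<phi> :: 'a \<Rightarrow> complex. (range \<phi> = \<real> \<or> range \<phi> = UNIV) \<and>
       (\<forall>x y. \<phi> (x + y) = \<phi> x + \<phi> y) \<and> (\<forall>x y. \<phi> (x * y) = \<phi> x * \<phi> y) \<and>
       (\<forall>x. cmod (\<phi> x) = norm x)"

instance real :: real_or_complex
  by standard (rule exI[of _ complex_of_real], auto simp: Reals_def)

instance complex :: real_or_complex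
  by standard (rule exI[of _ "\<lambda>z. z"], auto)

definition scalars :: "'k::real_or_complex ring" where
  "scalars = \<lparr>carrier = UNIV, monoid.mult = (*), one = 1, ring.zero = 0, add = (+)\<rparr>"


text \<open>
  Spaces are sets with their own linear operations, inside a type \<open>'a\<close> that has no structure of
  its own. A vector space is a module over \<open>scalars\<close>; the record fields \<open>mult\<close> and \<open>one\<close>, which
  modules inherit from rings, play no role, and neither do the values of the
  operations and of the norm outside the carrier.
\<close>

abbreviation vec_space :: "('k::real_or_complex, 'a, 'm) module_scheme \<Rightarrow> bool" where
  "vec_space E \<equiv> Module.module scalars E"

definition linear_subspace ::
  "('k::real_or_complex, 'a, 'm) module_scheme \<Rightarrow> ('k, 'a, 'n) module_scheme \<Rightarrow> bool" where
  "linear_subspace E F \<longleftrightarrow>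
     vec_space E \<and> vec_space F \<and> carrier E \<subseteq> carrier F \<and> \<zero>\<^bsub>E\<^esub> = \<zero>\<^bsub>F\<^esub> \<and>
     (\<forall>x\<in>carrier E. \<forall>y\<in>carrier E. x \<oplus>\<^bsub>E\<^esub> y = x \<oplus>\<^bsub>F\<^esub> y) \<and>
     (\<forall>c. \<forall>x\<in>carrier E. c \<odot>\<^bsub>E\<^esub> x = c \<odot>\<^bsub>F\<^esub> x)"

definition hausdorff_tvs ::
  "('k::real_or_complex, 'a, 'm) module_scheme \<Rightarrow> 'a topology \<Rightarrow> bool" where
  "hausdorff_tvs H \<tau> \<longleftrightarrow>
     vec_space H \<and> topspace \<tau> = carrier H \<and> Hausdorff_space \<tau> \<and>
     continuous_map (prod_topology \<tau> \<tau>) \<tau> (\<lambda>(x, y). x \<oplus>\<^bsub>H\<^esub> y) \<and>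
     continuous_map (prod_topology euclidean \<tau>) \<tau> (\<lambda>(c, x). c \<odot>\<^bsub>H\<^esub> x)"


section \<open>Banach spaces\<close>

record ('k, 'a) nspace = "('k, 'a) module" +
  nrm :: "'a \<Rightarrow> real"

definition normed_space :: "('k::real_or_complex, 'a) nspace \<Rightarrow> bool" where
  "normed_space E \<longleftrightarrow>
     vec_space E \<and>
     (\<forall>x\<in>carrier E. 0 \<le> nrm E x) \<and>
     (\<forall>x\<in>carrier E. nrm E x = 0 \<longleftrightarrow> x = \<zero>\<^bsub>E\<^esub>) \<and>
     (\<forall>c. \<forall>x\<in>carrier E. nrm E (c \<odot>\<^bsub>E\<^esub> x) = norm c * nrm E x) \<and>
     (\<forall>x\<in>carrier E. \<forall>y\<in>carrier E. nrm E (x \<oplus>\<^bsub>E\<^esub> y) \<le> nrm E x + nrm E y)"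

text \<open>
  The locale \<open>Metric_space\<close> asks for a nonnegative symmetric distance on the whole type,
  hence the value 0 off the carrier.
\<close>

definition ndist :: "('k::real_or_complex, 'a) nspace \<Rightarrow> 'a \<Rightarrow> 'a \<Rightarrow> real" where
  "ndist E x y = (if x \<in> carrier E \<and> y \<in> carrier E then nrm E (x \<ominus>\<^bsub>E\<^esub> y) else 0)"

definition ntopology :: "('k::real_or_complex, 'a) nspace \<Rightarrow> 'a topology" where
  "ntopology E = Metric_space.mtopology (carrier E) (ndist E)"

definition banach_space :: "('k::real_or_complex, 'a) nspace \<Rightarrow> bool" where
  "banach_space E \<longleftrightarrow> normed_space E \<and> Metric_space.mcomplete (carrier E) (ndist E)"

definition embedded ::
  "('k::real_or_complex, 'a) nspace \<Rightarrow> ('k, 'a) nspace \<Rightarrow> bool" (infix "\<hookrightarrow>" 50) where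
  "E \<hookrightarrow> F \<longleftrightarrow> linear_subspace E F \<and> continuous_map (ntopology E) (ntopology F) (\<lambda>x. x)"

text \<open>Mutual inclusion as linear subspaces says that the two linear spaces coincide.\<close>

definition proportional ::
  "('k::real_or_complex, 'a) nspace \<Rightarrow> ('k, 'a) nspace \<Rightarrow> bool" (infix "\<cong>\<^sub>p" 50) where
  "E \<cong>\<^sub>p F \<longleftrightarrow> linear_subspace E F \<and> linear_subspace F E \<and>
     (\<exists>c>0. \<forall>x\<in>carrier E. nrm F x = c * nrm E x)"


section \<open>Banach couples and intermediate spaces\<close>

text \<open>
  The ambient space \<open>H\<close> of a couple \<open>X, Y\<close> is kept as a parameter: the vectors
  of \<open>X + Y\<close> are formed with the addition of \<open>H\<close>.
\<close>

definition banach_couple ::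
  "('k::real_or_complex, 'a) module \<Rightarrow> 'a topology \<Rightarrow> ('k, 'a) nspace \<Rightarrow> ('k, 'a) nspace \<Rightarrow> bool"
where
  "banach_couple H \<tau> X Y \<longleftrightarrow>
     hausdorff_tvs H \<tau> \<and> banach_space X \<and> banach_space Y \<and>
     linear_subspace X H \<and> continuous_map (ntopology X) \<tau> (\<lambda>x. x) \<and>
     linear_subspace Y H \<and> continuous_map (ntopology Y) \<tau> (\<lambda>x. x)"

definition inter_space ::
  "('k::real_or_complex, 'a) module \<Rightarrow> ('k, 'a) nspace \<Rightarrow> ('k, 'a) nspace \<Rightarrow> ('k, 'a) nspace"
where
  "inter_space H X Y =
     module.extend (H\<lparr>carrier := carrier X \<inter> carrier Y\<rparr>)
       (nspace.fields (\<lambda>z. max (nrm X z) (nrm Y z)))"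

definition sum_space ::
  "('k::real_or_complex, 'a) module \<Rightarrow> ('k, 'a) nspace \<Rightarrow> ('k, 'a) nspace \<Rightarrow> ('k, 'a) nspace"
where
  "sum_space H X Y =
     module.extend (H\<lparr>carrier := {x \<oplus>\<^bsub>H\<^esub> y | x y. x \<in> carrier X \<and> y \<in> carrier Y}\<rparr>)
       (nspace.fields (\<lambda>z. Inf {nrm X x + nrm Y y | x y.
          x \<in> carrier X \<and> y \<in> carrier Y \<and> z = x \<oplus>\<^bsub>H\<^esub> y}))"

definition intermediate_spaces ::
  "('k::real_or_complex, 'a) module \<Rightarrow> ('k, 'a) nspace \<Rightarrow> ('k, 'a) nspace \<Rightarrow> ('k, 'a) nspace set"
where
  "intermediate_spaces H X Y =
     {Z. banach_space Z \<and> inter_space H X Y \<hookrightarrow> Z \<and> Z \<hookrightarrow> sum_space H X Y}"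


section \<open>Operators and interpolation\<close>

definition linear_operator ::
  "('k::real_or_complex, 'a) nspace \<Rightarrow> ('a \<Rightarrow> 'a) \<Rightarrow> bool" where
  "linear_operator E T \<longleftrightarrow>
     (\<forall>x\<in>carrier E. T x \<in> carrier E) \<and>
     (\<forall>x\<in>carrier E. \<forall>y\<in>carrier E. T (x \<oplus>\<^bsub>E\<^esub> y) = T x \<oplus>\<^bsub>E\<^esub> T y) \<and>
     (\<forall>c. \<forall>x\<in>carrier E. T (c \<odot>\<^bsub>E\<^esub> x) = c \<odot>\<^bsub>E\<^esub> T x)"

definition maps_boundedly ::
  "('k::real_or_complex, 'a) nspace \<Rightarrow> ('a \<Rightarrow> 'a) \<Rightarrow> bool" where
  "maps_boundedly E T \<longleftrightarrow>
     T ` carrier E \<subseteq> carrier E \<and> (\<exists>C. \<forall>x\<in>carrier E. nrm E (T x) \<le> C * nrm E x)"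

text \<open>Meaningful only if \<open>maps_boundedly E T\<close>; otherwise the supremum may be unspecified.\<close>

definition op_norm :: "('k::real_or_complex, 'a) nspace \<Rightarrow> ('a \<Rightarrow> 'a) \<Rightarrow> real" where
  "op_norm E T = Sup {nrm E (T x) | x. x \<in> carrier E \<and> nrm E x \<le> 1}"

definition couple_operators ::
  "('k::real_or_complex, 'a) module \<Rightarrow> ('k, 'a) nspace \<Rightarrow> ('k, 'a) nspace \<Rightarrow> ('a \<Rightarrow> 'a) set"
where
  "couple_operators H X Y =
     {T. linear_operator (sum_space H X Y) T \<and> maps_boundedly X T \<and> maps_boundedly Y T}"

definition couple_op_norm ::
  "('k::real_or_complex, 'a) nspace \<Rightarrow> ('k, 'a) nspace \<Rightarrow> ('a \<Rightarrow> 'a) \<Rightarrow> real" where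
  "couple_op_norm X Y T = max (op_norm X T) (op_norm Y T)"

definition rank_one :: "('k::real_or_complex, 'a) nspace \<Rightarrow> ('a \<Rightarrow> 'a) \<Rightarrow> bool" where
  "rank_one E T \<longleftrightarrow>
     (\<exists>u\<in>carrier E. u \<noteq> \<zero>\<^bsub>E\<^esub> \<and> T ` carrier E = range (\<lambda>c. c \<odot>\<^bsub>E\<^esub> u))"

definition R1 ::
  "('k::real_or_complex, 'a) module \<Rightarrow> ('k, 'a) nspace \<Rightarrow> ('k, 'a) nspace \<Rightarrow> ('a \<Rightarrow> 'a) set"
where
  "R1 H X Y = {T \<in> couple_operators H X Y. rank_one (sum_space H X Y) T}"

definition R1_Int_1 ::
  "('k::real_or_complex, 'a) module \<Rightarrow> ('k, 'a) nspace \<Rightarrow> ('k, 'a) nspace \<Rightarrow> ('k, 'a) nspace set"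
where
  "R1_Int_1 H X Y =
     {Z \<in> intermediate_spaces H X Y.
        \<forall>T\<in>R1 H X Y. maps_boundedly Z T \<and> op_norm Z T \<le> couple_op_norm X Y T}"

end

theory Submission imports Defs begin

text \<open>
  Write \<open>p, q, r, s\<close> for the norms of \<open>X, Y, V, W\<close> and, for a bounded functional \<open>f\<close> on \<open>X + Y\<close>, write
  \<open>P, Q, R, S\<close> for the norms of its restrictions to these spaces. The sum \<open>X + Y\<close> is itself an exact
  rank-one interpolation space of \<open>(X, Y)\<close>, so equality of the two collections embeds \<open>X + Y\<close> and \<open>V + W\<close>
  into each other. Hence everything takes place inside the one normed space \<open>M = X + Y\<close>, and both couples
  have the same bounded functionals (\<open>two_pairs\<close>).

  The operator \<open>f(\<cdot>)u\<close> with \<open>u\<close> in \<open>X \<inter> Y\<close> has norm \<open>max (P f * p u) (Q f * q u)\<close>. As \<open>V\<close> and \<open>W\<close> belong to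
  the collection of \<open>(X, Y)\<close> and conversely, \<open>X \<inter> Y = V \<inter> W\<close>, and on this intersection
  \<open>max (P f * p u) (Q f * q u) = max (R f * r u) (S f * s u)\<close> (\<open>rank_one_norm_eq\<close>).

  The heart of the proof is that this function of \<open>(f, u)\<close> determines the norms on the intersection. Let
  \<open>c\<close> be the infimum of \<open>Q f\<close> over all \<open>f\<close> with \<open>P f = 1\<close>. If \<open>c > 0\<close>, then \<open>P f \<le> Q f / c\<close> for all \<open>f\<close>, that is, the
  unit ball of \<open>X\<close> lies in the closure, taken in \<open>M\<close>, of a ball of \<open>Y\<close> of radius \<open>1 / c\<close>. By completeness
  of \<open>Y\<close> the closure can be dropped, as in the open mapping theorem, so \<open>c * q \<le> p\<close> on \<open>X\<close>
  (\<open>dual_domination\<close>), which is trivial for \<open>c = 0\<close>. Along a minimizing sequence of functionals the operator norms of \<open>f(\<cdot>)u\<close> therefore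
  tend to \<open>max (p u) (c * q u) = p u\<close> (\<open>norm_X_as_limit\<close>). Written in terms of \<open>V\<close> and \<open>W\<close>, the same limit
  is a maximum of nonnegative multiples of \<open>r u\<close> and \<open>s u\<close>. Thus each of \<open>{p, q}\<close> and \<open>{r, s}\<close> generates the other
  under scaling and maxima. Substituting one representation into the other shows that \<open>p\<close> is a multiple of \<open>r\<close>, of \<open>s\<close>
  or of \<open>q\<close>, and so the two sets agree up to scaling (\<open>max_comb_match\<close>).

  It remains to pass from the intersection to the whole spaces. If no nonzero functional vanishes on \<open>Y\<close>
  or on \<open>W\<close>, the intersection is dense in \<open>X\<close> and in \<open>V\<close>, and completeness extends the proportionality of their norms (\<open>proportional_of_dense\<close>).
  If a functional \<open>f \<noteq> 0\<close> does vanish on \<open>Y\<close>, the operators \<open>f(\<cdot>)u\<close> are available for all \<open>u\<close> in \<open>X\<close>, and their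
  invariance identifies \<open>X\<close> with \<open>V\<close> or with \<open>W\<close> at once (\<open>annihilated_cases\<close>).
\<close>

section \<open>Scalars and vector spaces\<close>

text \<open>
  Hahn--Banach over \<open>\<complex>\<close> needs real and imaginary parts. The isometric map into \<open>\<complex>\<close> preserves them because it fixes the
  real numbers.
\<close>

lemma real_or_complex_cases:
  obtains
    (real) "\<And>c::'k::real_or_complex. \<exists>r. c = of_real r"
  | (complex) i :: "'k::real_or_complex" where
      "i * i = -1" "\<And>c. \<exists>a b. c = of_real a + of_real b * i"
      "\<And>a b. \<bar>a\<bar> \<le> norm (of_real a + of_real b * i)"
proof -
  obtain \<phi> :: "'k \<Rightarrow> complex" where rng: "range \<phi> = \<real> \<or> range \<phi> = UNIV"
    and add: "\<And>x y. \<phi> (x + y) = \<phi> x + \<phi> y"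
    and mult: "\<And>x y. \<phi> (x * y) = \<phi> x * \<phi> y"
    and nrm: "\<And>x. cmod (\<phi> x) = norm x"
    using real_or_complex[where 'a='k] by blast
  have diff: "\<phi> (x - y) = \<phi> x - \<phi> y" for x y
    using add[of "x - y" y] by (simp add: algebra_simps)
  have inj: "x = y" if "\<phi> x = \<phi> y" for x y
    using nrm[of "x - y"] diff[of x y] that by simp
  have one: "\<phi> 1 = 1"
    using mult[of 1 1] nrm[of 1] by auto
  \<comment> \<open>An isometry that fixes \<open>0\<close> and \<open>1\<close> fixes every point of the line through them.\<close>
  have of_real: "\<phi> (of_real r) = of_real r" for r
  proof -
    define z where "z = \<phi> (of_real r)"
    have "(cmod z)\<^sup>2 = r\<^sup>2" unfolding z_def nrm by simp
    moreover have "cmod (z - 1) = \<bar>r - 1\<bar>"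
      using nrm[of "of_real r - 1"] norm_of_real[of "r - 1", where 'a='k]
      by (simp add: diff one z_def)
    then have "(cmod (z - 1))\<^sup>2 = (r - 1)\<^sup>2" by simp
    ultimately have "(Re z)\<^sup>2 + (Im z)\<^sup>2 = r\<^sup>2" "(Re z - 1)\<^sup>2 + (Im z)\<^sup>2 = (r - 1)\<^sup>2"
      by (simp_all add: cmod_power2)
    then have "Re z = r" "Im z = 0" by (auto simp: power2_eq_square algebra_simps)
    then show ?thesis unfolding z_def[symmetric] by (simp add: complex_eq_iff)
  qed
  from rng show thesis
  proof
    assume "range \<phi> = \<real>"
    then have "\<exists>r. c = of_real r" for c :: 'k
      using inj of_real by (metis Reals_cases rangeI)
    then show thesis by (rule real)
  next
    assume surj: "range \<phi> = UNIV"
    then obtain i where i: "\<phi> i = \<i>" by (metis surjD)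
    have ab: "\<phi> (of_real a + of_real b * i) = Complex a b" for a b
      by (simp add: add mult of_real i complex_eq_iff)
    show thesis
    proof (rule complex)
      show "i * i = -1"
        by (rule inj) (use of_real[of "-1"] in \<open>simp add: mult i\<close>)
      show "\<exists>a b. c = of_real a + of_real b * i" for c
        using inj ab by (metis complex.exhaust)
      show "\<bar>a\<bar> \<le> norm (of_real a + of_real b * i)" for a b
        using abs_Re_le_cmod[of "Complex a b"] by (simp add: nrm[symmetric] ab)
    qed
  qed
qed

locale vspace = module scalars M
  for M :: "('k::real_or_complex, 'a, 'm) module_scheme" (structure)
begin

lemma smul_closed [simp, intro]: "x \<in> carrier M \<Longrightarrow> c \<odot> x \<in> carrier M"
  by (rule smult_closed) (auto simp: scalars_def)

lemma smul_distrib: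
  "x \<in> carrier M \<Longrightarrow> (a + b) \<odot> x = a \<odot> x \<oplus> b \<odot> x"
  "x \<in> carrier M \<Longrightarrow> y \<in> carrier M \<Longrightarrow> c \<odot> (x \<oplus> y) = c \<odot> x \<oplus> c \<odot> y"
  using smult_l_distr[of a b x] smult_r_distr[of c x y] by (auto simp: scalars_def)

lemma smul_smul: "x \<in> carrier M \<Longrightarrow> a \<odot> (b \<odot> x) = (a * b) \<odot> x"
  using smult_assoc1[of a b x] by (auto simp: scalars_def)

lemma smul_one [simp]: "x \<in> carrier M \<Longrightarrow> 1 \<odot> x = x"
  using smult_one[of x] by (auto simp: scalars_def)

lemma smul_zero [simp]: "x \<in> carrier M \<Longrightarrow> 0 \<odot> x = \<zero>"
  using smult_l_null[of x] by (auto simp: scalars_def)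

lemma smul_zero_right [simp]: "c \<odot> \<zero> = \<zero>"
  using smult_r_null[of c] by (auto simp: scalars_def)

lemma smul_minus_one: "x \<in> carrier M \<Longrightarrow> (-1) \<odot> x = \<ominus> x"
  using smul_distrib(1)[of x "-1" 1]
  by (metis M.minus_equality smul_closed add.left_inverse smul_one smul_zero)

lemma minus_self [simp]: "x \<in> carrier M \<Longrightarrow> x \<ominus> x = \<zero>"
  by (simp add: a_minus_def M.r_neg)

lemma minus_zero [simp]: "x \<in> carrier M \<Longrightarrow> x \<ominus> \<zero> = x"
  by (simp add: a_minus_def)

lemma minus_eq_zero_iff: "\<lbrakk>x \<in> carrier M; y \<in> carrier M\<rbrakk> \<Longrightarrow> x \<ominus> y = \<zero> \<longleftrightarrow> x = y"
proof
  assume xy: "x \<in> carrier M" "y \<in> carrier M" and "x \<ominus> y = \<zero>"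
  moreover have "x = (x \<ominus> y) \<oplus> y"
    using xy by (simp add: a_minus_def M.a_assoc M.l_neg)
  ultimately show "x = y" by simp
qed simp

lemma minus_add_minus:
  "\<lbrakk>x \<in> carrier M; y \<in> carrier M; z \<in> carrier M\<rbrakk> \<Longrightarrow> (x \<ominus> y) \<oplus> (y \<ominus> z) = x \<ominus> z"
  by (simp add: a_minus_def M.a_assoc M.r_neg1 M.r_neg2)

end

section \<open>The Hahn--Banach theorem\<close>

definition linear_functional ::
  "('k::real_or_complex, 'a, 'm) module_scheme \<Rightarrow> ('a \<Rightarrow> 'k) \<Rightarrow> bool" where
  "linear_functional M f \<longleftrightarrow>
     (\<forall>x\<in>carrier M. \<forall>y\<in>carrier M. f (x \<oplus>\<^bsub>M\<^esub> y) = f x + f y) \<and>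
     (\<forall>c. \<forall>x\<in>carrier M. f (c \<odot>\<^bsub>M\<^esub> x) = c * f x)"

definition seminorm ::
  "('k::real_or_complex, 'a, 'm) module_scheme \<Rightarrow> ('a \<Rightarrow> real) \<Rightarrow> bool" where
  "seminorm M m \<longleftrightarrow>
     (\<forall>x\<in>carrier M. \<forall>y\<in>carrier M. m (x \<oplus>\<^bsub>M\<^esub> y) \<le> m x + m y) \<and>
     (\<forall>c. \<forall>x\<in>carrier M. m (c \<odot>\<^bsub>M\<^esub> x) = norm c * m x)"

definition sublinear ::
  "('k::real_or_complex, 'a, 'm) module_scheme \<Rightarrow> ('a \<Rightarrow> real) \<Rightarrow> bool" where
  "sublinear M g \<longleftrightarrow>
     (\<forall>x\<in>carrier M. \<forall>y\<in>carrier M. g (x \<oplus>\<^bsub>M\<^esub> y) \<le> g x + g y) \<and>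
     (\<forall>a\<ge>0. \<forall>x\<in>carrier M. g (of_real a \<odot>\<^bsub>M\<^esub> x) = a * g x)"

context vspace
begin

lemma seminorm_zero: "seminorm M m \<Longrightarrow> m \<zero> = 0"
  unfolding seminorm_def by (metis M.zero_closed mult_zero_left norm_zero smul_zero)

lemma sublinear_zero: "sublinear M g \<Longrightarrow> g \<zero> = 0"
  unfolding sublinear_def
  by (metis M.zero_closed mult_zero_left of_real_0 order_refl smul_zero)

lemma sublinear_minus:
  assumes "sublinear M g" "x \<in> carrier M"
  shows "0 \<le> g x + g (\<ominus> x)"
proof -
  have "g (x \<oplus> \<ominus> x) \<le> g x + g (\<ominus> x)"
    using assms unfolding sublinear_def by auto
  then show ?thesis using assms by (simp add: M.r_neg sublinear_zero)
qed

text \<open>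
  Lowering a sublinear functional \<open>g\<close> in the direction of \<open>u\<close>: the largest sublinear functional
  below \<open>g\<close> whose value at \<open>\<ominus> u\<close> is at most \<open>- g u\<close>.
\<close>

definition lower_along :: "'a \<Rightarrow> ('a \<Rightarrow> real) \<Rightarrow> 'a \<Rightarrow> real" where
  "lower_along u g x = (INF t\<in>{0..}. g (x \<oplus> of_real t \<odot> u) - t * g u)"

lemma lower_along:
  assumes g: "sublinear M g" and u: "u \<in> carrier M"
  shows lower_along_sublinear: "sublinear M (lower_along u g)"
    and lower_along_le: "\<And>x t. x \<in> carrier M \<Longrightarrow> 0 \<le> t \<Longrightarrow>
           lower_along u g x \<le> g (x \<oplus> of_real t \<odot> u) - t * g u"
proof -
  have gadd: "g (x \<oplus> y) \<le> g x + g y" if "x \<in> carrier M" "y \<in> carrier M" for x y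
    using g that by (auto simp: sublinear_def)
  have gmul: "g (of_real a \<odot> x) = a * g x" if "x \<in> carrier M" "a \<ge> 0" for x a
    using g that by (auto simp: sublinear_def)
  have lb: "- g (\<ominus> x) \<le> g (x \<oplus> of_real t \<odot> u) - t * g u" if x: "x \<in> carrier M" and t: "t \<ge> 0" for x t
  proof -
    have "t * g u = g ((x \<oplus> of_real t \<odot> u) \<oplus> \<ominus> x)"
    proof -
      have "(x \<oplus> of_real t \<odot> u) \<oplus> \<ominus> x = of_real t \<odot> u \<oplus> (x \<oplus> \<ominus> x)"
        using x u by (simp only: M.a_ac M.a_inv_closed smul_closed M.a_closed)
      then show ?thesis using x u t gmul[of u t] by (simp add: M.r_neg)
    qed
    also have "\<dots> \<le> g (x \<oplus> of_real t \<odot> u) + g (\<ominus> x)" using x u by (intro gadd) auto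
    finally show ?thesis by simp
  qed
  have bdd: "bdd_below ((\<lambda>t. g (x \<oplus> of_real t \<odot> u) - t * g u) ` {0..})" if "x \<in> carrier M" for x
    using lb[OF that] by (intro bdd_belowI2[where m="- g (\<ominus> x)"]) auto
  show le: "lower_along u g x \<le> g (x \<oplus> of_real t \<odot> u) - t * g u"
    if "x \<in> carrier M" "0 \<le> t" for x t
    unfolding lower_along_def using that by (intro cINF_lower bdd) auto
  have ge: "b \<le> lower_along u g x"
    if "\<And>t. 0 \<le> t \<Longrightarrow> b \<le> g (x \<oplus> of_real t \<odot> u) - t * g u" for b x
    unfolding lower_along_def using that by (intro cINF_greatest) auto
  have zero: "lower_along u g \<zero> = 0"
  proof (rule antisym)
    show "lower_along u g \<zero> \<le> 0"
      using le[of \<zero> 0] u by (simp add: sublinear_zero[OF g])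
    show "0 \<le> lower_along u g \<zero>"
      using u by (intro ge) (simp add: gmul)
  qed
  have homle: "lower_along u g (of_real a \<odot> x) \<le> a * lower_along u g x"
    if x: "x \<in> carrier M" and a: "a > 0" for x a
  proof -
    have "lower_along u g (of_real a \<odot> x) / a \<le> lower_along u g x"
    proof (rule ge)
      fix t :: real assume t: "0 \<le> t"
      have "lower_along u g (of_real a \<odot> x)
            \<le> g (of_real a \<odot> x \<oplus> of_real (a * t) \<odot> u) - a * t * g u"
        using x a t by (intro le) auto
      also have "of_real a \<odot> x \<oplus> of_real (a * t) \<odot> u = of_real a \<odot> (x \<oplus> of_real t \<odot> u)"
        using x u by (simp add: smul_distrib smul_smul)
      also have "g (of_real a \<odot> (x \<oplus> of_real t \<odot> u)) = a * g (x \<oplus> of_real t \<odot> u)"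
        using x u a by (intro gmul) auto
      finally show "lower_along u g (of_real a \<odot> x) / a \<le> g (x \<oplus> of_real t \<odot> u) - t * g u"
        using a by (simp add: field_simps)
    qed
    then show ?thesis using a by (simp add: field_simps)
  qed
  show "sublinear M (lower_along u g)"
    unfolding sublinear_def
  proof (intro conjI ballI allI impI)
    fix x y assume x: "x \<in> carrier M" and y: "y \<in> carrier M"
    have "lower_along u g (x \<oplus> y) - lower_along u g x \<le> lower_along u g y"
    proof (rule ge)
      fix t :: real assume t: "0 \<le> t"
      have "lower_along u g (x \<oplus> y) - (g (y \<oplus> of_real t \<odot> u) - t * g u) \<le> lower_along u g x"
      proof (rule ge)
        fix s :: real assume s: "0 \<le> s"
        have "lower_along u g (x \<oplus> y) \<le> g (x \<oplus> y \<oplus> of_real (s + t) \<odot> u) - (s + t) * g u"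
          using x y s t by (intro le) auto
        also have "x \<oplus> y \<oplus> of_real (s + t) \<odot> u = (x \<oplus> of_real s \<odot> u) \<oplus> (y \<oplus> of_real t \<odot> u)"
          using x y u by (simp add: smul_distrib M.a_ac)
        also have "g \<dots> \<le> g (x \<oplus> of_real s \<odot> u) + g (y \<oplus> of_real t \<odot> u)"
          using x y u by (intro gadd) auto
        finally show "lower_along u g (x \<oplus> y) - (g (y \<oplus> of_real t \<odot> u) - t * g u)
            \<le> g (x \<oplus> of_real s \<odot> u) - s * g u" by (simp add: algebra_simps)
      qed
      then show "lower_along u g (x \<oplus> y) - lower_along u g x \<le> g (y \<oplus> of_real t \<odot> u) - t * g u"
        by simp
    qed
    then show "lower_along u g (x \<oplus> y) \<le> lower_along u g x + lower_along u g y" by simp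
  next
    fix a :: real and x assume a: "0 \<le> a" and x: "x \<in> carrier M"
    show "lower_along u g (of_real a \<odot> x) = a * lower_along u g x"
    proof (cases "a = 0")
      case True then show ?thesis using x zero by simp
    next
      case False
      then have a: "a > 0" using a by simp
      have "of_real (1 / a) \<odot> (of_real a \<odot> x) = x"
        using x a smul_smul[of x "of_real (1/a)" "of_real a"] of_real_mult[of "1/a" a, where 'a='k]
        by simp
      then have "lower_along u g x \<le> (1 / a) * lower_along u g (of_real a \<odot> x)"
        using homle[of "of_real a \<odot> x" "1 / a"] x a by simp
      then show ?thesis using homle[OF x a] a by (simp add: field_simps)
    qed
  qed
qed

text \<open>
  Zorn's lemma applies because the pointwise infimum of a chain of sublinear functionals below \<open>m\<close> is again
  sublinear: it is bounded below by \<open>- m (\<ominus> x)\<close>, and for two members of the chain the smaller one serves both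
  summands. Functionals are normalized to \<open>0\<close> off the carrier to make the order antisymmetric.
\<close>

lemma minimal_sublinear_exists:
  assumes m: "sublinear M m"
  shows "\<exists>g. sublinear M g \<and> (\<forall>x\<in>carrier M. g x \<le> m x) \<and>
           (\<forall>h. sublinear M h \<longrightarrow> (\<forall>x\<in>carrier M. h x \<le> g x) \<longrightarrow> (\<forall>x\<in>carrier M. h x = g x))"
proof -
  define A where "A = {g. sublinear M g \<and> (\<forall>x\<in>carrier M. g x \<le> m x) \<and> (\<forall>x. x \<notin> carrier M \<longrightarrow> g x = 0)}"
  define P where "P = (\<lambda>g h. \<forall>x. (h x :: real) \<le> g (x :: 'a))"
  define cut where "cut = (\<lambda>g x. if x \<in> carrier M then (g x :: real) else 0)"
  have cut_sub: "sublinear M (cut g)" if "sublinear M g" for g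
    using that by (auto simp: sublinear_def cut_def)
  have "\<exists>g\<in>A. \<forall>h\<in>A. P g h \<longrightarrow> h = g"
  proof (rule predicate_Zorn)
    show "partial_order_on A (relation_of P A)"
      by (rule partial_order_on_relation_ofI)
        (auto simp: P_def fun_eq_iff intro: order_trans antisym)
  next
    fix C assume "C \<in> Chains (relation_of P A)"
    then have CA: "C \<subseteq> A" and ch: "\<And>g h. g \<in> C \<Longrightarrow> h \<in> C \<Longrightarrow> P g h \<or> P h g"
      by (auto simp: Chains_def relation_of_def)
    show "\<exists>l\<in>A. \<forall>g\<in>C. P g l"
    proof (cases "C = {}")
      case True
      have "cut m \<in> A" using cut_sub[OF m] by (auto simp: A_def cut_def)
      then show ?thesis using True by auto
    next
      case False
      have C: "sublinear M g" "\<And>x. x \<in> carrier M \<Longrightarrow> g x \<le> m x" "\<And>x. x \<notin> carrier M \<Longrightarrow> g x = 0" if "g \<in> C" for g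
        using that CA by (auto simp: A_def)
      define l where "l = cut (\<lambda>x. INF g\<in>C. g x)"
      have bdd: "bdd_below ((\<lambda>g. g x) ` C)" if x: "x \<in> carrier M" for x
      proof (rule bdd_belowI2)
        fix g assume "g \<in> C"
        then show "- m (\<ominus> x) \<le> g x"
          using sublinear_minus[OF C(1) x] C(2)[of g "\<ominus> x"] x by fastforce
      qed
      have le: "l x \<le> g x" if "x \<in> carrier M" "g \<in> C" for x g
        using that bdd by (auto simp: l_def cut_def intro: cINF_lower)
      have ge: "b \<le> l x" if "x \<in> carrier M" "\<And>g. g \<in> C \<Longrightarrow> b \<le> g x" for b x
        using that False by (auto simp: l_def cut_def intro: cINF_greatest)
      have "sublinear M l"
        unfolding sublinear_def
      proof (intro conjI ballI allI impI)
        fix x y assume x: "x \<in> carrier M" and y: "y \<in> carrier M"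
        have "l (x \<oplus> y) - l x \<le> l y"
        proof (rule ge[OF y])
          fix h assume h: "h \<in> C"
          have "l (x \<oplus> y) - h y \<le> l x"
          proof (rule ge[OF x])
            fix g assume g: "g \<in> C"
            have "\<exists>k\<in>C. k x \<le> g x \<and> k y \<le> h y"
              using ch[OF g h] g h unfolding P_def by blast
            then obtain k where k: "k \<in> C" "k x \<le> g x" "k y \<le> h y" by blast
            have "l (x \<oplus> y) \<le> k (x \<oplus> y)" using le x y k by auto
            also have "\<dots> \<le> k x + k y" using C(1)[OF k(1)] x y by (auto simp: sublinear_def)
            finally show "l (x \<oplus> y) - h y \<le> g x" using k by simp
          qed
          then show "l (x \<oplus> y) - l x \<le> h y" by simp
        qed
        then show "l (x \<oplus> y) \<le> l x + l y" by simp
      next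
        fix a :: real and x assume a: "0 \<le> a" and x: "x \<in> carrier M"
        have hom: "g (of_real a \<odot> x) = a * g x" if "g \<in> C" for g
          using C(1)[OF that] a x by (auto simp: sublinear_def)
        show "l (of_real a \<odot> x) = a * l x"
        proof (cases "a = 0")
          case True
          have "(\<lambda>g. g \<zero>) ` C = {0}" using False sublinear_zero[OF C(1)] by force
          then show ?thesis using True x by (simp add: l_def cut_def)
        next
          case F: False
          then have a: "a > 0" using a by simp
          show ?thesis
          proof (rule antisym)
            have "l (of_real a \<odot> x) / a \<le> l x"
            proof (rule ge[OF x])
              fix g assume g: "g \<in> C"
              show "l (of_real a \<odot> x) / a \<le> g x"
                using le[of "of_real a \<odot> x" g] g x hom[OF g] a by (simp add: field_simps)
            qed
            then show "l (of_real a \<odot> x) \<le> a * l x" using a by (simp add: field_simps)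
            show "a * l x \<le> l (of_real a \<odot> x)"
            proof (rule ge)
              fix g assume g: "g \<in> C"
              show "a * l x \<le> g (of_real a \<odot> x)" using hom[OF g] le[OF x g] a by simp
            qed (use x in auto)
          qed
        qed
      qed
      moreover have "\<forall>x\<in>carrier M. l x \<le> m x"
        using False le C(2) by (meson all_not_in_conv order_trans)
      ultimately have "l \<in> A" by (auto simp: A_def l_def cut_def)
      moreover have "\<forall>g\<in>C. P g l"
        using le C(3) unfolding P_def by (metis cut_def l_def order_refl)
      ultimately show ?thesis by blast
    qed
  qed
  then obtain g where g: "g \<in> A" and mini: "\<And>h. h \<in> A \<Longrightarrow> P g h \<Longrightarrow> h = g" by blast
  have "h x = g x" if h: "sublinear M h" and hg: "\<forall>x\<in>carrier M. h x \<le> g x" and x: "x \<in> carrier M" for h x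
  proof -
    have "cut h \<in> A" using g hg cut_sub[OF h] by (force simp: A_def cut_def)
    moreover have "P g (cut h)" using hg g by (auto simp: P_def cut_def A_def)
    ultimately have "cut h = g" by (rule mini)
    then show ?thesis using x by (metis cut_def)
  qed
  then show ?thesis using g by (auto simp: A_def)
qed

text \<open>
  A minimal sublinear functional \<open>g\<close> is additive, because lowering it along \<open>y\<close> cannot change it, and this
  gives \<open>g x \<le> g (x \<oplus> y) - g y\<close>. Starting Zorn's lemma from \<open>m\<close> lowered along \<open>u\<close> forces
  \<open>g (\<ominus> u) \<le> - m u\<close>, hence \<open>g u = m u\<close>.
\<close>

lemma real_hahn_banach:
  assumes m: "sublinear M m" and u: "u \<in> carrier M"
  obtains g where "\<And>x y. x \<in> carrier M \<Longrightarrow> y \<in> carrier M \<Longrightarrow> g (x \<oplus> y) = g x + g y"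
    "\<And>a x. x \<in> carrier M \<Longrightarrow> g (of_real a \<odot> x) = a * g x"
    "\<And>x. x \<in> carrier M \<Longrightarrow> g x \<le> m x" "g u = m u"
proof -
  obtain g where g: "sublinear M g" and gm: "\<And>x. x \<in> carrier M \<Longrightarrow> g x \<le> lower_along u m x"
    and mini: "\<And>h x. sublinear M h \<Longrightarrow> \<forall>x\<in>carrier M. h x \<le> g x \<Longrightarrow> x \<in> carrier M \<Longrightarrow> h x = g x"
    using minimal_sublinear_exists[OF lower_along_sublinear[OF m u]] by blast
  have hom: "g (of_real a \<odot> x) = a * g x" if "x \<in> carrier M" "0 \<le> a" for a x
    using g that by (auto simp: sublinear_def)
  have add: "g (x \<oplus> y) = g x + g y" if x: "x \<in> carrier M" and y: "y \<in> carrier M" for x y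
  proof (rule antisym)
    show "g (x \<oplus> y) \<le> g x + g y" using g x y by (auto simp: sublinear_def)
    have le0: "lower_along y g z \<le> g z" if "z \<in> carrier M" for z
      using lower_along_le[OF g y that, of 0] y that by simp
    have "g x = lower_along y g x"
      using mini[OF lower_along_sublinear[OF g y] _ x] le0 by simp
    also have "\<dots> \<le> g (x \<oplus> y) - g y" using lower_along_le[OF g y x, of 1] y by simp
    finally show "g x + g y \<le> g (x \<oplus> y)" by simp
  qed
  have neg: "g (\<ominus> x) = - g x" if "x \<in> carrier M" for x
    using add[of x "\<ominus> x"] that sublinear_zero[OF g] by (simp add: M.r_neg)
  have le0: "g x \<le> m x" if "x \<in> carrier M" for x
    using lower_along_le[OF m u that, of 0] gm[OF that] u that by simp
  show thesis
  proof
    show "g (of_real a \<odot> x) = a * g x" if x: "x \<in> carrier M" for a x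
    proof (cases "0 \<le> a")
      case True then show ?thesis using hom x by simp
    next
      case False
      have "of_real a \<odot> x = \<ominus> (of_real (- a) \<odot> x)"
        using x by (simp add: smul_minus_one[symmetric] smul_smul)
      then show ?thesis using neg[of "of_real (- a) \<odot> x"] hom[OF x, of "- a"] x False by simp
    qed
    have "g (\<ominus> u) \<le> - m u"
      using gm[of "\<ominus> u"] lower_along_le[OF m u, of "\<ominus> u" 1] u
      by (simp add: M.l_neg sublinear_zero[OF m])
    then show "g u = m u" using neg[OF u] le0[OF u] by simp
  qed (use add le0 in auto)
qed

text \<open>
  A complex functional is recovered from its real part \<open>g\<close> as \<open>g x - i * g (i x)\<close>.
\<close>

lemma hahn_banach:
  assumes m: "seminorm M m" and u: "u \<in> carrier M"
  obtains f where "linear_functional M f" "norm (f u) = m u"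
    "\<And>x. x \<in> carrier M \<Longrightarrow> norm (f x) \<le> m x"
proof -
  have mh: "m (c \<odot> x) = norm c * m x" if "x \<in> carrier M" for c x
    using m that by (auto simp: seminorm_def)
  have "sublinear M m" using m by (auto simp: sublinear_def seminorm_def)
  then obtain g where add: "\<And>x y. x \<in> carrier M \<Longrightarrow> y \<in> carrier M \<Longrightarrow> g (x \<oplus> y) = g x + g y"
    and hom: "\<And>a x. x \<in> carrier M \<Longrightarrow> g (of_real a \<odot> x) = a * g x"
    and le: "\<And>x. x \<in> carrier M \<Longrightarrow> g x \<le> m x" and gu: "g u = m u"
    using real_hahn_banach[OF _ u] by metis
  \<comment> \<open>Rotating \<open>x\<close> by a scalar of norm \<open>1\<close> turns a bound on real parts into a bound on the modulus.\<close>
  have rot: "\<exists>d. norm d = 1 \<and> d * c = of_real (norm c)" for c :: 'k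
    by (rule exI[of _ "if c = 0 then 1 else of_real (norm c) / c"]) (auto simp: norm_divide)
  show thesis
  proof (cases rule: real_or_complex_cases[where 'k='k, case_names real complex])
    case real
    define f where "f = (\<lambda>x. of_real (g x) :: 'k)"
    have "linear_functional M f"
      unfolding linear_functional_def
    proof (intro conjI ballI allI)
      fix c :: 'k and x assume "x \<in> carrier M"
      then show "f (c \<odot> x) = c * f x" using real[of c] hom by (auto simp: f_def)
    qed (auto simp: f_def add)
    moreover have bound: "norm (f x) \<le> m x" if "x \<in> carrier M" for x
      using le[OF that] le[of "of_real (-1) \<odot> x"] hom[OF that, of "-1"] mh[OF that, of "-1"] that
      by (auto simp: f_def)
    moreover have "norm (f u) = m u" using bound[OF u] gu by (simp add: f_def)
    ultimately show thesis using that by blast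
  next
    case (complex i)
    define f where "f = (\<lambda>x. of_real (g x) - i * of_real (g (i \<odot> x)) :: 'k)"
    have fadd: "f (x \<oplus> y) = f x + f y" if "x \<in> carrier M" "y \<in> carrier M" for x y
      using that by (simp add: f_def smul_distrib add algebra_simps)
    have freal: "f (of_real a \<odot> x) = of_real a * f x" if "x \<in> carrier M" for a x
    proof -
      have "g (i \<odot> (of_real a \<odot> x)) = a * g (i \<odot> x)"
        using hom[of "i \<odot> x" a] that by (simp add: smul_smul mult.commute)
      then show ?thesis using that hom by (simp add: f_def algebra_simps)
    qed
    have fi: "f (i \<odot> x) = i * f x" if "x \<in> carrier M" for x
    proof -
      have "g (i \<odot> (i \<odot> x)) = - g x"
        using hom[of x "-1"] that complex(1) by (simp add: smul_smul)
      moreover have "i * (i * z) = - z" for z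
        using complex(1) by (metis mult.assoc mult_minus1)
      ultimately show ?thesis using that by (simp add: f_def right_diff_distrib)
    qed
    have fmul: "f (c \<odot> x) = c * f x" if x: "x \<in> carrier M" for c x
    proof -
      obtain a b where c: "c = of_real a + of_real b * i" using complex(2) by blast
      have "f (c \<odot> x) = f (of_real a \<odot> x) + f (of_real b \<odot> (i \<odot> x))"
        using x by (simp add: c smul_distrib smul_smul fadd)
      then show ?thesis using x by (simp add: freal fi c algebra_simps)
    qed
    have re: "\<bar>g x\<bar> \<le> norm (f x)" for x
      using complex(3)[of "g x" "- g (i \<odot> x)"] by (simp add: f_def mult.commute)
    have bound: "norm (f x) \<le> m x" if x: "x \<in> carrier M" for x
    proof -
      obtain d where d: "norm d = 1" "d * f x = of_real (norm (f x))" using rot by blast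
      define y where "y = d \<odot> x"
      have y: "y \<in> carrier M" using x by (simp add: y_def)
      have "of_real (norm (f x)) = of_real (g y) - i * of_real (g (i \<odot> y))"
        using fmul[OF x, of d] d by (simp add: y_def f_def)
      then have "0 = of_real (g y - norm (f x)) + of_real (- g (i \<odot> y)) * i"
        by (simp add: algebra_simps)
      then have "\<bar>g y - norm (f x)\<bar> \<le> 0" using complex(3) by (metis norm_zero)
      then have "norm (f x) = g y" by simp
      also have "\<dots> \<le> m x" using le[OF y] mh[OF x, of d] d by (simp add: y_def)
      finally show ?thesis .
    qed
    have "linear_functional M f" using fadd fmul by (auto simp: linear_functional_def)
    moreover have "norm (f u) = m u" using bound[OF u] re[of u] gu by simp
    ultimately show thesis using that bound by blast
  qed
qed

end

section \<open>Normed spaces and completeness\<close>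

text \<open>
  All computations are carried out with the operations of the ambient space \<open>M\<close>, which is only a vector
  space here: it may be the space \<open>H\<close> of a couple, or a normed space, possibly \<open>E\<close> itself.
\<close>

locale normed_subspace = vspace M
  for M :: "('k::real_or_complex, 'a, 'm) module_scheme" (structure) +
  fixes E :: "('k, 'a) nspace"
  assumes normed: "normed_space E" and subspace: "linear_subspace E M"
begin

lemma vspace: "vspace E"
  using subspace by (simp add: linear_subspace_def vspace_def)

lemma mem [simp, intro]: "x \<in> carrier E \<Longrightarrow> x \<in> carrier M"
  using subspace by (auto simp: linear_subspace_def)

lemma zero_eq: "\<zero>\<^bsub>E\<^esub> = \<zero>" and add_eq: "\<lbrakk>x \<in> carrier E; y \<in> carrier E\<rbrakk> \<Longrightarrow> x \<oplus>\<^bsub>E\<^esub> y = x \<oplus> y"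
  and smul_eq: "x \<in> carrier E \<Longrightarrow> c \<odot>\<^bsub>E\<^esub> x = c \<odot> x"
  using subspace by (auto simp: linear_subspace_def)

lemma zero_mem [simp, intro]: "\<zero> \<in> carrier E"
  using abelian_group.axioms(1)[OF module.axioms(2)] vspace zero_eq
  by (metis abelian_monoid.zero_closed vspace_def)

lemma smul_mem [simp, intro]: "x \<in> carrier E \<Longrightarrow> c \<odot> x \<in> carrier E"
  using vspace.smul_closed[OF vspace, of x c] smul_eq by simp

lemma add_mem [simp, intro]: "\<lbrakk>x \<in> carrier E; y \<in> carrier E\<rbrakk> \<Longrightarrow> x \<oplus> y \<in> carrier E"
  using abelian_group.axioms(1)[OF module.axioms(2)] vspace add_eq
  by (metis abelian_monoid.a_closed vspace_def)

lemma inv_eq: "x \<in> carrier E \<Longrightarrow> \<ominus>\<^bsub>E\<^esub> x = \<ominus> x"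
  using vspace.smul_minus_one[OF vspace, of x] smul_eq[of x "-1"] smul_minus_one[of x] by simp

lemma inv_mem [simp, intro]: "x \<in> carrier E \<Longrightarrow> \<ominus> x \<in> carrier E"
  using smul_mem[of x "-1"] smul_minus_one[of x] by simp

lemma minus_eq: "\<lbrakk>x \<in> carrier E; y \<in> carrier E\<rbrakk> \<Longrightarrow> x \<ominus>\<^bsub>E\<^esub> y = x \<ominus> y"
  by (simp add: a_minus_def inv_eq add_eq)

lemma minus_mem [simp, intro]: "\<lbrakk>x \<in> carrier E; y \<in> carrier E\<rbrakk> \<Longrightarrow> x \<ominus> y \<in> carrier E"
  by (simp add: a_minus_def)

lemma nrm_nonneg [simp]: "x \<in> carrier E \<Longrightarrow> 0 \<le> nrm E x"
  using normed by (auto simp: normed_space_def)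

lemma nrm_eq_zero: "x \<in> carrier E \<Longrightarrow> nrm E x = 0 \<longleftrightarrow> x = \<zero>"
  using normed by (auto simp: normed_space_def zero_eq)

lemma nrm_zero [simp]: "nrm E \<zero> = 0"
  by (simp add: nrm_eq_zero)

lemma nrm_pos: "x \<in> carrier E \<Longrightarrow> x \<noteq> \<zero> \<Longrightarrow> 0 < nrm E x"
  using nrm_nonneg[of x] nrm_eq_zero[of x] by linarith

lemma nrm_smul: "x \<in> carrier E \<Longrightarrow> nrm E (c \<odot> x) = norm c * nrm E x"
  using normed smul_eq[of x c] unfolding normed_space_def by metis

lemma nrm_add: "\<lbrakk>x \<in> carrier E; y \<in> carrier E\<rbrakk> \<Longrightarrow> nrm E (x \<oplus> y) \<le> nrm E x + nrm E y"
  using normed add_eq[of x y] unfolding normed_space_def by metis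

lemma nrm_inv: "x \<in> carrier E \<Longrightarrow> nrm E (\<ominus> x) = nrm E x"
  using nrm_smul[of x "-1"] by (simp add: smul_minus_one)

lemma nrm_minus_commute: "\<lbrakk>x \<in> carrier E; y \<in> carrier E\<rbrakk> \<Longrightarrow> nrm E (x \<ominus> y) = nrm E (y \<ominus> x)"
proof -
  assume xy: "x \<in> carrier E" "y \<in> carrier E"
  have "y \<ominus> x = \<ominus> (x \<ominus> y)"
    using xy by (simp add: a_minus_def M.minus_add M.a_comm)
  then show ?thesis using xy by (simp add: nrm_inv)
qed

lemma nrm_le_plus_diff: "\<lbrakk>x \<in> carrier E; y \<in> carrier E\<rbrakk> \<Longrightarrow> nrm E x \<le> nrm E y + nrm E (x \<ominus> y)"
proof -
  assume xy: "x \<in> carrier E" "y \<in> carrier E"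
  have "x = y \<oplus> (x \<ominus> y)"
    using xy by (simp add: a_minus_def M.a_lcomm M.r_neg)
  then show ?thesis using nrm_add[of y "x \<ominus> y"] xy by simp
qed

lemma nrm_triangle:
  "\<lbrakk>x \<in> carrier E; y \<in> carrier E; z \<in> carrier E\<rbrakk> \<Longrightarrow>
     nrm E (x \<ominus> z) \<le> nrm E (x \<ominus> y) + nrm E (y \<ominus> z)"
  using minus_add_minus[of x y z] nrm_add[of "x \<ominus> y" "y \<ominus> z"] by simp

lemma ndist_eq: "\<lbrakk>x \<in> carrier E; y \<in> carrier E\<rbrakk> \<Longrightarrow> ndist E x y = nrm E (x \<ominus> y)"
  by (simp add: ndist_def minus_eq)

lemma Metric_space: "Metric_space (carrier E) (ndist E)"
proof
  show "0 \<le> ndist E x y" for x y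
    by (auto simp: ndist_def minus_eq)
  show "ndist E x y = ndist E y x" for x y
    by (auto simp: ndist_def minus_eq nrm_minus_commute)
  show "(ndist E x y = 0) = (x = y)" if "x \<in> carrier E" "y \<in> carrier E" for x y
    using that by (simp add: ndist_eq nrm_eq_zero minus_eq_zero_iff)
  show "ndist E x z \<le> ndist E x y + ndist E y z"
    if "x \<in> carrier E" "y \<in> carrier E" "z \<in> carrier E" for x y z
    using that by (simp add: ndist_eq nrm_triangle)
qed

sublocale metric: Metric_space "carrier E" "ndist E"
  by (rule Metric_space)

lemma limitin_iff:
  "limitin (ntopology E) s l sequentially \<longleftrightarrow>
     l \<in> carrier E \<and> (\<exists>N. \<forall>n\<ge>N. s n \<in> carrier E) \<and> (\<lambda>n. ndist E (s n) l) \<longlonglongrightarrow> 0"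
  unfolding ntopology_def metric.limitin_metric_dist_null eventually_sequentially by simp

lemma banach_cauchy_convergent:
  assumes "banach_space E" and s: "\<And>n. s n \<in> carrier E"
    and cauchy: "\<And>e. e > 0 \<Longrightarrow> \<exists>N. \<forall>m\<ge>N. \<forall>n\<ge>N. nrm E (s m \<ominus> s n) < e"
  obtains l where "l \<in> carrier E" "(\<lambda>n. nrm E (s n \<ominus> l)) \<longlonglongrightarrow> 0"
proof -
  have "metric.MCauchy s"
    unfolding metric.MCauchy_def using s cauchy by (simp add: ndist_eq image_subset_iff)
  then obtain l where l: "limitin (ntopology E) s l sequentially"
    using assms(1) unfolding banach_space_def metric.mcomplete_def ntopology_def by blast
  then have "l \<in> carrier E" "(\<lambda>n. ndist E (s n) l) \<longlonglongrightarrow> 0" unfolding limitin_iff by auto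
  then show thesis using that s by (simp add: ndist_eq)
qed

lemma finsum_lessThan_Suc:
  assumes "\<And>n :: nat. a n \<in> carrier M"
  shows "finsum M a {..<Suc n} = finsum M a {..<n} \<oplus> a n"
  using assms M.finsum_insert[of "{..<n}" n a]
  by (simp add: lessThan_Suc M.a_comm M.finsum_closed Pi_def)

lemma finsum_mem [simp, intro]:
  assumes "\<And>n :: nat. a n \<in> carrier E"
  shows "finsum M a {..<n} \<in> carrier E"
  by (induction n) (use assms in \<open>simp_all add: finsum_lessThan_Suc del: M.finsum_closed\<close>)

lemma series_converges:
  assumes ban: "banach_space E" and a: "\<And>n. a n \<in> carrier E"
    and le: "\<And>n. nrm E (a n) \<le> e n" and e: "summable e"
  obtains l where "l \<in> carrier E" "(\<lambda>n. nrm E (finsum M a {..<n} \<ominus> l)) \<longlonglongrightarrow> 0" "nrm E l \<le> suminf e"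
proof -
  define s where "s n = finsum M a {..<n}" for n
  have s: "s n \<in> carrier E" for n unfolding s_def using a by auto
  have s_Suc: "s (Suc n) = s n \<oplus> a n" for n
    unfolding s_def using a by (intro finsum_lessThan_Suc) auto
  have s0: "s 0 = \<zero>" unfolding s_def by simp
  have e0: "0 \<le> e n" for n using le[of n] nrm_nonneg[OF a, of n] by linarith
  have diff: "nrm E (s (m + k) \<ominus> s m) \<le> sum e {m..<m + k}" for m k
  proof (induction k)
    case 0
    then show ?case using mem[OF s] by simp
  next
    case (Suc k)
    have "s (m + Suc k) \<ominus> s m = (s (m + k) \<ominus> s m) \<oplus> a (m + k)"
      using s a s_Suc[of "m + k"] mem by (simp add: a_minus_def M.a_ac)
    then have "nrm E (s (m + Suc k) \<ominus> s m) \<le> nrm E (s (m + k) \<ominus> s m) + nrm E (a (m + k))"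
      using nrm_add s a by simp
    also have "\<dots> \<le> sum e {m..<m + Suc k}" using Suc le[of "m + k"] by simp
    finally show ?case .
  qed
  have diff': "nrm E (s n \<ominus> s m) \<le> sum e {m..<n}" if "m \<le> n" for m n
    using diff[of m "n - m"] that by simp
  have "\<exists>N. \<forall>m\<ge>N. \<forall>n\<ge>N. nrm E (s m \<ominus> s n) < d" if "d > 0" for d
  proof -
    from e that obtain N where N: "\<And>m n. m \<ge> N \<Longrightarrow> norm (sum e {m..<n}) < d"
      unfolding summable_Cauchy by blast
    have "nrm E (s m \<ominus> s n) < d" if "m \<ge> N" "n \<ge> N" for m n
    proof (cases "m \<le> n")
      case True
      then show ?thesis using diff'[OF True] N[of m n] that nrm_minus_commute[OF s s, of m n] by simp
    next
      case False
      then show ?thesis using diff'[of n m] N[of n m] that by simp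
    qed
    then show ?thesis by blast
  qed
  with ban s obtain l where l: "l \<in> carrier E" "(\<lambda>n. nrm E (s n \<ominus> l)) \<longlonglongrightarrow> 0"
    by (rule banach_cauchy_convergent)
  have "nrm E l \<le> suminf e + nrm E (s n \<ominus> l)" for n
  proof -
    have "nrm E (s n) \<le> sum e {..<n}"
      using diff'[of 0 n] mem[OF s, of n] by (simp add: s0 atLeast0LessThan)
    also have "\<dots> \<le> suminf e" using e e0 by (intro sum_le_suminf) auto
    finally show ?thesis
      using nrm_le_plus_diff[OF l(1) s, of n] nrm_minus_commute[OF l(1) s, of n] by linarith
  qed
  moreover have "(\<lambda>n. suminf e + nrm E (s n \<ominus> l)) \<longlonglongrightarrow> suminf e + 0"
    by (intro tendsto_intros l)
  ultimately have "nrm E l \<le> suminf e"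
    using LIMSEQ_le_const[of "\<lambda>n. suminf e + nrm E (s n \<ominus> l)" "suminf e + 0" "nrm E l"] by simp
  then show thesis using that l unfolding s_def by blast
qed

text \<open>
  A Cauchy sequence has a subsequence whose consecutive differences have norm at most \<open>(1/2) ^ n\<close>, so these series suffice.
\<close>

lemma banach_if_series_converge:
  assumes "\<And>d. (\<And>n. d n \<in> carrier E) \<Longrightarrow> (\<And>n. nrm E (d n) \<le> (1/2) ^ n) \<Longrightarrow>
     \<exists>l\<in>carrier E. (\<lambda>n. nrm E (finsum M d {..<n} \<ominus> l)) \<longlonglongrightarrow> 0"
  shows "banach_space E"
  unfolding banach_space_def metric.mcomplete_def
proof (intro conjI normed allI impI)
  fix s assume cauchy: "metric.MCauchy s"
  then have s: "s n \<in> carrier E" for n unfolding metric.MCauchy_def by auto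
  have "\<exists>N. \<forall>m\<ge>N. \<forall>n\<ge>N. ndist E (s m) (s n) < (1/2) ^ k" for k
    using cauchy unfolding metric.MCauchy_def
    by (metis zero_less_divide_1_iff zero_less_numeral zero_less_power)
  then obtain N where N: "\<And>k m n. m \<ge> N k \<Longrightarrow> n \<ge> N k \<Longrightarrow> ndist E (s m) (s n) < (1/2) ^ k"
    by metis
  \<comment> \<open>Strictly increasing, and beyond \<open>N k\<close> from index \<open>k\<close> on.\<close>
  define r where "r k = (\<Sum>i\<le>k. N i) + k" for k
  have r: "strict_mono r" by (rule strict_mono_Suc_iff[THEN iffD2]) (simp add: r_def)
  have rN: "N k \<le> r n" if "k \<le> n" for k n
    using member_le_sum[of k "{..n}" N] that by (simp add: r_def)
  define d where "d k = s (r (Suc k)) \<ominus> s (r k)" for k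
  have d: "d k \<in> carrier E" for k using s by (simp add: d_def)
  have "nrm E (d k) \<le> (1/2) ^ k" for k
    using N[OF rN rN, of k "Suc k" k] s by (simp add: d_def ndist_eq)
  then obtain l where l: "l \<in> carrier E" "(\<lambda>n. nrm E (finsum M d {..<n} \<ominus> l)) \<longlonglongrightarrow> 0"
    using assms[of d] d by blast
  have tele: "finsum M d {..<n} = s (r n) \<ominus> s (r 0)" for n
  proof (induction n)
    case 0 then show ?case using mem[OF s] by simp
  next
    case (Suc n)
    have "finsum M d {..<Suc n} = d n \<oplus> (s (r n) \<ominus> s (r 0))"
      using finsum_lessThan_Suc[of d n] d Suc s by (simp add: M.a_comm)
    also have "\<dots> = s (r (Suc n)) \<ominus> s (r 0)"
      unfolding d_def using s by (intro minus_add_minus) auto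
    finally show ?case .
  qed
  define b where "b = l \<oplus> s (r 0)"
  have b: "b \<in> carrier E" using l s by (simp add: b_def)
  have "finsum M d {..<n} \<ominus> l = s (r n) \<ominus> b" for n
    unfolding tele b_def using s l by (simp add: a_minus_def M.minus_add M.a_ac)
  then have "(\<lambda>n. ndist E ((s \<circ> r) n) b) \<longlonglongrightarrow> 0" using l(2) s b by (simp add: ndist_eq)
  then have "limitin metric.mtopology (s \<circ> r) b sequentially"
    using s b limitin_iff[unfolded ntopology_def] by auto
  then show "\<exists>x. limitin metric.mtopology s x sequentially"
    using metric.MCauchy_convergent_subsequence[OF cauchy r] by blast
qed

end

lemma linear_subspace_refl: "vspace E \<Longrightarrow> linear_subspace E E"
  by (simp add: linear_subspace_def vspace_def)

lemma normed_subspace_self: "normed_space E \<Longrightarrow> normed_subspace E E"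
  by (simp add: normed_subspace_def normed_subspace_axioms_def normed_space_def vspace_def
      linear_subspace_refl)

lemma normed_subspaceI: "normed_space E \<Longrightarrow> linear_subspace E M \<Longrightarrow> normed_subspace M E"
  by (simp add: normed_subspace_def normed_subspace_axioms_def linear_subspace_def vspace_def)

text \<open>
  By homogeneity, continuity at the origin already gives a bound.
\<close>

lemma embedded_bound:
  assumes E: "normed_space E" and F: "normed_space F" and emb: "E \<hookrightarrow> F"
  shows "\<exists>C>0. \<forall>x\<in>carrier E. nrm F x \<le> C * nrm E x"
proof -
  have sub: "linear_subspace E F" and cont: "continuous_map (ntopology E) (ntopology F) (\<lambda>x. x)"
    using emb by (auto simp: embedded_def)
  interpret F: normed_subspace F F by (rule normed_subspace_self[OF F])
  interpret E: normed_subspace F E by (rule normed_subspaceI[OF E sub])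
  obtain \<delta> where \<delta>: "\<delta> > 0"
    and d: "\<And>x. x \<in> carrier E \<Longrightarrow> ndist E \<zero>\<^bsub>F\<^esub> x < \<delta> \<Longrightarrow> ndist F \<zero>\<^bsub>F\<^esub> x < 1"
    using cont E.metric.metric_continuous_map[OF F.Metric_space, of "\<lambda>x. x"] E.zero_mem
    unfolding ntopology_def by (metis zero_less_one)
  have small: "nrm F x < 1" if x: "x \<in> carrier E" and "nrm E x < \<delta>" for x
    using d[OF x] that E.mem[OF x]
    by (simp add: E.ndist_eq F.ndist_eq a_minus_def E.nrm_inv F.nrm_inv)
  show ?thesis
  proof (intro exI[of _ "2 / \<delta>"] conjI ballI)
    show "2 / \<delta> > 0" using \<delta> by simp
    fix x assume x: "x \<in> carrier E"
    show "nrm F x \<le> 2 / \<delta> * nrm E x"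
    proof (cases "x = \<zero>\<^bsub>F\<^esub>")
      case False
      then have pos: "nrm E x > 0" using E.nrm_pos x by blast
      define a where "a = \<delta> / (2 * nrm E x)"
      have a: "a > 0" using pos \<delta> by (simp add: a_def)
      have "nrm E (of_real a \<odot>\<^bsub>F\<^esub> x) = a * nrm E x" using x a by (simp add: E.nrm_smul)
      also have "\<dots> = \<delta> / 2" using pos by (simp add: a_def)
      finally have "nrm E (of_real a \<odot>\<^bsub>F\<^esub> x) = \<delta> / 2" .
      then have "nrm F (of_real a \<odot>\<^bsub>F\<^esub> x) < 1" using small[of "of_real a \<odot>\<^bsub>F\<^esub> x"] x \<delta> by simp
      then have "a * nrm F x < 1" using x a by (simp add: F.nrm_smul)
      then show ?thesis using pos \<delta> by (simp add: a_def field_simps)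
    qed simp
  qed
qed

lemma embeddedI:
  assumes E: "normed_space E" and F: "normed_space F" and sub: "linear_subspace E F"
    and C: "\<And>x. x \<in> carrier E \<Longrightarrow> nrm F x \<le> C * nrm E x"
  shows "E \<hookrightarrow> F"
  unfolding embedded_def
proof (intro conjI sub)
  interpret F: normed_subspace F F by (rule normed_subspace_self[OF F])
  interpret E: normed_subspace F E by (rule normed_subspaceI[OF E sub])
  show "continuous_map (ntopology E) (ntopology F) (\<lambda>x. x)"
    unfolding ntopology_def E.metric.metric_continuous_map[OF F.Metric_space]
  proof (intro conjI ballI allI impI)
    fix a \<epsilon> :: real and x assume a: "x \<in> carrier E" and \<epsilon>: "0 < \<epsilon>"
    show "\<exists>\<delta>>0. \<forall>y. y \<in> carrier E \<and> ndist E x y < \<delta> \<longrightarrow> ndist F x y < \<epsilon>"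
    proof (intro exI[of _ "\<epsilon> / (\<bar>C\<bar> + 1)"] conjI allI impI)
      show "0 < \<epsilon> / (\<bar>C\<bar> + 1)" using \<epsilon> by (simp add: field_simps add_nonneg_pos)
      fix y assume y: "y \<in> carrier E \<and> ndist E x y < \<epsilon> / (\<bar>C\<bar> + 1)"
      define z where "z = x \<ominus>\<^bsub>F\<^esub> y"
      have z: "z \<in> carrier E" "nrm E z < \<epsilon> / (\<bar>C\<bar> + 1)"
        using a y by (auto simp: z_def E.ndist_eq)
      have "nrm F z \<le> C * nrm E z" using C z by blast
      also have "\<dots> \<le> (\<bar>C\<bar> + 1) * nrm E z"
        using z(1) by (intro mult_right_mono) auto
      also have "\<dots> < \<epsilon>" using z(2) by (simp add: field_simps add_nonneg_pos)
      finally show "ndist F x y < \<epsilon>" using a y E.mem by (simp add: F.ndist_eq z_def)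
    qed
  qed auto
qed

text \<open>
  Limits taken in two different norms coincide because both norms dominate the norm of \<open>M\<close>, up to constants.
\<close>

lemma limits_agree:
  fixes M X Y :: "('k::real_or_complex, 'a) nspace"
  assumes "normed_subspace M M" "normed_subspace M X" "normed_subspace M Y"
    and X_bound: "\<exists>C. \<forall>x\<in>carrier X. nrm M x \<le> C * nrm X x"
    and Y_bound: "\<exists>C. \<forall>y\<in>carrier Y. nrm M y \<le> C * nrm Y y"
    and x: "x \<in> carrier X" and y: "y \<in> carrier Y"
    and s: "\<And>n. s n \<in> carrier X" "\<And>n. s n \<ominus>\<^bsub>M\<^esub> y \<in> carrier Y"
    and X: "(\<lambda>n. nrm X (s n \<ominus>\<^bsub>M\<^esub> x)) \<longlonglongrightarrow> 0" and Y: "(\<lambda>n. nrm Y (s n \<ominus>\<^bsub>M\<^esub> y)) \<longlonglongrightarrow> 0"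
  shows "x = y"
proof -
  interpret whole: normed_subspace M M by fact
  interpret X: normed_subspace M X by fact
  interpret Y: normed_subspace M Y by fact
  obtain B where B: "\<And>x. x \<in> carrier X \<Longrightarrow> nrm M x \<le> B * nrm X x" using X_bound by blast
  obtain C where C: "\<And>x. x \<in> carrier Y \<Longrightarrow> nrm M x \<le> C * nrm Y x" using Y_bound by blast
  have xM: "x \<in> carrier M" and yM: "y \<in> carrier M" and sM: "s n \<in> carrier M" for n
    using x y s by auto
  have "nrm M (x \<ominus>\<^bsub>M\<^esub> y) \<le> B * nrm X (s n \<ominus>\<^bsub>M\<^esub> x) + C * nrm Y (s n \<ominus>\<^bsub>M\<^esub> y)" for n
  proof -
    have "nrm M (x \<ominus>\<^bsub>M\<^esub> y) \<le> nrm M (x \<ominus>\<^bsub>M\<^esub> s n) + nrm M (s n \<ominus>\<^bsub>M\<^esub> y)"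
      by (rule whole.nrm_triangle[OF xM sM yM])
    also have "nrm M (x \<ominus>\<^bsub>M\<^esub> s n) = nrm M (s n \<ominus>\<^bsub>M\<^esub> x)" by (rule whole.nrm_minus_commute[OF xM sM])
    also have "\<dots> \<le> B * nrm X (s n \<ominus>\<^bsub>M\<^esub> x)" using x s(1)[of n] by (intro B) auto
    finally show ?thesis using C[OF s(2)[of n]] by linarith
  qed
  moreover have "(\<lambda>n. B * nrm X (s n \<ominus>\<^bsub>M\<^esub> x) + C * nrm Y (s n \<ominus>\<^bsub>M\<^esub> y)) \<longlonglongrightarrow> B * 0 + C * 0"
    by (intro tendsto_intros X Y)
  ultimately have "nrm M (x \<ominus>\<^bsub>M\<^esub> y) \<le> B * 0 + C * 0"
    by (intro LIMSEQ_le_const[where X="\<lambda>n. B * nrm X (s n \<ominus>\<^bsub>M\<^esub> x) + C * nrm Y (s n \<ominus>\<^bsub>M\<^esub> y)"]) auto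
  then have "nrm M (x \<ominus>\<^bsub>M\<^esub> y) = 0"
    using whole.nrm_nonneg[OF whole.minus_mem[OF xM yM]] by linarith
  then show "x = y"
    using whole.nrm_eq_zero[OF whole.minus_mem[OF xM yM]] whole.minus_eq_zero_iff[OF xM yM] by simp
qed

section \<open>Norms of functionals\<close>

definition bounded_functional :: "('k::real_or_complex, 'a) nspace \<Rightarrow> ('a \<Rightarrow> 'k) \<Rightarrow> bool" where
  "bounded_functional M f \<longleftrightarrow>
     linear_functional M f \<and> (\<exists>C. \<forall>x\<in>carrier M. norm (f x) \<le> C * nrm M x)"

definition dual_norm :: "('k::real_or_complex, 'a) nspace \<Rightarrow> ('a \<Rightarrow> 'k) \<Rightarrow> real" where
  "dual_norm E f = Sup {norm (f x) | x. x \<in> carrier E \<and> nrm E x \<le> 1}"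

context normed_subspace
begin

lemma functional_zero: "linear_functional M f \<Longrightarrow> f \<zero> = 0"
  unfolding linear_functional_def by (metis M.zero_closed mult_zero_left smul_zero)

lemma dual_norm_bound:
  assumes f: "linear_functional M f" and bd: "\<exists>C. \<forall>x\<in>carrier E. norm (f x) \<le> C * nrm E x"
    and x: "x \<in> carrier E"
  shows "norm (f x) \<le> dual_norm E f * nrm E x"
proof (cases "x = \<zero>")
  case True
  then show ?thesis using functional_zero[OF f] by simp
next
  case False
  then have pos: "nrm E x > 0" using nrm_pos x by blast
  obtain C where C: "\<And>x. x \<in> carrier E \<Longrightarrow> norm (f x) \<le> C * nrm E x" using bd by blast
  have bdd: "bdd_above {norm (f x) | x. x \<in> carrier E \<and> nrm E x \<le> 1}"
  proof (rule bdd_aboveI)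
    fix r assume "r \<in> {norm (f x) | x. x \<in> carrier E \<and> nrm E x \<le> 1}"
    then obtain y where y: "r = norm (f y)" "y \<in> carrier E" "nrm E y \<le> 1" by blast
    have "r \<le> C * nrm E y" using C y by simp
    also have "\<dots> \<le> \<bar>C\<bar> * 1" using y by (intro mult_mono) auto
    finally show "r \<le> \<bar>C\<bar>" by simp
  qed
  define y where "y = of_real (1 / nrm E x) \<odot> x"
  have y: "y \<in> carrier E" "nrm E y \<le> 1"
    using x pos nrm_smul[OF x, of "of_real (1 / nrm E x)"]
    by (auto simp: y_def norm_divide simp del: of_real_divide)
  have "norm (f y) = norm (f x) / nrm E x"
    using f x pos unfolding y_def linear_functional_def by (simp add: norm_mult norm_divide)
  moreover have "norm (f y) \<le> dual_norm E f"
    unfolding dual_norm_def using y by (intro cSup_upper bdd) auto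
  ultimately show ?thesis using pos by (simp add: pos_divide_le_eq)
qed

lemma dual_norm_least:
  assumes "0 \<le> c" and c: "\<And>x. x \<in> carrier E \<Longrightarrow> norm (f x) \<le> c * nrm E x"
  shows "dual_norm E f \<le> c"
  unfolding dual_norm_def
proof (rule cSup_least)
  show "{norm (f x) | x. x \<in> carrier E \<and> nrm E x \<le> 1} \<noteq> {}"
    using zero_mem by (auto intro!: exI[of _ \<zero>])
  fix r assume "r \<in> {norm (f x) | x. x \<in> carrier E \<and> nrm E x \<le> 1}"
  then obtain y where y: "r = norm (f y)" "y \<in> carrier E" "nrm E y \<le> 1" by blast
  then show "r \<le> c" using c[of y] mult_left_le[of "nrm E y" c] assms(1) by linarith
qed

lemma dual_norm_nonneg:
  assumes "linear_functional M f" "\<exists>C. \<forall>x\<in>carrier E. norm (f x) \<le> C * nrm E x"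
  shows "0 \<le> dual_norm E f"
proof (cases "\<exists>x\<in>carrier E. x \<noteq> \<zero>")
  case True
  then obtain x where x: "x \<in> carrier E" "nrm E x > 0" using nrm_pos by blast
  have "0 \<le> dual_norm E f * nrm E x"
    using dual_norm_bound[OF assms x(1)] norm_ge_zero[of "f x"] by linarith
  then show ?thesis using x by (simp add: zero_le_mult_iff)
next
  case False
  then have "{norm (f x) | x. x \<in> carrier E \<and> nrm E x \<le> 1} = {0}"
  proof -
    have "{norm (f x) | x. x \<in> carrier E \<and> nrm E x \<le> 1} = {norm (f \<zero>)}"
      using False zero_mem nrm_zero by (auto intro!: exI[of _ \<zero>])
    then show ?thesis using functional_zero[OF assms(1)] by simp
  qed
  then show ?thesis by (simp add: dual_norm_def)
qed

lemma dual_norm_cmult: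
  assumes f: "linear_functional M f" and bd: "\<exists>C. \<forall>x\<in>carrier E. norm (f x) \<le> C * nrm E x"
  shows "dual_norm E (\<lambda>x. c * f x) = norm c * dual_norm E f"
proof -
  have le: "dual_norm E (\<lambda>x. c * f x) \<le> norm c * dual_norm E f"
    if f: "linear_functional M f" and bd: "\<exists>C. \<forall>x\<in>carrier E. norm (f x) \<le> C * nrm E x" for c f
  proof (rule dual_norm_least)
    show "0 \<le> norm c * dual_norm E f" using dual_norm_nonneg[OF f bd] by simp
    fix x assume "x \<in> carrier E"
    then show "norm (c * f x) \<le> norm c * dual_norm E f * nrm E x"
      using mult_left_mono[OF dual_norm_bound[OF f bd], of x "norm c"]
      by (simp add: norm_mult mult.assoc)
  qed
  show ?thesis
  proof (cases "c = 0")
    case True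
    have "0 \<le> dual_norm E (\<lambda>x. 0 :: 'k)"
      by (rule dual_norm_nonneg) (auto simp: linear_functional_def intro: exI[of _ 0])
    then show ?thesis using le[OF f bd, of c] True by simp
  next
    case False
    define g where "g = (\<lambda>x. c * f x)"
    have g: "linear_functional M g"
      using f by (auto simp: g_def linear_functional_def algebra_simps)
    obtain C where "\<forall>x\<in>carrier E. norm (f x) \<le> C * nrm E x" using bd by blast
    then have "\<forall>x\<in>carrier E. norm (g x) \<le> (norm c * C) * nrm E x"
      by (auto simp: g_def norm_mult mult.assoc intro!: mult_left_mono)
    then have "dual_norm E (\<lambda>x. inverse c * g x) \<le> norm (inverse c) * dual_norm E g"
      by (intro le g) blast
    moreover have "(\<lambda>x. inverse c * g x) = f" using False by (auto simp: g_def)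
    ultimately have "norm c * dual_norm E f \<le> dual_norm E g"
      using False pos_le_divide_eq[of "norm c" "dual_norm E f" "dual_norm E g"]
      by (simp add: norm_inverse divide_inverse mult.commute)
    then show ?thesis using le[OF f bd, of c] by (simp add: g_def)
  qed
qed

end

section \<open>The weighted K-functional\<close>

locale subspace_pair = vspace M + X: normed_subspace M X + Y: normed_subspace M Y
  for M :: "('k::real_or_complex, 'a, 'm) module_scheme" (structure) and X Y :: "('k, 'a) nspace" +
  assumes span: "u \<in> carrier M \<Longrightarrow> \<exists>x\<in>carrier X. \<exists>y\<in>carrier Y. u = x \<oplus> y"
begin

lemma decompose:
  assumes "u \<in> carrier M"
  obtains x y where "x \<in> carrier X" "y \<in> carrier Y" "u = x \<oplus> y"
  using span[OF assms] by blast

text \<open>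
  The weighted \<open>K\<close>-functional; for \<open>t = 0\<close> it is a seminorm that vanishes on \<open>Y\<close>.
\<close>

definition K :: "real \<Rightarrow> 'a \<Rightarrow> real" where
  "K t u = Inf {nrm X x + t * nrm Y y | x y. x \<in> carrier X \<and> y \<in> carrier Y \<and> u = x \<oplus> y}"

lemma K_le:
  assumes "0 \<le> t" "x \<in> carrier X" "y \<in> carrier Y"
  shows "K t (x \<oplus> y) \<le> nrm X x + t * nrm Y y"
  unfolding K_def
proof (rule cInf_lower)
  show "bdd_below {nrm X x' + t * nrm Y y' | x' y'. x' \<in> carrier X \<and> y' \<in> carrier Y \<and> x \<oplus> y = x' \<oplus> y'}"
    using assms(1) by (intro bdd_belowI[where m=0]) auto
qed (use assms in blast)

lemma K_greatest:
  assumes "u \<in> carrier M"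
    "\<And>x y. x \<in> carrier X \<Longrightarrow> y \<in> carrier Y \<Longrightarrow> u = x \<oplus> y \<Longrightarrow> b \<le> nrm X x + t * nrm Y y"
  shows "b \<le> K t u"
proof -
  obtain x y where "x \<in> carrier X" "y \<in> carrier Y" "u = x \<oplus> y" by (rule decompose[OF assms(1)])
  then have "{nrm X x + t * nrm Y y | x y. x \<in> carrier X \<and> y \<in> carrier Y \<and> u = x \<oplus> y} \<noteq> {}"
    by blast
  then show ?thesis unfolding K_def by (rule cInf_greatest) (use assms(2) in blast)
qed

lemma K_approx:
  assumes "u \<in> carrier M" "e > 0"
  obtains x y where "x \<in> carrier X" "y \<in> carrier Y" "u = x \<oplus> y" "nrm X x + t * nrm Y y < K t u + e"
  using K_greatest[OF assms(1), of "K t u + e" t] assms(2) by force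

lemma K_nonneg: "0 \<le> t \<Longrightarrow> u \<in> carrier M \<Longrightarrow> 0 \<le> K t u"
  by (rule K_greatest) auto

lemma seminorm_K:
  assumes t: "0 \<le> t"
  shows "seminorm M (K t)"
  unfolding seminorm_def
proof (intro conjI ballI allI)
  fix u v assume u: "u \<in> carrier M" and v: "v \<in> carrier M"
  show "K t (u \<oplus> v) \<le> K t u + K t v"
  proof (rule field_le_epsilon)
    fix e :: real assume e: "0 < e"
    obtain x y where xy: "x \<in> carrier X" "y \<in> carrier Y" "u = x \<oplus> y"
      "nrm X x + t * nrm Y y < K t u + e / 2" using K_approx[OF u] e half_gt_zero by metis
    obtain x' y' where xy': "x' \<in> carrier X" "y' \<in> carrier Y" "v = x' \<oplus> y'"
      "nrm X x' + t * nrm Y y' < K t v + e / 2" using K_approx[OF v] e half_gt_zero by metis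
    have "u \<oplus> v = (x \<oplus> x') \<oplus> (y \<oplus> y')"
      using xy xy' by (simp add: M.a_ac)
    then have "K t (u \<oplus> v) \<le> nrm X (x \<oplus> x') + t * nrm Y (y \<oplus> y')"
      using K_le[OF t, of "x \<oplus> x'" "y \<oplus> y'"] xy xy' by simp
    also have "\<dots> \<le> (nrm X x + nrm X x') + t * (nrm Y y + nrm Y y')"
      using xy xy' t by (intro add_mono mult_left_mono X.nrm_add Y.nrm_add) auto
    finally show "K t (u \<oplus> v) \<le> K t u + K t v + e"
      using xy(4) xy'(4) by (simp add: algebra_simps)
  qed
next
  have le: "K t (c \<odot> u) \<le> norm c * K t u" if u: "u \<in> carrier M" and c: "c \<noteq> 0" for c u
  proof -
    have "K t (c \<odot> u) / norm c \<le> K t u"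
    proof (rule K_greatest[OF u])
      fix x y assume xy: "x \<in> carrier X" "y \<in> carrier Y" "u = x \<oplus> y"
      have "K t (c \<odot> u) \<le> nrm X (c \<odot> x) + t * nrm Y (c \<odot> y)"
        using K_le[OF t, of "c \<odot> x" "c \<odot> y"] xy by (simp add: smul_distrib)
      then show "K t (c \<odot> u) / norm c \<le> nrm X x + t * nrm Y y"
        using c xy by (simp add: X.nrm_smul Y.nrm_smul field_simps)
    qed
    then show ?thesis using c by (simp add: field_simps)
  qed
  fix c u assume u: "u \<in> carrier M"
  show "K t (c \<odot> u) = norm c * K t u"
  proof (cases "c = 0")
    case True
    then show ?thesis
      using K_le[OF t, of \<zero> \<zero>] K_nonneg[OF t, of \<zero>] u by simp
  next
    case False
    have "K t u \<le> norm (inverse c) * K t (c \<odot> u)"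
      using le[of "c \<odot> u" "inverse c"] u False by (simp add: smul_smul)
    then have "norm c * K t u \<le> norm c * (norm (inverse c) * K t (c \<odot> u))"
      by (rule mult_left_mono) simp
    also have "\<dots> = K t (c \<odot> u)" using False by (simp add: norm_inverse)
    finally show ?thesis using le[OF u False] by simp
  qed
qed

lemma K_le_X: "0 \<le> t \<Longrightarrow> x \<in> carrier X \<Longrightarrow> K t x \<le> nrm X x"
  using K_le[of t x \<zero>] by simp

lemma K_le_Y: "0 \<le> t \<Longrightarrow> y \<in> carrier Y \<Longrightarrow> K t y \<le> t * nrm Y y"
  using K_le[of t \<zero> y] by simp

end

section \<open>Pairs of Banach spaces inside a normed space\<close>

text \<open>
  The norm of \<open>M\<close> is only required to be equivalent to the sum norm of \<open>X\<close> and \<open>Y\<close>. In this way two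
  couples with equivalent sum norms are pairs in the same space \<open>M\<close>.
\<close>

locale banach_pair = vspace M + whole: normed_subspace M M + X: normed_subspace M X + Y: normed_subspace M Y
  for M :: "('k::real_or_complex, 'a) nspace" (structure) and X Y :: "('k, 'a) nspace" +
  assumes X_banach: "banach_space X" and Y_banach: "banach_space Y"
    and X_bound: "\<exists>C. \<forall>x\<in>carrier X. nrm M x \<le> C * nrm X x"
    and Y_bound: "\<exists>C. \<forall>x\<in>carrier Y. nrm M x \<le> C * nrm Y x"
    and decomposition: "\<exists>C. \<forall>u\<in>carrier M. \<exists>x\<in>carrier X. \<exists>y\<in>carrier Y.
          u = x \<oplus> y \<and> nrm X x + nrm Y y \<le> C * nrm M u"
begin

sublocale subspace_pair M X Y
  by unfold_locales (use decomposition in blast)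

lemma swap: "banach_pair M Y X"
proof (unfold_locales)
  obtain C where C: "\<forall>u\<in>carrier M. \<exists>x\<in>carrier X. \<exists>y\<in>carrier Y.
          u = x \<oplus> y \<and> nrm X x + nrm Y y \<le> C * nrm M u" using decomposition by blast
  have "\<exists>y\<in>carrier Y. \<exists>x\<in>carrier X. u = y \<oplus> x \<and> nrm Y y + nrm X x \<le> C * nrm M u"
    if u: "u \<in> carrier M" for u
  proof -
    obtain x y where xy: "x \<in> carrier X" "y \<in> carrier Y" "u = x \<oplus> y" "nrm X x + nrm Y y \<le> C * nrm M u"
      using C u by blast
    then have "u = y \<oplus> x" "nrm Y y + nrm X x \<le> C * nrm M u" by (simp_all add: M.a_comm)
    with xy show ?thesis by blast
  qed
  then show "\<exists>C. \<forall>u\<in>carrier M. \<exists>y\<in>carrier Y. \<exists>x\<in>carrier X.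
       u = y \<oplus> x \<and> nrm Y y + nrm X x \<le> C * nrm M u" by blast
qed (fact X_banach Y_banach X_bound Y_bound)+

lemma bounded_on_X:
  assumes f: "bounded_functional M f"
  shows "\<exists>C. \<forall>x\<in>carrier X. norm (f x) \<le> C * nrm X x"
proof -
  obtain C where C: "\<And>x. x \<in> carrier M \<Longrightarrow> norm (f x) \<le> C * nrm M x"
    using f by (auto simp: bounded_functional_def)
  obtain B where B: "\<And>x. x \<in> carrier X \<Longrightarrow> nrm M x \<le> B * nrm X x" using X_bound by blast
  have "norm (f x) \<le> (\<bar>C\<bar> * B) * nrm X x" if x: "x \<in> carrier X" for x
  proof -
    have "norm (f x) \<le> C * nrm M x" using C x by auto
    also have "\<dots> \<le> \<bar>C\<bar> * nrm M x" using x by (intro mult_right_mono) auto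
    also have "\<dots> \<le> \<bar>C\<bar> * (B * nrm X x)" using B x by (intro mult_left_mono) auto
    finally show ?thesis by (simp add: mult.assoc)
  qed
  then show ?thesis by blast
qed

lemma dual_X:
  assumes f: "bounded_functional M f"
  shows dual_X_bound: "x \<in> carrier X \<Longrightarrow> norm (f x) \<le> dual_norm X f * nrm X x"
    and dual_X_nonneg: "0 \<le> dual_norm X f"
    and dual_X_cmult: "dual_norm X (\<lambda>x. c * f x) = norm c * dual_norm X f"
  using f bounded_on_X[OF f] X.dual_norm_bound X.dual_norm_nonneg X.dual_norm_cmult
  by (auto simp: bounded_functional_def)

lemmas dual_Y_bound = banach_pair.dual_X_bound[OF swap]
  and dual_Y_nonneg = banach_pair.dual_X_nonneg[OF swap]
  and dual_Y_cmult = banach_pair.dual_X_cmult[OF swap]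

lemma K_pos:
  assumes u: "u \<in> carrier M" "u \<noteq> \<zero>"
  shows "0 < K 1 u"
proof -
  obtain B where B: "\<And>x. x \<in> carrier X \<Longrightarrow> nrm M x \<le> B * nrm X x" using X_bound by blast
  obtain C where C: "\<And>x. x \<in> carrier Y \<Longrightarrow> nrm M x \<le> C * nrm Y x" using Y_bound by blast
  define D where "D = max 1 (max B C)"
  have "nrm M u / D \<le> K 1 u"
  proof (rule K_greatest[OF u(1)])
    fix x y assume xy: "x \<in> carrier X" "y \<in> carrier Y" "u = x \<oplus> y"
    have "nrm M u \<le> nrm M x + nrm M y" using xy whole.nrm_add by auto
    also have "\<dots> \<le> B * nrm X x + C * nrm Y y" using B C xy by (intro add_mono) auto
    also have "\<dots> \<le> D * nrm X x + D * nrm Y y"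
      using xy by (intro add_mono mult_right_mono) (auto simp: D_def)
    finally show "nrm M u / D \<le> nrm X x + 1 * nrm Y y"
      by (simp add: D_def pos_divide_le_eq algebra_simps)
  qed
  moreover have "0 < nrm M u / D" using whole.nrm_pos[OF u] by (simp add: D_def)
  ultimately show ?thesis by linarith
qed

text \<open>
  Hahn--Banach for \<open>K t\<close>: a functional dominated by \<open>K t\<close> has norm at most \<open>1\<close> on \<open>X\<close> and at most \<open>t\<close> on \<open>Y\<close>.
\<close>

lemma norming_functional:
  assumes t: "0 \<le> t" and u: "u \<in> carrier M"
  obtains f where "bounded_functional M f" "norm (f u) = K t u"
    "dual_norm X f \<le> 1" "dual_norm Y f \<le> t"
proof -
  obtain f where f: "linear_functional M f" "norm (f u) = K t u"
    and le: "\<And>x. x \<in> carrier M \<Longrightarrow> norm (f x) \<le> K t x"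
    using hahn_banach[OF seminorm_K[OF t] u] by blast
  obtain C where C: "\<forall>u\<in>carrier M. \<exists>x\<in>carrier X. \<exists>y\<in>carrier Y.
          u = x \<oplus> y \<and> nrm X x + nrm Y y \<le> C * nrm M u" using decomposition by blast
  have "norm (f v) \<le> ((1 + t) * C) * nrm M v" if v: "v \<in> carrier M" for v
  proof -
    obtain x y where xy: "x \<in> carrier X" "y \<in> carrier Y" "v = x \<oplus> y"
      "nrm X x + nrm Y y \<le> C * nrm M v" using C v by blast
    have "norm (f v) \<le> nrm X x + t * nrm Y y" using le[OF v] K_le[OF t xy(1,2)] xy(3) by simp
    also have "\<dots> \<le> (1 + t) * (nrm X x + nrm Y y)"
      using t xy by (simp add: algebra_simps)
    also have "\<dots> \<le> (1 + t) * (C * nrm M v)" using xy t by (intro mult_left_mono) auto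
    finally show ?thesis by (simp add: mult.assoc)
  qed
  then have "bounded_functional M f" using f unfolding bounded_functional_def by blast
  moreover have "dual_norm X f \<le> 1"
    using order_trans[OF le[OF X.mem] K_le_X[OF t]] by (intro X.dual_norm_least) simp_all
  moreover have "dual_norm Y f \<le> t"
    using order_trans[OF le[OF Y.mem] K_le_Y[OF t]] t by (intro Y.dual_norm_least) simp_all
  ultimately show thesis using that f(2) by blast
qed

lemma functional_determined:
  assumes f: "linear_functional M f" and "\<And>x. x \<in> carrier X \<Longrightarrow> f x = 0" "\<And>y. y \<in> carrier Y \<Longrightarrow> f y = 0"
    and u: "u \<in> carrier M"
  shows "f u = 0"
proof -
  obtain x y where xy: "x \<in> carrier X" "y \<in> carrier Y" "u = x \<oplus> y" by (rule decompose[OF u])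
  then have "f u = f x + f y" using f X.mem[OF xy(1)] Y.mem[OF xy(2)] unfolding linear_functional_def by blast
  then show ?thesis using assms(2)[OF xy(1)] assms(3)[OF xy(2)] by simp
qed

text \<open>
  For large \<open>t\<close> the K-functional puts nearly all of \<open>y\<close> into \<open>X\<close>. A norming functional \<open>f\<close> for \<open>K t y\<close> has norm
  at most \<open>1\<close> on \<open>X\<close>, hence at most \<open>c\<close> on \<open>Y\<close>, so \<open>K t y \<le> c * nrm Y y\<close> for every \<open>t\<close>. In a nearly optimal
  decomposition the part in \<open>Y\<close> has norm \<open>O(1 / t)\<close>.
\<close>

lemma almost_in_X:
  assumes c: "0 \<le> c" and dom: "\<And>f. bounded_functional M f \<Longrightarrow> dual_norm Y f \<le> c * dual_norm X f"
    and y: "y \<in> carrier Y" and e: "0 < e"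
  obtains x y' where "x \<in> carrier X" "y' \<in> carrier Y" "y = x \<oplus> y'" "nrm X x \<le> c * nrm Y y + e"
    "nrm Y y' \<le> e"
proof -
  \<comment> \<open>Chosen so that \<open>t * e\<close> is the available bound for \<open>K t y + e\<close>.\<close>
  define t where "t = (c * nrm Y y + e) / e"
  have t: "t > 0" using c e y by (simp add: t_def add_nonneg_pos)
  obtain f where f: "bounded_functional M f" "norm (f y) = K t y" "dual_norm X f \<le> 1"
    using norming_functional[of t y] t y by (metis Y.mem less_imp_le)
  have "K t y \<le> dual_norm Y f * nrm Y y" using dual_Y_bound[OF f(1) y] f(2) by simp
  also have "dual_norm Y f \<le> c"
    using dom[OF f(1)] mult_left_mono[OF f(3) c] by simp
  then have "dual_norm Y f * nrm Y y \<le> c * nrm Y y" using y by (intro mult_right_mono) auto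
  finally have Ky: "K t y \<le> c * nrm Y y" .
  obtain x y' where xy: "x \<in> carrier X" "y' \<in> carrier Y" "y = x \<oplus> y'"
    "nrm X x + t * nrm Y y' < K t y + e" using K_approx[of y e t] y e by blast
  have "t * nrm Y y' < c * nrm Y y + e" using xy(4) Ky X.nrm_nonneg[OF xy(1)] by linarith
  also have "\<dots> = t * e" using e by (simp add: t_def)
  finally have "nrm Y y' < e" using t by simp
  moreover have "nrm X x \<le> c * nrm Y y + e"
    using xy(4) Ky t Y.nrm_nonneg[OF xy(2)] mult_nonneg_nonneg[of t "nrm Y y'"] by linarith
  ultimately show thesis using that xy by auto
qed

text \<open>
  The hypothesis says that the unit ball of \<open>Y\<close> lies in the closure, taken in \<open>M\<close>, of the ball of radius \<open>c\<close> of
  \<open>X\<close>. As in the proof of the open mapping theorem, approximating \<open>y\<close>, then the error, then the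
  error of that, writes \<open>y\<close> as a series that converges in \<open>X\<close>. Since the errors are small in the norm of \<open>Y\<close>, the series
  has sum \<open>y\<close>, and since they decrease geometrically from an arbitrarily small start, the constant \<open>c\<close> is not lost.
\<close>

lemma dual_domination:
  assumes c: "0 \<le> c" and dom: "\<And>f. bounded_functional M f \<Longrightarrow> dual_norm Y f \<le> c * dual_norm X f"
    and y: "y \<in> carrier Y"
  shows "y \<in> carrier X \<and> nrm X y \<le> c * nrm Y y"
proof -
  have approx: "y \<in> carrier X \<and> nrm X y \<le> c * nrm Y y + (2 * c + 1) * (2 * \<epsilon>)" if \<epsilon>: "\<epsilon> > 0" for \<epsilon>
  proof -
    define e where "e n = \<epsilon> * (1 / 2) ^ n" for n :: nat
    have e: "e n > 0" "e n = 2 * e (Suc n)" for n using \<epsilon> by (simp_all add: e_def)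
    have "\<forall>z n. \<exists>x y'. z \<in> carrier Y \<longrightarrow> x \<in> carrier X \<and> y' \<in> carrier Y \<and> z = x \<oplus> y' \<and>
        nrm X x \<le> c * nrm Y z + e n \<and> nrm Y y' \<le> e n"
    proof (intro allI)
      fix z n
      show "\<exists>x y'. z \<in> carrier Y \<longrightarrow> x \<in> carrier X \<and> y' \<in> carrier Y \<and> z = x \<oplus> y' \<and>
        nrm X x \<le> c * nrm Y z + e n \<and> nrm Y y' \<le> e n"
      proof (cases "z \<in> carrier Y")
        case True
        show ?thesis by (rule almost_in_X[OF c dom True e(1)[of n]]) blast+
      qed blast
    qed
    then obtain A R where AR: "\<And>z n. z \<in> carrier Y \<Longrightarrow> A z n \<in> carrier X \<and> R z n \<in> carrier Y \<and>
        z = A z n \<oplus> R z n \<and> nrm X (A z n) \<le> c * nrm Y z + e n \<and> nrm Y (R z n) \<le> e n"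
      unfolding choice_iff by blast
    define r where "r = rec_nat y (\<lambda>n z. R z n)"
    have r0: "r 0 = y" and rSuc: "r (Suc n) = R (r n) n" for n by (simp_all add: r_def)
    have r: "r n \<in> carrier Y" for n by (induction n) (use AR y r0 rSuc in auto)
    define a where "a n = A (r n) n" for n
    have a: "a n \<in> carrier X" and split: "r n = a n \<oplus> r (Suc n)" for n
      using AR[OF r[of n], of n] by (simp_all add: a_def rSuc)
    have rle: "nrm Y (r (Suc n)) \<le> e n" for n using AR[OF r[of n], of n] by (simp add: rSuc)
    \<comment> \<open>For \<open>n = m + 1\<close> the bound is \<open>c * e m + e n = (2 * c + 1) * e n\<close>, since \<open>e m = 2 * e n\<close>.\<close>
    define b where "b n = (if n = 0 then c * nrm Y y else 0) + (2 * c + 1) * e n" for n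
    have ab: "nrm X (a n) \<le> b n" for n
    proof (cases n)
      case 0
      have "nrm X (a 0) \<le> c * nrm Y y + e 0" using AR[OF r[of 0], of 0] by (simp add: a_def r0)
      also have "\<dots> \<le> b 0" using c e(1)[of 0] by (simp add: b_def)
      finally show ?thesis using 0 by simp
    next
      case (Suc m)
      have "nrm X (a n) \<le> c * nrm Y (r n) + e n" using AR[OF r[of n], of n] by (simp add: a_def)
      also have "c * nrm Y (r n) \<le> c * e m" using rle[of m] c Suc by (simp add: mult_left_mono)
      also have "c * e m + e n = b n" using e(2)[of m] Suc by (simp add: b_def algebra_simps)
      finally show ?thesis by simp
    qed
    have "(\<lambda>n. (if n = 0 then c * nrm Y y else 0) + (2 * c + 1) * (\<epsilon> * (1 / 2) ^ n)) sums
        (c * nrm Y y + (2 * c + 1) * (\<epsilon> * (1 / (1 - 1 / 2))))"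
      by (intro sums_add sums_mult geometric_sums sums_single) simp
    then have b: "b sums (c * nrm Y y + (2 * c + 1) * (2 * \<epsilon>))"
      by (simp add: b_def[abs_def] e_def mult.commute[of \<epsilon> 2])
    obtain l where l: "l \<in> carrier X" "(\<lambda>n. nrm X (finsum M a {..<n} \<ominus> l)) \<longlonglongrightarrow> 0" "nrm X l \<le> suminf b"
      using X.series_converges[OF X_banach a ab sums_summable[OF b]] by blast
    have part: "y = finsum M a {..<n} \<oplus> r n" for n
    proof (induction n)
      case 0 then show ?case using y by (simp add: r0)
    next
      case (Suc n)
      have "finsum M a {..<Suc n} \<oplus> r (Suc n) = finsum M a {..<n} \<oplus> r n"
        using X.finsum_lessThan_Suc[of a n] a split[of n] X.mem[OF X.finsum_mem[OF a]] X.mem[OF a] Y.mem[OF r]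
        by (simp add: M.a_assoc)
      then show ?case using Suc by simp
    qed
    have rem: "finsum M a {..<n} \<ominus> y = \<ominus> r n" for n
    proof -
      have S: "finsum M a {..<n} \<in> carrier M" using a by auto
      have "\<ominus> y = \<ominus> finsum M a {..<n} \<ominus> r n"
        using part[of n] M.minus_add[OF S Y.mem[OF r[of n]]] by (simp add: a_minus_def)
      then show ?thesis using S Y.mem[OF r[of n]]
        by (simp add: a_minus_def M.r_neg2)
    qed
    have "(\<lambda>n. \<epsilon> * (1 / 2) ^ n) \<longlonglongrightarrow> \<epsilon> * 0" by (intro tendsto_intros LIMSEQ_power_zero) simp
    then have e0: "e \<longlonglongrightarrow> 0" by (simp add: e_def[abs_def])
    have "(\<lambda>n. nrm Y (r (Suc n))) \<longlonglongrightarrow> 0"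
      by (rule tendsto_sandwich[OF always_eventually always_eventually tendsto_const e0])
        (simp_all add: rle Y.nrm_nonneg[OF r])
    then have "(\<lambda>n. nrm Y (r n)) \<longlonglongrightarrow> 0" by (rule LIMSEQ_imp_Suc)
    then have "(\<lambda>n. nrm Y (finsum M a {..<n} \<ominus> y)) \<longlonglongrightarrow> 0"
      by (simp add: rem Y.nrm_inv[OF r])
    then have "l = y"
      using limits_agree[OF whole.normed_subspace_axioms X.normed_subspace_axioms Y.normed_subspace_axioms
          X_bound Y_bound l(1) y, of "\<lambda>n. finsum M a {..<n}"] a l(2) rem r by auto
    then show ?thesis using l sums_unique[OF b] by simp
  qed
  have "nrm X y \<le> c * nrm Y y"
  proof (rule field_le_epsilon)
    fix d :: real assume d: "0 < d"
    have "(2 * c + 1) * (2 * (d / (2 * (2 * c + 1)))) = d" using c by (simp add: field_simps)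
    then show "nrm X y \<le> c * nrm Y y + d"
      using approx[of "d / (2 * (2 * c + 1))"] d c by simp
  qed
  then show ?thesis using approx[of 1] by simp
qed

text \<open>
  The expression under the limit is the norm of the rank-one operator \<open>F n (\<cdot>) u\<close>. The functionals minimize the
  ratio \<open>dual_norm Y f / dual_norm X f\<close>; its infimum \<open>c\<close> satisfies \<open>c * nrm Y u \<le> nrm X u\<close> by
  \<open>dual_domination\<close>, so the second term of the maximum is absorbed in the limit.
\<close>

lemma norm_X_as_limit:
  assumes u0: "u0 \<in> carrier X" "u0 \<in> carrier Y" "u0 \<noteq> \<zero>"
  obtains F where "\<And>n. bounded_functional M (F n)"
    "\<And>u. u \<in> carrier X \<Longrightarrow> u \<in> carrier Y \<Longrightarrow>
       (\<lambda>n :: nat. max (dual_norm X (F n) * nrm X u) (dual_norm Y (F n) * nrm Y u)) \<longlonglongrightarrow> nrm X u"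
proof -
  interpret sw: banach_pair M Y X by (rule swap)
  have scale: "bounded_functional M (\<lambda>x. c * f x)" if f: "bounded_functional M f" for c f
  proof -
    obtain C where "\<And>x. x \<in> carrier M \<Longrightarrow> norm (f x) \<le> C * nrm M x"
      using f unfolding bounded_functional_def by blast
    then have "norm (c * f x) \<le> (norm c * C) * nrm M x" if "x \<in> carrier M" for x
      using that by (auto simp: norm_mult mult.assoc intro!: mult_left_mono)
    moreover have "linear_functional M (\<lambda>x. c * f x)"
      using f by (auto simp: bounded_functional_def linear_functional_def algebra_simps)
    ultimately show ?thesis unfolding bounded_functional_def by blast
  qed
  have normalize: "\<exists>g. bounded_functional M g \<and> dual_norm X g = 1 \<and> dual_norm Y g = dual_norm Y f / dual_norm X f"
    if f: "bounded_functional M f" and pos: "dual_norm X f > 0" for f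
    using scale[OF f, of "of_real (1 / dual_norm X f)"] dual_X_cmult[OF f, of "of_real (1 / dual_norm X f)"]
      dual_Y_cmult[OF f, of "of_real (1 / dual_norm X f)"] pos
    by (intro exI[of _ "\<lambda>x. of_real (1 / dual_norm X f) * f x"]) (simp add: norm_divide)
  define Q where "Q = {dual_norm Y f | f. bounded_functional M f \<and> dual_norm X f = 1}"
  have Q0: "0 \<le> q" if "q \<in> Q" for q using that dual_Y_nonneg by (auto simp: Q_def)
  have bdd: "bdd_below Q" using Q0 by (rule bdd_belowI)
  have "K 1 u0 \<noteq> 0" using K_pos u0 by fastforce
  moreover obtain f where f: "bounded_functional M f" "norm (f u0) = K 1 u0"
    using norming_functional[of 1 u0] u0 by (metis X.mem zero_le_one)
  ultimately have "dual_norm X f \<noteq> 0"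
    using dual_X_bound[OF f(1) u0(1)] norm_ge_zero[of "f u0"] by (metis antisym mult_zero_left)
  then have Qne: "Q \<noteq> {}"
    using normalize[OF f(1)] dual_X_nonneg[OF f(1)] unfolding Q_def by force
  define c where "c = Inf Q"
  have c: "0 \<le> c" unfolding c_def using Q0 Qne by (intro cInf_greatest) auto
  have cle: "c * dual_norm X f \<le> dual_norm Y f" if f: "bounded_functional M f" for f
  proof (cases "dual_norm X f = 0")
    case True then show ?thesis using dual_Y_nonneg[OF f] by simp
  next
    case False
    then have pos: "dual_norm X f > 0" using dual_X_nonneg[OF f] by simp
    then have "dual_norm Y f / dual_norm X f \<in> Q"
      using normalize[OF f] unfolding Q_def by force
    then have "c \<le> dual_norm Y f / dual_norm X f" unfolding c_def using bdd by (rule cInf_lower)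
    then show ?thesis using pos by (simp add: field_simps)
  qed
  have cu: "c * nrm Y u \<le> nrm X u" if u: "u \<in> carrier X" for u
  proof (cases "c = 0")
    case False
    then have "c > 0" using c by simp
    then show ?thesis
      using sw.dual_domination[of "1 / c" u] cle u by (simp add: field_simps)
  qed (use u in auto)
  have "\<exists>f. bounded_functional M f \<and> dual_norm X f = 1 \<and> dual_norm Y f < c + 1 / (real n + 1)" for n
    using cInf_lessD[OF Qne, of "c + 1 / (real n + 1)"] unfolding Q_def c_def by force
  then obtain F where F: "\<And>n. bounded_functional M (F n)" "\<And>n. dual_norm X (F n) = 1"
    "\<And>n. dual_norm Y (F n) < c + 1 / (real n + 1)" by metis
  have inv: "(\<lambda>n. 1 / (real n + 1)) \<longlonglongrightarrow> 0"
    using LIMSEQ_inverse_real_of_nat by (simp add: inverse_eq_divide add.commute)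
  have upper: "(\<lambda>n. c + 1 / (real n + 1)) \<longlonglongrightarrow> c"
    using tendsto_add[OF tendsto_const inv, of c] by simp
  have lower: "c \<le> dual_norm Y (F n)" for n using cle[OF F(1)[of n]] F(2)[of n] by simp
  have lim: "(\<lambda>n. dual_norm Y (F n)) \<longlonglongrightarrow> c"
    by (rule tendsto_sandwich[OF always_eventually always_eventually tendsto_const upper])
      (use lower F(3) in \<open>auto intro: less_imp_le\<close>)
  show thesis
  proof
    show "bounded_functional M (F n)" for n by (rule F)
    fix u assume u: "u \<in> carrier X" "u \<in> carrier Y"
    have "(\<lambda>n. max (1 * nrm X u) (dual_norm Y (F n) * nrm Y u)) \<longlonglongrightarrow> max (1 * nrm X u) (c * nrm Y u)"
      by (intro tendsto_intros lim)
    then show "(\<lambda>n. max (dual_norm X (F n) * nrm X u) (dual_norm Y (F n) * nrm Y u)) \<longlonglongrightarrow> nrm X u"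
      using cu[OF u(1)] F(2) by (simp add: max_def)
  qed
qed

text \<open>
  \<open>K 0 x\<close> is the distance of \<open>x\<close> from \<open>X \<inter> Y\<close> in the norm of \<open>X\<close>, and a norming functional for it vanishes on \<open>Y\<close>.
\<close>

lemma intersection_dense:
  assumes "\<And>f. bounded_functional M f \<Longrightarrow> (\<And>y. y \<in> carrier Y \<Longrightarrow> f y = 0) \<Longrightarrow> (\<And>u. u \<in> carrier M \<Longrightarrow> f u = 0)"
    and x: "x \<in> carrier X" and e: "0 < e"
  obtains d where "d \<in> carrier X" "d \<in> carrier Y" "nrm X (x \<ominus> d) < e"
proof -
  obtain f where f: "bounded_functional M f" "norm (f x) = K 0 x" "dual_norm Y f \<le> 0"
    using norming_functional[of 0 x] x by auto
  have "f y = 0" if y: "y \<in> carrier Y" for y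
    using dual_Y_bound[OF f(1) y] f(3) dual_Y_nonneg[OF f(1)] by simp
  then have "K 0 x = 0" using assms(1)[OF f(1), of x] f(2) x by auto
  obtain a y where ay: "a \<in> carrier X" "y \<in> carrier Y" "x = a \<oplus> y" "nrm X a + 0 * nrm Y y < K 0 x + e"
    by (rule K_approx[OF X.mem[OF x] e])
  with \<open>K 0 x = 0\<close> have small: "nrm X a < e" by simp
  have aM: "a \<in> carrier M" and yM: "y \<in> carrier M" using ay by auto
  have "x \<ominus> a = y \<oplus> a \<ominus> a" using ay(3) M.a_comm[OF aM yM] by simp
  also have "\<dots> = y" using aM yM by (simp add: a_minus_def M.a_assoc M.r_neg)
  finally have xa: "x \<ominus> a = y" .
  have xy: "x \<ominus> y = a" unfolding ay(3) using aM yM by (simp add: a_minus_def M.a_assoc M.r_neg)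
  have "y \<in> carrier X" using X.minus_mem[OF x ay(1)] xa by simp
  then show thesis using that[of y] ay(2) small xy by simp
qed

end

section \<open>Proportionality and maxima\<close>

definition proportional_on :: "'a set \<Rightarrow> ('a \<Rightarrow> real) \<Rightarrow> ('a \<Rightarrow> real) \<Rightarrow> bool" where
  "proportional_on D f g \<longleftrightarrow> (\<exists>c>0. \<forall>u\<in>D. f u = c * g u)"

lemma proportional_on_sym: "proportional_on D f g \<Longrightarrow> proportional_on D g f"
  unfolding proportional_on_def
proof (elim exE conjE)
  fix c :: real assume "0 < c" "\<forall>u\<in>D. f u = c * g u"
  then show "\<exists>c>0. \<forall>u\<in>D. g u = c * f u" by (intro exI[of _ "1 / c"]) auto
qed

lemma proportional_on_trans:
  "proportional_on D f g \<Longrightarrow> proportional_on D g h \<Longrightarrow> proportional_on D f h"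
  unfolding proportional_on_def
proof (elim exE conjE)
  fix a b :: real assume "0 < a" "\<forall>u\<in>D. f u = a * g u" "0 < b" "\<forall>u\<in>D. g u = b * h u"
  then show "\<exists>c>0. \<forall>u\<in>D. f u = c * h u" by (intro exI[of _ "a * b"]) auto
qed

definition max_comb_on :: "'a set \<Rightarrow> ('a \<Rightarrow> real) \<Rightarrow> ('a \<Rightarrow> real) \<Rightarrow> ('a \<Rightarrow> real) \<Rightarrow> bool" where
  "max_comb_on D h f g \<longleftrightarrow> (\<exists>a\<ge>0. \<exists>b\<ge>0. \<forall>u\<in>D. h u = max (a * f u) (b * g u))"

lemma max_comb_of_proportional:
  assumes "max_comb_on D h f g" "proportional_on D f g" "\<And>u. u \<in> D \<Longrightarrow> 0 < h u" "\<And>u. u \<in> D \<Longrightarrow> 0 < g u"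
  shows "proportional_on D h g"
proof (cases "D = {}")
  case True then show ?thesis by (auto simp: proportional_on_def intro: exI[of _ 1])
next
  case False
  then obtain u0 where u0: "u0 \<in> D" by blast
  obtain a b where ab: "0 \<le> a" "0 \<le> b" "\<And>u. u \<in> D \<Longrightarrow> h u = max (a * f u) (b * g u)"
    using assms(1) unfolding max_comb_on_def by blast
  obtain c where c: "0 < c" "\<And>u. u \<in> D \<Longrightarrow> f u = c * g u"
    using assms(2) unfolding proportional_on_def by blast
  have eq: "h u = max (a * c) b * g u" if "u \<in> D" for u
    using ab(3)[OF that] c(2)[OF that] assms(4)[OF that] by (simp add: max_mult_distrib_right)
  have "0 < max (a * c) b"
    using eq[OF u0] assms(3,4)[OF u0] by (simp add: zero_less_mult_iff)
  then show ?thesis using eq unfolding proportional_on_def by blast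
qed

text \<open>
  Substituting the formulas for \<open>r\<close> and \<open>s\<close> into that for \<open>p\<close> gives \<open>p = max (a' * p) (b' * q)\<close>. If \<open>a' < 1\<close>, then
  \<open>p\<close> is a multiple of \<open>q\<close>. If \<open>a' = 1\<close>, then one of the two terms \<open>a * r\<close> and \<open>b * s\<close> of the maximum \<open>p\<close> is
  already at least \<open>p\<close>, hence equal to it.
\<close>

lemma max_comb_extremal:
  assumes p: "max_comb_on D p r s" and r: "max_comb_on D r p q" and s: "max_comb_on D s p q"
    and pos: "\<And>u. u \<in> D \<Longrightarrow> 0 < p u" and posq: "\<And>u. u \<in> D \<Longrightarrow> 0 < q u"
  shows "proportional_on D p r \<or> proportional_on D p s \<or> proportional_on D p q"
proof (cases "D = {}")
  case True then show ?thesis by (auto simp: proportional_on_def intro: exI[of _ 1])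
next
  case False
  then obtain u0 where u0: "u0 \<in> D" by blast
  obtain a b where ab: "0 \<le> a" "0 \<le> b" "\<And>u. u \<in> D \<Longrightarrow> p u = max (a * r u) (b * s u)"
    using p unfolding max_comb_on_def by blast
  obtain c d where cd: "0 \<le> c" "0 \<le> d" "\<And>u. u \<in> D \<Longrightarrow> r u = max (c * p u) (d * q u)"
    using r unfolding max_comb_on_def by blast
  obtain c' d' where cd': "0 \<le> c'" "0 \<le> d'" "\<And>u. u \<in> D \<Longrightarrow> s u = max (c' * p u) (d' * q u)"
    using s unfolding max_comb_on_def by blast
  have ar: "a * r u = max (a * c * p u) (a * d * q u)" if "u \<in> D" for u
    using cd(3)[OF that] ab(1) by (simp add: max_mult_distrib_left mult.assoc)
  have bs: "b * s u = max (b * c' * p u) (b * d' * q u)" if "u \<in> D" for u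
    using cd'(3)[OF that] ab(2) by (simp add: max_mult_distrib_left mult.assoc)
  have "a * c * p u0 \<le> 1 * p u0" "b * c' * p u0 \<le> 1 * p u0"
    using ab(3)[OF u0] ar[OF u0] bs[OF u0] by auto
  then have le1: "a * c \<le> 1" "b * c' \<le> 1"
    using pos[OF u0] by (simp_all del: mult_1)
  consider "a * c = 1" | "b * c' = 1" | "a * c < 1" "b * c' < 1" using le1 by linarith
  then show ?thesis
  proof cases
    case 1
    then have "a > 0" using ab(1) by (cases "a = 0") auto
    moreover have "p u = a * r u" if "u \<in> D" for u
      using ab(3)[OF that] ar[OF that] 1 by simp
    ultimately show ?thesis unfolding proportional_on_def by blast
  next
    case 2
    then have "b > 0" using ab(2) by (cases "b = 0") auto
    moreover have "p u = b * s u" if "u \<in> D" for u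
      using ab(3)[OF that] bs[OF that] 2 by simp
    ultimately show ?thesis unfolding proportional_on_def by blast
  next
    case 3
    have eq: "p u = max (a * d * q u) (b * d' * q u)" if "u \<in> D" for u
    proof -
      have "a * c * p u < 1 * p u" "b * c' * p u < 1 * p u"
        using mult_strict_right_mono[OF 3(1) pos[OF that]] mult_strict_right_mono[OF 3(2) pos[OF that]]
        by simp_all
      moreover have "p u = max (max (a * c * p u) (a * d * q u)) (max (b * c' * p u) (b * d' * q u))"
        using ab(3)[OF that] unfolding ar[OF that] bs[OF that] .
      moreover have "w = max y z" if "x < 1 * w" "x' < 1 * w" "w = max (max x y) (max x' z)" for x x' y z w :: real
        using that by (simp add: max_def split: if_splits)
      ultimately show ?thesis by blast
    qed
    have eq': "p u = max (a * d) (b * d') * q u" if "u \<in> D" for u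
      using eq[OF that] posq[OF that] by (simp add: max_mult_distrib_right)
    have "0 < max (a * d) (b * d')"
      using eq'[OF u0] pos[OF u0] posq[OF u0] by (simp add: zero_less_mult_iff)
    then show ?thesis using eq' unfolding proportional_on_def by blast
  qed
qed

lemma max_comb_match:
  assumes p: "max_comb_on D p r s" and q: "max_comb_on D q r s"
    and r: "max_comb_on D r p q" and s: "max_comb_on D s p q"
    and pos: "\<And>u. u \<in> D \<Longrightarrow> 0 < p u" "\<And>u. u \<in> D \<Longrightarrow> 0 < q u"
      "\<And>u. u \<in> D \<Longrightarrow> 0 < r u" "\<And>u. u \<in> D \<Longrightarrow> 0 < s u"
  shows "(proportional_on D p r \<and> proportional_on D q s) \<or> (proportional_on D p s \<and> proportional_on D q r)"
proof -
  have comm: "max_comb_on D h g f" if "max_comb_on D h f g" for f g h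
    using that unfolding max_comb_on_def by (metis max.commute)
  note sym = proportional_on_sym and trans = proportional_on_trans
  have P: "proportional_on D p r \<or> proportional_on D p s \<or> proportional_on D p q"
    by (rule max_comb_extremal[OF p r s pos(1,2)])
  have Q: "proportional_on D q r \<or> proportional_on D q s \<or> proportional_on D q p"
    by (rule max_comb_extremal[OF q comm[OF r] comm[OF s] pos(2,1)])
  show ?thesis
  proof (cases "proportional_on D p q")
    case True
    have "proportional_on D r q" "proportional_on D s q"
      using max_comb_of_proportional[OF r True pos(3,2)] max_comb_of_proportional[OF s True pos(4,2)]
      by auto
    then show ?thesis using True sym trans by metis
  next
    case False
    then show ?thesis using P Q sym trans by metis
  qed
qed

section \<open>Two pairs with the same rank-one invariance\<close>

text \<open>
  Stability of \<open>Z\<close> under the operators \<open>x \<mapsto> f x \<odot> u\<close>, stated without operators. Such an operator maps \<open>X\<close> into \<open>X\<close>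
  if \<open>u\<close> is in \<open>X\<close> or \<open>f\<close> vanishes on \<open>X\<close>, and similarly for \<open>Y\<close>. This gives a two-sided case, in
  which \<open>u\<close> is in both spaces, and a one-sided case. In the first, the membership of \<open>u\<close> in
  \<open>Z\<close> is part of the requirement that \<open>Z\<close> is intermediate.
\<close>

definition two_sided_stable ::
  "('k::real_or_complex, 'a) nspace \<Rightarrow> ('k, 'a) nspace \<Rightarrow> ('k, 'a) nspace \<Rightarrow> ('k, 'a) nspace \<Rightarrow> bool" where
  "two_sided_stable M X Y Z \<longleftrightarrow> (\<forall>f u. bounded_functional M f \<longrightarrow> u \<in> carrier X \<longrightarrow> u \<in> carrier Y \<longrightarrow>
     u \<in> carrier Z \<and>
     dual_norm Z f * nrm Z u \<le> max (dual_norm X f * nrm X u) (dual_norm Y f * nrm Y u))"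

definition one_sided_stable ::
  "('k::real_or_complex, 'a) nspace \<Rightarrow> ('k, 'a) nspace \<Rightarrow> ('k, 'a) nspace \<Rightarrow> ('k, 'a) nspace \<Rightarrow> bool" where
  "one_sided_stable M X Y Z \<longleftrightarrow> (\<forall>f u z. bounded_functional M f \<longrightarrow> (\<forall>y\<in>carrier Y. f y = 0) \<longrightarrow>
     u \<in> carrier X \<longrightarrow> z \<in> carrier Z \<longrightarrow> f z \<noteq> 0 \<longrightarrow>
     u \<in> carrier Z \<and> dual_norm Z f * nrm Z u \<le> dual_norm X f * nrm X u)"

definition rank_one_stable ::
  "('k::real_or_complex, 'a) nspace \<Rightarrow> ('k, 'a) nspace \<Rightarrow> ('k, 'a) nspace \<Rightarrow> ('k, 'a) nspace \<Rightarrow> bool" where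
  "rank_one_stable M X Y Z \<longleftrightarrow>
     two_sided_stable M X Y Z \<and> one_sided_stable M X Y Z \<and> one_sided_stable M Y X Z"

lemma rank_one_stable_commute: "rank_one_stable M X Y Z \<Longrightarrow> rank_one_stable M Y X Z"
  by (simp add: rank_one_stable_def two_sided_stable_def max.commute)

text \<open>
  By Hahn--Banach this says that \<open>E\<close> is not dense in \<open>M\<close>. For \<open>E = Y\<close> in a pair it means that \<open>X \<inter> Y\<close> is not dense in \<open>X\<close>.
\<close>

definition annihilated :: "('k::real_or_complex, 'a) nspace \<Rightarrow> ('k, 'a) nspace \<Rightarrow> bool" where
  "annihilated M E \<longleftrightarrow>
     (\<exists>f. bounded_functional M f \<and> (\<forall>y\<in>carrier E. f y = 0) \<and> (\<exists>u\<in>carrier M. f u \<noteq> 0))"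

lemma zero_functional: "vspace M \<Longrightarrow> bounded_functional M (\<lambda>_. 0)"
  by (auto simp: bounded_functional_def linear_functional_def intro: exI[of _ 0])

context vspace
begin

lemma linear_subspaceI:
  assumes E: "normed_subspace M E" and F: "normed_subspace M F" and sub: "carrier E \<subseteq> carrier F"
  shows "linear_subspace E F"
proof -
  interpret E: normed_subspace M E by fact
  interpret F: normed_subspace M F by fact
  show ?thesis
    unfolding linear_subspace_def
  proof (intro conjI ballI allI sub)
    show "vec_space E" "vec_space F" using E.vspace F.vspace by (simp_all add: vspace_def)
    show "\<zero>\<^bsub>E\<^esub> = \<zero>\<^bsub>F\<^esub>" using E.zero_eq F.zero_eq by metis
  next
    fix x y assume xy: "x \<in> carrier E" "y \<in> carrier E"
    show "x \<oplus>\<^bsub>E\<^esub> y = x \<oplus>\<^bsub>F\<^esub> y"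
      using E.add_eq[OF xy] F.add_eq[OF subsetD[OF sub xy(1)] subsetD[OF sub xy(2)]] by (rule trans[OF _ sym])
  next
    fix c x assume x: "x \<in> carrier E"
    show "c \<odot>\<^bsub>E\<^esub> x = c \<odot>\<^bsub>F\<^esub> x"
      using E.smul_eq[OF x] F.smul_eq[OF subsetD[OF sub x]] by (rule trans[OF _ sym])
  qed
qed

lemma proportionalI:
  assumes E: "normed_subspace M E" and F: "normed_subspace M F" and eq: "carrier E = carrier F"
    and norms: "proportional_on (carrier E) (nrm E) (nrm F)"
  shows "E \<cong>\<^sub>p F"
  using linear_subspaceI[OF E F] linear_subspaceI[OF F E] eq proportional_on_sym[OF norms]
  unfolding proportional_def proportional_on_def by simp

end

lemma proportional_carrier: "E \<cong>\<^sub>p F \<Longrightarrow> carrier E = carrier F"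
  by (auto simp: proportional_def linear_subspace_def)

lemma proportional_commute:
  assumes "E \<cong>\<^sub>p F" shows "F \<cong>\<^sub>p E"
proof -
  have "proportional_on (carrier E) (nrm F) (nrm E)"
    using assms unfolding proportional_def proportional_on_def by blast
  then have "proportional_on (carrier F) (nrm E) (nrm F)"
    unfolding proportional_carrier[OF assms] by (rule proportional_on_sym)
  then show ?thesis using assms unfolding proportional_def proportional_on_def by blast
qed

lemma dense_extension_subset:
  fixes M E F :: "('k::real_or_complex, 'a) nspace"
  assumes M: "normed_subspace M M" and E: "normed_subspace M E" and F: "normed_subspace M F"
    and F_banach: "banach_space F"
    and E_bound: "\<exists>C. \<forall>x\<in>carrier E. nrm M x \<le> C * nrm E x"
    and F_bound: "\<exists>C. \<forall>x\<in>carrier F. nrm M x \<le> C * nrm F x"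
    and D: "D \<subseteq> carrier E" "D \<subseteq> carrier F" "\<And>x y. x \<in> D \<Longrightarrow> y \<in> D \<Longrightarrow> x \<ominus>\<^bsub>M\<^esub> y \<in> D"
    and dense: "\<And>x e. x \<in> carrier E \<Longrightarrow> 0 < e \<Longrightarrow> \<exists>d\<in>D. nrm E (x \<ominus>\<^bsub>M\<^esub> d) < e"
    and a: "0 < a" "\<And>d. d \<in> D \<Longrightarrow> nrm E d = a * nrm F d"
    and x: "x \<in> carrier E"
  shows "x \<in> carrier F \<and> nrm E x = a * nrm F x"
proof -
  interpret M: normed_subspace M M by fact
  interpret E: normed_subspace M E by fact
  interpret F: normed_subspace M F by fact
  have "\<exists>d\<in>D. nrm E (x \<ominus>\<^bsub>M\<^esub> d) < 1 / (real n + 1)" for n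
    using dense[OF x] by simp
  then obtain s where s: "\<And>n. s n \<in> D" "\<And>n. nrm E (x \<ominus>\<^bsub>M\<^esub> s n) < 1 / (real n + 1)" by metis
  have sE: "s n \<in> carrier E" and sF: "s n \<in> carrier F" for n using s(1) D by auto
  have inv: "(\<lambda>n. 1 / (real n + 1)) \<longlonglongrightarrow> 0"
    using LIMSEQ_inverse_real_of_nat by (simp add: inverse_eq_divide add.commute)
  have sx: "nrm E (s n \<ominus>\<^bsub>M\<^esub> x) \<le> 1 / (real n + 1)" for n
    using s(2)[of n] E.nrm_minus_commute[OF x sE, of n] by simp
  have limE: "(\<lambda>n. nrm E (s n \<ominus>\<^bsub>M\<^esub> x)) \<longlonglongrightarrow> 0"
    by (rule tendsto_sandwich[OF always_eventually always_eventually tendsto_const inv])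
      (simp_all add: sx sE x)
  have "\<exists>N. \<forall>m\<ge>N. \<forall>n\<ge>N. nrm F (s m \<ominus>\<^bsub>M\<^esub> s n) < e" if e: "e > 0" for e
  proof -
    have "0 < a * e / 2" using a e by simp
    then obtain N where N: "\<And>n. n \<ge> N \<Longrightarrow> nrm E (s n \<ominus>\<^bsub>M\<^esub> x) < a * e / 2"
      using order_tendstoD(2)[OF limE] unfolding eventually_sequentially by blast
    have "nrm F (s m \<ominus>\<^bsub>M\<^esub> s n) < e" if "m \<ge> N" "n \<ge> N" for m n
    proof -
      have "a * nrm F (s m \<ominus>\<^bsub>M\<^esub> s n) = nrm E (s m \<ominus>\<^bsub>M\<^esub> s n)"
        using a(2)[OF D(3)[OF s(1) s(1)]] by simp
      also have "\<dots> \<le> nrm E (s m \<ominus>\<^bsub>M\<^esub> x) + nrm E (x \<ominus>\<^bsub>M\<^esub> s n)"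
        by (rule E.nrm_triangle[OF sE x sE])
      also have "\<dots> < a * e"
        using N[OF that(1)] N[OF that(2)] E.nrm_minus_commute[OF x sE, of n] by simp
      finally show ?thesis using a(1) by simp
    qed
    then show ?thesis by blast
  qed
  with F_banach sF obtain l where l: "l \<in> carrier F" "(\<lambda>n. nrm F (s n \<ominus>\<^bsub>M\<^esub> l)) \<longlonglongrightarrow> 0"
    by (rule F.banach_cauchy_convergent)
  have xl: "x = l"
    using limits_agree[OF M E F E_bound F_bound x l(1) sE F.minus_mem[OF sF l(1)] limE l(2)] .
  have conv: "(\<lambda>n. nrm G (s n)) \<longlonglongrightarrow> nrm G x"
    if G: "normed_subspace M G" and mem: "x \<in> carrier G" "\<And>n. s n \<in> carrier G"
      and lim: "(\<lambda>n. nrm G (s n \<ominus>\<^bsub>M\<^esub> x)) \<longlonglongrightarrow> 0" for G :: "('k, 'a) nspace"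
  proof -
    interpret G: normed_subspace M G by fact
    have "norm (nrm G (s n) - nrm G x) \<le> nrm G (s n \<ominus>\<^bsub>M\<^esub> x)" for n
      using G.nrm_le_plus_diff[OF mem(2) mem(1), of n] G.nrm_le_plus_diff[OF mem(1) mem(2), of n]
        G.nrm_minus_commute[OF mem(1) mem(2), of n] by simp
    then have "(\<lambda>n. nrm G (s n) - nrm G x) \<longlonglongrightarrow> 0"
      by (intro Lim_null_comparison[OF _ lim]) simp
    then show ?thesis using LIM_zero_iff by blast
  qed
  have xF: "x \<in> carrier F" using xl l by simp
  have "(\<lambda>n. a * nrm F (s n)) \<longlonglongrightarrow> a * nrm F x"
    using conv[OF F xF sF] l(2) xl by (intro tendsto_mult_left) simp
  moreover have "(\<lambda>n. a * nrm F (s n)) \<longlonglongrightarrow> nrm E x"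
    using conv[OF E x sE limE] a(2)[OF s(1)] by simp
  ultimately show ?thesis using LIMSEQ_unique xF by blast
qed

lemma proportional_on_add_zero:
  assumes "proportional_on (A - {z}) f g" "f z = 0" "g z = 0"
  shows "proportional_on A f g"
proof -
  obtain c where c: "0 < c" "\<forall>u\<in>A - {z}. f u = c * g u"
    using assms(1) unfolding proportional_on_def by auto
  have "\<forall>u\<in>A. f u = c * g u"
  proof
    fix u assume "u \<in> A"
    then show "f u = c * g u" using c(2) assms(2,3) by (cases "u = z") auto
  qed
  with c(1) show ?thesis unfolding proportional_on_def by auto
qed

locale two_pairs = XY: banach_pair M X Y + VW: banach_pair M V W
  for M X Y V W :: "('k::real_or_complex, 'a) nspace" +
  assumes stable_V: "rank_one_stable M X Y V" and stable_W: "rank_one_stable M X Y W"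
    and stable_X: "rank_one_stable M V W X" and stable_Y: "rank_one_stable M V W Y"
begin

lemma swap_XY: "two_pairs M Y X V W"
  using XY.swap VW.banach_pair_axioms rank_one_stable_commute[OF stable_V]
    rank_one_stable_commute[OF stable_W] stable_X stable_Y
  by (simp add: two_pairs_def two_pairs_axioms_def)

lemma swap_VW: "two_pairs M X Y W V"
  using XY.banach_pair_axioms VW.swap rank_one_stable_commute[OF stable_X]
    rank_one_stable_commute[OF stable_Y] stable_V stable_W
  by (simp add: two_pairs_def two_pairs_axioms_def)

lemma exchange: "two_pairs M V W X Y"
  using XY.banach_pair_axioms VW.banach_pair_axioms stable_V stable_W stable_X stable_Y
  by (simp add: two_pairs_def two_pairs_axioms_def)

lemma intersection_subset: "carrier X \<inter> carrier Y \<subseteq> carrier V \<inter> carrier W"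
  using stable_V stable_W zero_functional[OF XY.vspace_axioms]
  unfolding rank_one_stable_def two_sided_stable_def by blast

lemma intersection_eq: "carrier X \<inter> carrier Y = carrier V \<inter> carrier W"
  using intersection_subset two_pairs.intersection_subset[OF exchange] by blast

lemma rank_one_norm_le:
  assumes "bounded_functional M f" "u \<in> carrier X" "u \<in> carrier Y"
  shows "max (dual_norm V f * nrm V u) (dual_norm W f * nrm W u)
    \<le> max (dual_norm X f * nrm X u) (dual_norm Y f * nrm Y u)"
  using stable_V stable_W assms unfolding rank_one_stable_def two_sided_stable_def
  by (intro max.boundedI) blast+

lemma rank_one_norm_eq:
  assumes f: "bounded_functional M f" and u: "u \<in> carrier X" "u \<in> carrier Y"
  shows "max (dual_norm X f * nrm X u) (dual_norm Y f * nrm Y u)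
    = max (dual_norm V f * nrm V u) (dual_norm W f * nrm W u)"
proof (rule antisym)
  have "u \<in> carrier V" "u \<in> carrier W" using intersection_subset u by auto
  then show "max (dual_norm X f * nrm X u) (dual_norm Y f * nrm Y u)
    \<le> max (dual_norm V f * nrm V u) (dual_norm W f * nrm W u)"
    by (rule two_pairs.rank_one_norm_le[OF exchange f])
qed (rule rank_one_norm_le[OF f u])

abbreviation D where "D \<equiv> carrier X \<inter> carrier Y - {\<zero>\<^bsub>M\<^esub>}"

text \<open>
  The operator norms that approximate \<open>nrm X u\<close> are also maxima of multiples of \<open>nrm V u\<close> and \<open>nrm W u\<close>. The
  coefficients do not depend on \<open>u\<close> and are bounded, as one sees at a single \<open>u \<noteq> 0\<close>, so a subsequence of them converges.
\<close>

lemma norm_X_max_comb: "max_comb_on D (nrm X) (nrm V) (nrm W)"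
proof (cases "D = {}")
  case True then show ?thesis unfolding max_comb_on_def by (metis empty_iff order_refl)
next
  case False
  then obtain u0 where u0: "u0 \<in> carrier X" "u0 \<in> carrier Y" "u0 \<noteq> \<zero>\<^bsub>M\<^esub>" by blast
  have DVW: "u \<in> carrier V" "u \<in> carrier W" if "u \<in> carrier X" "u \<in> carrier Y" for u
    using intersection_subset that by auto
  obtain F where F: "\<And>n. bounded_functional M (F n)"
    and lim: "\<And>u. u \<in> carrier X \<Longrightarrow> u \<in> carrier Y \<Longrightarrow>
       (\<lambda>n :: nat. max (dual_norm X (F n) * nrm X u) (dual_norm Y (F n) * nrm Y u)) \<longlonglongrightarrow> nrm X u"
    using XY.norm_X_as_limit[OF u0] by blast
  define a where "a n = dual_norm V (F n)" for n
  define b where "b n = dual_norm W (F n)" for n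
  have ab0: "0 \<le> a n" "0 \<le> b n" for n
    using VW.dual_X_nonneg[OF F] VW.dual_Y_nonneg[OF F] by (auto simp: a_def b_def)
  have lim': "(\<lambda>n. max (a n * nrm V u) (b n * nrm W u)) \<longlonglongrightarrow> nrm X u"
    if "u \<in> carrier X" "u \<in> carrier Y" for u
    using lim[OF that] unfolding rank_one_norm_eq[OF F that] a_def b_def .
  obtain B where B: "\<And>n. \<bar>max (a n * nrm V u0) (b n * nrm W u0)\<bar> \<le> B"
    using convergent_imp_Bseq[OF convergentI[OF lim'[OF u0(1,2)]]] unfolding Bseq_def by auto
  have pos: "0 < nrm V u0" "0 < nrm W u0"
    using VW.X.nrm_pos[OF DVW(1)[OF u0(1,2)] u0(3)] VW.Y.nrm_pos[OF DVW(2)[OF u0(1,2)] u0(3)] by auto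
  have "norm (a n, b n) \<le> B / nrm V u0 + B / nrm W u0" for n
  proof -
    have "a n * nrm V u0 \<le> B" "b n * nrm W u0 \<le> B" using B[of n] by linarith+
    then have "a n \<le> B / nrm V u0" "b n \<le> B / nrm W u0" using pos by (simp_all add: pos_le_divide_eq)
    then show ?thesis using norm_Pair_le[of "a n" "b n"] ab0[of n] by simp
  qed
  then have "bounded (range (\<lambda>n. (a n, b n)))" by (auto simp: bounded_iff)
  then obtain l r where r: "strict_mono (r :: nat \<Rightarrow> nat)" and l: "((\<lambda>n. (a n, b n)) \<circ> r) \<longlonglongrightarrow> l"
    using bounded_imp_convergent_subsequence by blast
  have la: "(\<lambda>n. a (r n)) \<longlonglongrightarrow> fst l" and lb: "(\<lambda>n. b (r n)) \<longlonglongrightarrow> snd l"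
    using tendsto_fst[OF l] tendsto_snd[OF l] by (simp_all add: o_def)
  have "0 \<le> fst l" "0 \<le> snd l"
    using LIMSEQ_le_const[OF la] LIMSEQ_le_const[OF lb] ab0 by blast+
  moreover have "nrm X u = max (fst l * nrm V u) (snd l * nrm W u)" if "u \<in> D" for u
  proof -
    have "(\<lambda>n. max (a (r n) * nrm V u) (b (r n) * nrm W u)) \<longlonglongrightarrow> nrm X u"
      using LIMSEQ_subseq_LIMSEQ[OF lim' r, of u] that by (simp add: o_def)
    moreover have "(\<lambda>n. max (a (r n) * nrm V u) (b (r n) * nrm W u)) \<longlonglongrightarrow> max (fst l * nrm V u) (snd l * nrm W u)"
      by (intro tendsto_intros la lb)
    ultimately show ?thesis by (rule LIMSEQ_unique)
  qed
  ultimately show ?thesis unfolding max_comb_on_def by blast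
qed

lemma norms_match_on_intersection:
  "(proportional_on (carrier X \<inter> carrier Y) (nrm X) (nrm V) \<and> proportional_on (carrier X \<inter> carrier Y) (nrm Y) (nrm W)) \<or>
   (proportional_on (carrier X \<inter> carrier Y) (nrm X) (nrm W) \<and> proportional_on (carrier X \<inter> carrier Y) (nrm Y) (nrm V))"
proof -
  have eqs: "carrier Y \<inter> carrier X = carrier X \<inter> carrier Y" "carrier V \<inter> carrier W = carrier X \<inter> carrier Y"
    "carrier W \<inter> carrier V = carrier X \<inter> carrier Y" using intersection_eq by auto
  have D: "u \<in> carrier X" "u \<in> carrier Y" "u \<in> carrier V" "u \<in> carrier W" "u \<noteq> \<zero>\<^bsub>M\<^esub>" if "u \<in> D" for u
    using that intersection_eq by auto
  have match: "(proportional_on D (nrm X) (nrm V) \<and> proportional_on D (nrm Y) (nrm W)) \<or>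
     (proportional_on D (nrm X) (nrm W) \<and> proportional_on D (nrm Y) (nrm V))"
  proof (rule max_comb_match)
    show "max_comb_on D (nrm X) (nrm V) (nrm W)" by (rule norm_X_max_comb)
    show "max_comb_on D (nrm Y) (nrm V) (nrm W)"
      using two_pairs.norm_X_max_comb[OF swap_XY] unfolding eqs .
    show "max_comb_on D (nrm V) (nrm X) (nrm Y)"
      using two_pairs.norm_X_max_comb[OF exchange] unfolding eqs .
    show "max_comb_on D (nrm W) (nrm X) (nrm Y)"
      using two_pairs.norm_X_max_comb[OF two_pairs.swap_XY[OF exchange]] unfolding eqs .
    fix u assume u: "u \<in> D"
    show "0 < nrm X u" by (rule XY.X.nrm_pos[OF D(1,5)[OF u]])
    show "0 < nrm Y u" by (rule XY.Y.nrm_pos[OF D(2,5)[OF u]])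
    show "0 < nrm V u" by (rule VW.X.nrm_pos[OF D(3,5)[OF u]])
    show "0 < nrm W u" by (rule VW.Y.nrm_pos[OF D(4,5)[OF u]])
  qed
  note ext = proportional_on_add_zero[of "carrier X \<inter> carrier Y" "\<zero>\<^bsub>M\<^esub>"]
  note zeros = XY.X.nrm_zero XY.Y.nrm_zero VW.X.nrm_zero VW.Y.nrm_zero
  from match show ?thesis
  proof (elim disjE conjE)
    assume "proportional_on D (nrm X) (nrm V)" "proportional_on D (nrm Y) (nrm W)"
    then show ?thesis using ext[of "nrm X" "nrm V"] ext[of "nrm Y" "nrm W"] zeros by simp
  next
    assume "proportional_on D (nrm X) (nrm W)" "proportional_on D (nrm Y) (nrm V)"
    then show ?thesis using ext[of "nrm X" "nrm W"] ext[of "nrm Y" "nrm V"] zeros by simp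
  qed
qed

text \<open>
  The operators \<open>z \<mapsto> f z \<odot> u\<close> with \<open>u\<close> in \<open>X\<close> map \<open>V\<close> into itself, and \<open>f\<close> is nonzero on \<open>V\<close>, so \<open>u\<close> belongs to
  \<open>V\<close>. The norm estimate, together with its mirror image, determines the ratio of the two norms.
\<close>

lemma one_sided:
  assumes f: "bounded_functional M f" and fY: "\<And>y. y \<in> carrier Y \<Longrightarrow> f y = 0"
    and fW: "\<And>w. w \<in> carrier W \<Longrightarrow> f w = 0" and nz: "u \<in> carrier M" "f u \<noteq> 0"
  shows "X \<cong>\<^sub>p V"
proof -
  have lin: "linear_functional M f" using f by (simp add: bounded_functional_def)
  obtain x where x: "x \<in> carrier X" "f x \<noteq> 0" using XY.functional_determined[OF lin _ fY nz(1)] nz(2) by blast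
  obtain v where v: "v \<in> carrier V" "f v \<noteq> 0" using VW.functional_determined[OF lin _ fW nz(1)] nz(2) by blast
  have XV: "z \<in> carrier V" "dual_norm V f * nrm V z \<le> dual_norm X f * nrm X z" if "z \<in> carrier X" for z
    using stable_V f fY that v unfolding rank_one_stable_def one_sided_stable_def by blast+
  have VX: "z \<in> carrier X" "dual_norm X f * nrm X z \<le> dual_norm V f * nrm V z" if "z \<in> carrier V" for z
    using stable_X f fW that x unfolding rank_one_stable_def one_sided_stable_def by blast+
  have "dual_norm X f \<noteq> 0" "dual_norm V f \<noteq> 0"
    using XY.dual_X_bound[OF f x(1)] VW.dual_X_bound[OF f v(1)] x(2) v(2) by auto
  then have pos: "dual_norm X f > 0" "dual_norm V f > 0"
    using XY.dual_X_nonneg[OF f] VW.dual_X_nonneg[OF f] by auto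
  have "nrm X z = (dual_norm V f / dual_norm X f) * nrm V z" if "z \<in> carrier X" for z
    using XV[OF that] VX(2)[OF XV(1)[OF that]] pos by (simp add: field_simps)
  then have "proportional_on (carrier X) (nrm X) (nrm V)"
    unfolding proportional_on_def using pos by (intro exI[of _ "dual_norm V f / dual_norm X f"]) auto
  then show ?thesis
    using XV(1) VX(1) by (intro XY.proportionalI XY.X.normed_subspace_axioms VW.X.normed_subspace_axioms) auto
qed

lemma carrier_neq:
  assumes "annihilated M Y" shows "carrier X \<noteq> carrier Y"
  using assms XY.functional_determined unfolding annihilated_def bounded_functional_def by metis

text \<open>
  If \<open>f\<close> were nonzero on both \<open>V\<close> and \<open>W\<close>, the operators \<open>z \<mapsto> f z \<odot> u\<close> would force \<open>X \<subseteq> V \<inter> W = X \<inter> Y\<close>, and \<open>f\<close>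
  would vanish on \<open>X\<close> too. So \<open>one_sided\<close> applies to exactly one of the spaces.
\<close>

lemma annihilated_cases:
  assumes ann: "annihilated M Y"
  shows "(X \<cong>\<^sub>p V \<and> annihilated M W) \<or> (X \<cong>\<^sub>p W \<and> annihilated M V)"
proof -
  obtain f u where f: "bounded_functional M f" and fY: "\<And>y. y \<in> carrier Y \<Longrightarrow> f y = 0"
    and u: "u \<in> carrier M" "f u \<noteq> 0"
    using ann unfolding annihilated_def by blast
  have lin: "linear_functional M f" using f by (simp add: bounded_functional_def)
  show ?thesis
  proof (cases "\<forall>w\<in>carrier W. f w = 0")
    case True
    then show ?thesis using one_sided[OF f fY _ u] f u unfolding annihilated_def by blast
  next
    case W: False
    show ?thesis
    proof (cases "\<forall>v\<in>carrier V. f v = 0")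
      case True
      then show ?thesis
        using two_pairs.one_sided[OF swap_VW f fY _ u] f u unfolding annihilated_def by blast
    next
      case V: False
      have "x \<in> carrier V \<inter> carrier W" if "x \<in> carrier X" for x
        using stable_V stable_W f fY V W that
        unfolding rank_one_stable_def one_sided_stable_def by blast
      then have "f x = 0" if "x \<in> carrier X" for x using intersection_eq fY that by blast
      then show ?thesis using XY.functional_determined[OF lin _ fY u(1)] u(2) by blast
    qed
  qed
qed

lemma dense_X:
  assumes "\<not> annihilated M Y" "x \<in> carrier X" "0 < e"
  shows "\<exists>d\<in>carrier X \<inter> carrier Y. nrm X (x \<ominus>\<^bsub>M\<^esub> d) < e"
proof -
  have "f u = 0" if "bounded_functional M f" "\<And>y. y \<in> carrier Y \<Longrightarrow> f y = 0" "u \<in> carrier M" for f u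
    using assms(1) that unfolding annihilated_def by blast
  then obtain d where "d \<in> carrier X" "d \<in> carrier Y" "nrm X (x \<ominus>\<^bsub>M\<^esub> d) < e"
    using XY.intersection_dense[OF _ assms(2,3)] by metis
  then show ?thesis by blast
qed

lemma proportional_of_dense:
  assumes annY: "\<not> annihilated M Y" and annW: "\<not> annihilated M W"
    and norms: "proportional_on (carrier X \<inter> carrier Y) (nrm X) (nrm V)"
  shows "X \<cong>\<^sub>p V"
proof -
  obtain a where a: "0 < a" "\<And>d. d \<in> carrier X \<inter> carrier Y \<Longrightarrow> nrm X d = a * nrm V d"
    using norms unfolding proportional_on_def by blast
  have XV: "x \<in> carrier V \<and> nrm X x = a * nrm V x" if x: "x \<in> carrier X" for x
  proof (rule dense_extension_subset[where D = "carrier X \<inter> carrier Y", OF XY.whole.normed_subspace_axioms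
        XY.X.normed_subspace_axioms VW.X.normed_subspace_axioms VW.X_banach XY.X_bound VW.X_bound _ _ _ _ a x])
    show "carrier X \<inter> carrier Y \<subseteq> carrier V" using intersection_eq by blast
    show "\<exists>d\<in>carrier X \<inter> carrier Y. nrm X (x \<ominus>\<^bsub>M\<^esub> d) < e" if "x \<in> carrier X" "0 < e" for x e
      using dense_X[OF annY that] .
  qed auto
  have "0 < 1 / a" using a by simp
  moreover have "nrm V d = 1 / a * nrm X d" if "d \<in> carrier X \<inter> carrier Y" for d
    using a(1) a(2)[OF that] by simp
  ultimately have VX: "x \<in> carrier X" if x: "x \<in> carrier V" for x
    using dense_extension_subset[where D = "carrier X \<inter> carrier Y" and a = "1 / a", OF XY.whole.normed_subspace_axioms
        VW.X.normed_subspace_axioms XY.X.normed_subspace_axioms XY.X_banach VW.X_bound XY.X_bound _ _ _ _ _ _ x]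
      two_pairs.dense_X[OF exchange annW] intersection_eq by auto
  show ?thesis
    using XV VX a(1) unfolding proportional_on_def
    by (intro XY.proportionalI XY.X.normed_subspace_axioms VW.X.normed_subspace_axioms)
      (auto simp: proportional_on_def)
qed

text \<open>
  If \<open>X\<close> or \<open>V\<close> is annihilated, \<open>annihilated_cases\<close> identifies one of \<open>Y\<close>, \<open>W\<close> with a space of the other pair, and it
  can only be \<open>Y \<cong>\<^sub>p W\<close>, since \<open>carrier X = carrier V\<close> differs from \<open>carrier Y\<close> and \<open>carrier W\<close>. Otherwise the intersection is
  dense in \<open>Y\<close> and in \<open>W\<close>.
\<close>

lemma couple_match_one_sided:
  assumes annY: "annihilated M Y" and annW: "annihilated M W" and XV: "X \<cong>\<^sub>p V"
  shows "Y \<cong>\<^sub>p W"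
proof -
  note sw = two_pairs.swap_VW[OF swap_XY]
  have cXV: "carrier X = carrier V" by (rule proportional_carrier[OF XV])
  have neq: "carrier X \<noteq> carrier Y" "carrier V \<noteq> carrier W"
    using carrier_neq[OF annY] two_pairs.carrier_neq[OF exchange annW] by auto
  consider "annihilated M X" | "annihilated M V" | "\<not> annihilated M X" "\<not> annihilated M V" by blast
  then show ?thesis
  proof cases
    case 1
    from two_pairs.annihilated_cases[OF swap_XY 1]
    show ?thesis using neq cXV proportional_carrier by metis
  next
    case 2
    from two_pairs.annihilated_cases[OF two_pairs.swap_XY[OF exchange] 2]
    show ?thesis using neq cXV proportional_carrier proportional_commute by metis
  next
    case 3
    let ?D = "carrier X \<inter> carrier Y"
    have xv: "proportional_on ?D (nrm V) (nrm X)"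
      using XV unfolding proportional_def proportional_on_def by auto
    have "proportional_on ?D (nrm Y) (nrm W)"
      using norms_match_on_intersection
    proof (elim disjE conjE)
      assume xw: "proportional_on ?D (nrm X) (nrm W)" and yv: "proportional_on ?D (nrm Y) (nrm V)"
      show ?thesis by (rule proportional_on_trans[OF proportional_on_trans[OF yv xv] xw])
    qed
    then have "proportional_on (carrier Y \<inter> carrier X) (nrm Y) (nrm W)" by (simp add: Int_commute)
    then show ?thesis by (rule two_pairs.proportional_of_dense[OF sw 3])
  qed
qed

lemma couple_match_annihilated:
  assumes "annihilated M Y"
  shows "(X \<cong>\<^sub>p V \<and> Y \<cong>\<^sub>p W) \<or> (X \<cong>\<^sub>p W \<and> Y \<cong>\<^sub>p V)"
  using annihilated_cases[OF assms] couple_match_one_sided[OF assms]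
    two_pairs.couple_match_one_sided[OF swap_VW assms] by blast

lemma couple_match: "(X \<cong>\<^sub>p V \<and> Y \<cong>\<^sub>p W) \<or> (X \<cong>\<^sub>p W \<and> Y \<cong>\<^sub>p V)"
proof -
  consider "annihilated M Y" | "annihilated M X" | "\<not> annihilated M X" "\<not> annihilated M Y" by blast
  then show ?thesis
  proof cases
    case 1 then show ?thesis by (rule couple_match_annihilated)
  next
    case 2 then show ?thesis using two_pairs.couple_match_annihilated[OF swap_XY] by blast
  next
    case 3
    have VW: "\<not> annihilated M V" "\<not> annihilated M W"
      using 3 two_pairs.annihilated_cases[OF exchange]
        two_pairs.annihilated_cases[OF two_pairs.swap_XY[OF exchange]] by blast+
    note YXWV = two_pairs.swap_VW[OF swap_XY]
    from norms_match_on_intersection show ?thesis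
    proof
      assume *: "proportional_on (carrier X \<inter> carrier Y) (nrm X) (nrm V) \<and>
         proportional_on (carrier X \<inter> carrier Y) (nrm Y) (nrm W)"
      then show ?thesis
        using proportional_of_dense[OF 3(2) VW(2)]
          two_pairs.proportional_of_dense[OF YXWV 3(1) VW(1)] by (simp add: Int_commute)
    next
      assume *: "proportional_on (carrier X \<inter> carrier Y) (nrm X) (nrm W) \<and>
         proportional_on (carrier X \<inter> carrier Y) (nrm Y) (nrm V)"
      then show ?thesis
        using two_pairs.proportional_of_dense[OF swap_VW 3(2) VW(1)]
          two_pairs.proportional_of_dense[OF swap_XY 3(1) VW(2)] by (simp add: Int_commute)
    qed
  qed
qed

end

section \<open>Operator norms\<close>

context normed_subspace
begin

lemma
  assumes T: "\<And>c x. x \<in> carrier E \<Longrightarrow> T (c \<odot> x) = c \<odot> T x" and bd: "maps_boundedly E T"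
  shows op_norm_bound: "x \<in> carrier E \<Longrightarrow> nrm E (T x) \<le> op_norm E T * nrm E x"
    and op_norm_nonneg: "0 \<le> op_norm E T"
proof -
  have TE: "T x \<in> carrier E" if "x \<in> carrier E" for x
    using bd that by (auto simp: maps_boundedly_def)
  obtain C where C: "\<And>x. x \<in> carrier E \<Longrightarrow> nrm E (T x) \<le> C * nrm E x"
    using bd unfolding maps_boundedly_def by auto
  have T0: "T \<zero> = \<zero>"
    using T[of \<zero> 0] TE[of \<zero>] by simp
  have bdd: "bdd_above {nrm E (T x) | x. x \<in> carrier E \<and> nrm E x \<le> 1}"
  proof (rule bdd_aboveI)
    fix r assume "r \<in> {nrm E (T x) | x. x \<in> carrier E \<and> nrm E x \<le> 1}"
    then obtain y where y: "r = nrm E (T y)" "y \<in> carrier E" "nrm E y \<le> 1" by blast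
    have "r \<le> C * nrm E y" using C y by simp
    also have "\<dots> \<le> \<bar>C\<bar> * 1" using y by (intro mult_mono) auto
    finally show "r \<le> \<bar>C\<bar>" by simp
  qed
  have upper: "nrm E (T x) \<le> op_norm E T" if "x \<in> carrier E" "nrm E x \<le> 1" for x
    unfolding op_norm_def using that by (intro cSup_upper bdd) auto
  show "0 \<le> op_norm E T" using upper[of \<zero>] T0 by simp
  show "nrm E (T x) \<le> op_norm E T * nrm E x" if x: "x \<in> carrier E"
  proof (cases "x = \<zero>")
    case True
    then show ?thesis using T0 by simp
  next
    case False
    then have pos: "nrm E x > 0" using nrm_pos x by blast
    define a where "a = 1 / nrm E x"
    have a: "a > 0" "a * nrm E x = 1" using pos by (simp_all add: a_def)
    have "nrm E (of_real a \<odot> x) \<le> 1" using nrm_smul[OF x, of "of_real a"] a by simp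
    from upper[OF smul_mem[OF x] this]
    have "a * nrm E (T x) \<le> op_norm E T"
      using T[OF x] nrm_smul[OF TE[OF x], of "of_real a"] a(1) by simp
    then show ?thesis using pos by (simp add: a_def pos_divide_le_eq)
  qed
qed

lemma op_norm_least:
  assumes "0 \<le> c" and c: "\<And>x. x \<in> carrier E \<Longrightarrow> nrm E (T x) \<le> c * nrm E x"
  shows "op_norm E T \<le> c"
  unfolding op_norm_def
proof (rule cSup_least)
  show "{nrm E (T x) | x. x \<in> carrier E \<and> nrm E x \<le> 1} \<noteq> {}"
    using zero_mem by (auto intro!: exI[of _ \<zero>])
  fix r assume "r \<in> {nrm E (T x) | x. x \<in> carrier E \<and> nrm E x \<le> 1}"
  then obtain y where y: "r = nrm E (T y)" "y \<in> carrier E" "nrm E y \<le> 1" by blast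
  then show "r \<le> c" using c[of y] mult_left_le[of "nrm E y" c] assms(1) by linarith
qed

end

section \<open>The sum of a Banach couple\<close>

lemma sum_space_simps:
  "carrier (sum_space H X Y) = {x \<oplus>\<^bsub>H\<^esub> y | x y. x \<in> carrier X \<and> y \<in> carrier Y}"
  "\<zero>\<^bsub>sum_space H X Y\<^esub> = \<zero>\<^bsub>H\<^esub>" "add (sum_space H X Y) = add H"
  "smult (sum_space H X Y) = smult H"
  by (simp_all add: sum_space_def module.extend_def nspace.fields_def)

lemma inter_space_simps:
  "carrier (inter_space H X Y) = carrier X \<inter> carrier Y"
  "\<zero>\<^bsub>inter_space H X Y\<^esub> = \<zero>\<^bsub>H\<^esub>" "add (inter_space H X Y) = add H"
  "smult (inter_space H X Y) = smult H"
  "nrm (inter_space H X Y) = (\<lambda>z. max (nrm X z) (nrm Y z))"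
  by (simp_all add: inter_space_def module.extend_def nspace.fields_def)

lemma (in vspace) linear_subspace_of_closed:
  fixes E :: "('k, 'a, 'n) module_scheme"
  assumes ops: "\<zero>\<^bsub>E\<^esub> = \<zero>" "add E = add M" "smult E = smult M"
    and closed: "carrier E \<subseteq> carrier M" "\<zero> \<in> carrier E"
      "\<And>x y. x \<in> carrier E \<Longrightarrow> y \<in> carrier E \<Longrightarrow> x \<oplus> y \<in> carrier E"
      "\<And>c x. x \<in> carrier E \<Longrightarrow> c \<odot> x \<in> carrier E"
  shows "linear_subspace E M"
proof -
  have mem: "x \<in> carrier M" if "x \<in> carrier E" for x using closed(1) that by blast
  have "abelian_group E"
  proof (rule abelian_groupI)
    fix x assume x: "x \<in> carrier E"
    have "(-1) \<odot> x \<in> carrier E" using closed(4) x by blast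
    moreover have "(-1) \<odot> x \<oplus> x = \<zero>" using mem[OF x] by (simp add: smul_minus_one M.l_neg)
    ultimately show "\<exists>y\<in>carrier E. y \<oplus>\<^bsub>E\<^esub> x = \<zero>\<^bsub>E\<^esub>" unfolding ops by blast
    show "\<zero>\<^bsub>E\<^esub> \<oplus>\<^bsub>E\<^esub> x = x" using mem[OF x] by (simp add: ops)
    fix y assume y: "y \<in> carrier E"
    show "x \<oplus>\<^bsub>E\<^esub> y \<in> carrier E" using closed(3) x y by (simp add: ops)
    show "x \<oplus>\<^bsub>E\<^esub> y = y \<oplus>\<^bsub>E\<^esub> x" using M.a_comm mem x y by (simp add: ops)
    fix z assume z: "z \<in> carrier E"
    show "x \<oplus>\<^bsub>E\<^esub> y \<oplus>\<^bsub>E\<^esub> z = x \<oplus>\<^bsub>E\<^esub> (y \<oplus>\<^bsub>E\<^esub> z)" using M.a_assoc mem x y z by (simp add: ops)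
  qed (simp add: ops closed)
  then have "vec_space E"
    using mem closed(4)
    by (intro moduleI R.is_cring)
      (auto simp: ops smul_distrib smul_smul scalars_def)
  then show ?thesis
    using vspace_axioms closed(1) by (simp add: linear_subspace_def vspace_def ops)
qed

locale couple =
  fixes H :: "('k::real_or_complex, 'a) module" and \<tau> :: "'a topology" and X Y :: "('k, 'a) nspace"
  assumes couple: "banach_couple H \<tau> X Y"
begin

sublocale vspace H
  using couple by (simp add: banach_couple_def hausdorff_tvs_def vspace_def)

sublocale X: normed_subspace H X
  using couple by (intro normed_subspaceI) (simp_all add: banach_couple_def banach_space_def)

sublocale Y: normed_subspace H Y
  using couple by (intro normed_subspaceI) (simp_all add: banach_couple_def banach_space_def)

lemma banach: "banach_space X" "banach_space Y"
  using couple by (simp_all add: banach_couple_def)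

abbreviation S where "S \<equiv> sum_space H X Y"

lemma S_subspace: "linear_subspace S H"
proof (rule linear_subspace_of_closed)
  show "\<zero>\<^bsub>S\<^esub> = \<zero>\<^bsub>H\<^esub>" "add S = add H" "smult S = smult H" by (simp_all add: sum_space_simps)
  show "carrier S \<subseteq> carrier H" by (auto simp: sum_space_simps)
  show "\<zero>\<^bsub>H\<^esub> \<in> carrier S"
    using X.zero_mem Y.zero_mem by (auto simp: sum_space_simps intro!: exI[of _ "\<zero>\<^bsub>H\<^esub>"])
  fix u v assume "u \<in> carrier S" "v \<in> carrier S"
  then obtain x y x' y' where xy: "x \<in> carrier X" "y \<in> carrier Y" "u = x \<oplus>\<^bsub>H\<^esub> y"
    "x' \<in> carrier X" "y' \<in> carrier Y" "v = x' \<oplus>\<^bsub>H\<^esub> y'" by (auto simp: sum_space_simps)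
  have "u \<oplus>\<^bsub>H\<^esub> v = (x \<oplus>\<^bsub>H\<^esub> x') \<oplus>\<^bsub>H\<^esub> (y \<oplus>\<^bsub>H\<^esub> y')"
    using xy by (simp add: M.a_ac)
  moreover have "x \<oplus>\<^bsub>H\<^esub> x' \<in> carrier X" "y \<oplus>\<^bsub>H\<^esub> y' \<in> carrier Y" using xy by auto
  ultimately show "u \<oplus>\<^bsub>H\<^esub> v \<in> carrier S" by (auto simp: sum_space_simps)
next
  fix c u assume "u \<in> carrier S"
  then obtain x y where xy: "x \<in> carrier X" "y \<in> carrier Y" "u = x \<oplus>\<^bsub>H\<^esub> y" by (auto simp: sum_space_simps)
  have "c \<odot>\<^bsub>H\<^esub> u = c \<odot>\<^bsub>H\<^esub> x \<oplus>\<^bsub>H\<^esub> c \<odot>\<^bsub>H\<^esub> y" using xy by (simp add: smul_distrib)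
  moreover have "c \<odot>\<^bsub>H\<^esub> x \<in> carrier X" "c \<odot>\<^bsub>H\<^esub> y \<in> carrier Y" using xy by auto
  ultimately show "c \<odot>\<^bsub>H\<^esub> u \<in> carrier S" by (auto simp: sum_space_simps)
qed

lemma X_subset: "carrier X \<subseteq> carrier S"
proof
  fix x assume "x \<in> carrier X"
  then have "x = x \<oplus>\<^bsub>H\<^esub> \<zero>\<^bsub>H\<^esub>" by simp
  then show "x \<in> carrier S" using \<open>x \<in> carrier X\<close> Y.zero_mem unfolding sum_space_simps by blast
qed

lemma Y_subset: "carrier Y \<subseteq> carrier S"
proof
  fix y assume "y \<in> carrier Y"
  then have "y = \<zero>\<^bsub>H\<^esub> \<oplus>\<^bsub>H\<^esub> y" by simp
  then show "y \<in> carrier S" using \<open>y \<in> carrier Y\<close> X.zero_mem unfolding sum_space_simps by blast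
qed

lemma S_vspace: "vspace S"
  using S_subspace by (simp add: linear_subspace_def vspace_def)

lemma S_normed_subspaceI:
  assumes "normed_space E" "linear_subspace E H" "carrier E \<subseteq> carrier S"
  shows "normed_subspace S E"
proof (rule normed_subspaceI)
  show "linear_subspace E S"
    using assms(2,3) S_vspace unfolding linear_subspace_def vspace_def sum_space_simps by simp
qed fact

lemma S_X: "normed_subspace S X" and S_Y: "normed_subspace S Y"
  using X.normed X.subspace X_subset Y.normed Y.subspace Y_subset S_normed_subspaceI by auto

sublocale SP: subspace_pair S X Y
proof (intro subspace_pair.intro S_vspace S_X S_Y)
  show "subspace_pair_axioms S X Y" by unfold_locales (auto simp: sum_space_simps)
qed

lemma nrm_S: "nrm S u = SP.K 1 u"
  unfolding SP.K_def sum_space_simps by (simp add: sum_space_def module.extend_def nspace.fields_def)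

text \<open>
  This is the only place where the Hausdorff vector topology \<open>\<tau>\<close> enters: both parts of a small decomposition
  tend to \<open>0\<close> in \<open>\<tau>\<close>, hence so does their constant sum \<open>u\<close>.
\<close>

lemma zero_of_small_decompositions:
  assumes u: "u \<in> carrier S" and small: "SP.K 1 u = 0"
  shows "u = \<zero>\<^bsub>H\<^esub>"
proof -
  have tvs: "topspace \<tau> = carrier H" "Hausdorff_space \<tau>"
    "continuous_map (prod_topology \<tau> \<tau>) \<tau> (\<lambda>(x, y). x \<oplus>\<^bsub>H\<^esub> y)"
    using couple by (auto simp: banach_couple_def hausdorff_tvs_def)
  have "\<exists>x y. x \<in> carrier X \<and> y \<in> carrier Y \<and> u = x \<oplus>\<^bsub>H\<^esub> y \<and> nrm X x + nrm Y y < 1 / (real n + 1)" for n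
  proof -
    obtain a b where "a \<in> carrier X" "b \<in> carrier Y" "u = a \<oplus>\<^bsub>S\<^esub> b" "nrm X a + 1 * nrm Y b < SP.K 1 u + 1 / (real n + 1)"
      by (rule SP.K_approx[OF u, of "1 / (real n + 1)" 1]) simp
    then show ?thesis using small by (intro exI[of _ a] exI[of _ b]) (simp add: sum_space_simps)
  qed
  then obtain x y where xy: "\<And>n. x n \<in> carrier X" "\<And>n. y n \<in> carrier Y" "\<And>n. u = x n \<oplus>\<^bsub>H\<^esub> y n"
    "\<And>n. nrm X (x n) + nrm Y (y n) < 1 / (real n + 1)" by metis
  have inv: "(\<lambda>n. 1 / (real n + 1)) \<longlonglongrightarrow> 0"
    using LIMSEQ_inverse_real_of_nat by (simp add: inverse_eq_divide add.commute)
  have x0: "(\<lambda>n. nrm X (x n)) \<longlonglongrightarrow> 0"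
  proof (rule tendsto_sandwich[OF always_eventually always_eventually tendsto_const inv]; intro allI)
    fix n show "0 \<le> nrm X (x n)" using xy(1) by simp
    show "nrm X (x n) \<le> 1 / (real n + 1)" using xy(4)[of n] Y.nrm_nonneg[OF xy(2)[of n]] by linarith
  qed
  have y0: "(\<lambda>n. nrm Y (y n)) \<longlonglongrightarrow> 0"
  proof (rule tendsto_sandwich[OF always_eventually always_eventually tendsto_const inv]; intro allI)
    fix n show "0 \<le> nrm Y (y n)" using xy(2) by simp
    show "nrm Y (y n) \<le> 1 / (real n + 1)" using xy(4)[of n] X.nrm_nonneg[OF xy(1)[of n]] by linarith
  qed
  have "limitin (ntopology X) x \<zero>\<^bsub>H\<^esub> sequentially"
    unfolding X.limitin_iff using xy(1) x0 by (simp add: X.ndist_eq X.mem[OF xy(1)])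
  then have lx: "limitin \<tau> x \<zero>\<^bsub>H\<^esub> sequentially"
    using continuous_map_limit[of "ntopology X" \<tau> "\<lambda>x. x" x] couple
    by (simp add: banach_couple_def o_def)
  have "limitin (ntopology Y) y \<zero>\<^bsub>H\<^esub> sequentially"
    unfolding Y.limitin_iff using xy(2) y0 by (simp add: Y.ndist_eq Y.mem[OF xy(2)])
  then have ly: "limitin \<tau> y \<zero>\<^bsub>H\<^esub> sequentially"
    using continuous_map_limit[of "ntopology Y" \<tau> "\<lambda>x. x" y] couple
    by (simp add: banach_couple_def o_def)
  have "limitin (prod_topology \<tau> \<tau>) (\<lambda>n. (x n, y n)) (\<zero>\<^bsub>H\<^esub>, \<zero>\<^bsub>H\<^esub>) sequentially"
    using lx ly by (simp add: limitin_pairwise o_def)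
  from continuous_map_limit[OF tvs(3) this]
  have "limitin \<tau> (\<lambda>n. u) \<zero>\<^bsub>H\<^esub> sequentially"
    using xy(3)[symmetric] by (simp add: o_def)
  moreover have "limitin \<tau> (\<lambda>n. u) u sequentially"
    using u S_subspace tvs(1) by (auto simp: linear_subspace_def)
  ultimately show ?thesis
    using limitin_Hausdorff_unique tvs(2) trivial_limit_sequentially by metis
qed

lemma S_normed: "normed_space S"
proof -
  have semi: "seminorm S (nrm S)" unfolding nrm_S[abs_def] by (rule SP.seminorm_K) simp
  have nn: "0 \<le> nrm S u" if "u \<in> carrier S" for u
    using SP.K_nonneg[OF _ that] by (simp add: nrm_S)
  have z: "nrm S u = 0 \<longleftrightarrow> u = \<zero>\<^bsub>S\<^esub>" if "u \<in> carrier S" for u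
    using zero_of_small_decompositions[OF that] SP.seminorm_zero[OF semi] by (auto simp: nrm_S sum_space_simps)
  show ?thesis
    using semi nn z S_vspace unfolding normed_space_def seminorm_def vspace_def by blast
qed

sublocale S: normed_subspace S S
  by (rule normed_subspace_self[OF S_normed])

lemma nrm_S_le_X: "x \<in> carrier X \<Longrightarrow> nrm S x \<le> nrm X x"
  and nrm_S_le_Y: "y \<in> carrier Y \<Longrightarrow> nrm S y \<le> nrm Y y"
  using SP.K_le_X[of 1 x] SP.K_le_Y[of 1 y] by (auto simp: nrm_S)

lemma S_decomposition:
  assumes u: "u \<in> carrier S"
  shows "\<exists>x\<in>carrier X. \<exists>y\<in>carrier Y. u = x \<oplus>\<^bsub>S\<^esub> y \<and> nrm X x + nrm Y y \<le> 2 * nrm S u"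
proof (cases "u = \<zero>\<^bsub>S\<^esub>")
  case True
  show ?thesis
    by (rule bexI[of _ "\<zero>\<^bsub>S\<^esub>"], rule bexI[of _ "\<zero>\<^bsub>S\<^esub>"]) (simp_all add: True)
next
  case False
  then have "0 < nrm S u" by (rule S.nrm_pos[OF u])
  then show ?thesis
    using SP.K_approx[OF u, of "nrm S u" 1] unfolding nrm_S by (metis less_imp_le mult_1 mult_2)
qed

text \<open>
  A rapidly convergent series in the sum splits into absolutely convergent series in \<open>X\<close> and in \<open>Y\<close>.
\<close>

lemma S_banach: "banach_space S"
proof (rule S.banach_if_series_converge)
  fix d :: "nat \<Rightarrow> 'a" assume d: "\<And>n. d n \<in> carrier S" "\<And>n. nrm S (d n) \<le> (1 / 2) ^ n"
  have "\<exists>x y. x \<in> carrier X \<and> y \<in> carrier Y \<and> d n = x \<oplus>\<^bsub>S\<^esub> y \<and> nrm X x + nrm Y y \<le> 2 * (1 / 2) ^ n" for n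
    using S_decomposition[OF d(1)[of n]] d(2)[of n] by fastforce
  then obtain x y where xy: "\<And>n. x n \<in> carrier X" "\<And>n. y n \<in> carrier Y" "\<And>n. d n = x n \<oplus>\<^bsub>S\<^esub> y n"
    "\<And>n. nrm X (x n) + nrm Y (y n) \<le> 2 * (1 / 2) ^ n" by metis
  have sum: "summable (\<lambda>n. 2 * (1 / 2 :: real) ^ n)" by (intro summable_mult summable_geometric) simp
  have xle: "nrm X (x n) \<le> 2 * (1 / 2) ^ n" and yle: "nrm Y (y n) \<le> 2 * (1 / 2) ^ n" for n
    using xy(4)[of n] X.nrm_nonneg[OF xy(1)[of n]] Y.nrm_nonneg[OF xy(2)[of n]] by linarith+
  obtain a where a: "a \<in> carrier X" "(\<lambda>n. nrm X (finsum S x {..<n} \<ominus>\<^bsub>S\<^esub> a)) \<longlonglongrightarrow> 0"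
    using SP.X.series_converges[OF banach(1) xy(1) xle sum] by metis
  obtain b where b: "b \<in> carrier Y" "(\<lambda>n. nrm Y (finsum S y {..<n} \<ominus>\<^bsub>S\<^esub> b)) \<longlonglongrightarrow> 0"
    using SP.Y.series_converges[OF banach(2) xy(2) yle sum] by metis
  have xS: "x n \<in> carrier S" and yS: "y n \<in> carrier S" for n using xy SP.X.mem SP.Y.mem by auto
  have aS: "a \<in> carrier S" and bS: "b \<in> carrier S" using a b SP.X.mem SP.Y.mem by auto
  have split: "finsum S d {..<n} \<ominus>\<^bsub>S\<^esub> (a \<oplus>\<^bsub>S\<^esub> b)
      = (finsum S x {..<n} \<ominus>\<^bsub>S\<^esub> a) \<oplus>\<^bsub>S\<^esub> (finsum S y {..<n} \<ominus>\<^bsub>S\<^esub> b)" for n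
  proof -
    have "d = (\<lambda>n. x n \<oplus>\<^bsub>S\<^esub> y n)" using xy(3) by auto
    then have "finsum S d {..<n} = finsum S x {..<n} \<oplus>\<^bsub>S\<^esub> finsum S y {..<n}"
      using SP.M.finsum_addf[of x "{..<n}" y] xS yS by (simp only: Pi_def) simp
    moreover have "finsum S x {..<n} \<in> carrier S" "finsum S y {..<n} \<in> carrier S"
      using S.finsum_mem xS yS by blast+
    ultimately show ?thesis
      using aS bS by (simp only: a_minus_def SP.M.minus_add SP.M.a_ac SP.M.a_closed SP.M.a_inv_closed)
  qed
  show "\<exists>l\<in>carrier S. (\<lambda>n. nrm S (finsum S d {..<n} \<ominus>\<^bsub>S\<^esub> l)) \<longlonglongrightarrow> 0"
  proof (rule bexI)
    have sum0: "(\<lambda>n. nrm X (finsum S x {..<n} \<ominus>\<^bsub>S\<^esub> a) + nrm Y (finsum S y {..<n} \<ominus>\<^bsub>S\<^esub> b)) \<longlonglongrightarrow> 0"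
      using tendsto_add[OF a(2) b(2)] by simp
    show "(\<lambda>n. nrm S (finsum S d {..<n} \<ominus>\<^bsub>S\<^esub> (a \<oplus>\<^bsub>S\<^esub> b))) \<longlonglongrightarrow> 0"
    proof (rule tendsto_sandwich[OF always_eventually always_eventually tendsto_const sum0]; intro allI)
      fix n
      have X: "finsum S x {..<n} \<ominus>\<^bsub>S\<^esub> a \<in> carrier X"
        by (intro SP.X.minus_mem SP.X.finsum_mem xy a)
      have Y: "finsum S y {..<n} \<ominus>\<^bsub>S\<^esub> b \<in> carrier Y"
        by (intro SP.Y.minus_mem SP.Y.finsum_mem xy b)
      show "nrm S (finsum S d {..<n} \<ominus>\<^bsub>S\<^esub> (a \<oplus>\<^bsub>S\<^esub> b))
          \<le> nrm X (finsum S x {..<n} \<ominus>\<^bsub>S\<^esub> a) + nrm Y (finsum S y {..<n} \<ominus>\<^bsub>S\<^esub> b)"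
        using SP.K_le[OF _ X Y, of 1] unfolding split nrm_S by simp
      show "0 \<le> nrm S (finsum S d {..<n} \<ominus>\<^bsub>S\<^esub> (a \<oplus>\<^bsub>S\<^esub> b))"
        unfolding split using S.add_mem[OF SP.X.mem[OF X] SP.Y.mem[OF Y]] by (rule S.nrm_nonneg)
    qed
    show "a \<oplus>\<^bsub>S\<^esub> b \<in> carrier S" by (rule S.add_mem[OF aS bS])
  qed
qed

lemma banach_pair: "banach_pair S X Y"
proof (intro banach_pair.intro S_vspace S_X S_Y S.normed_subspace_axioms banach_pair_axioms.intro banach)
  show "\<exists>C. \<forall>x\<in>carrier X. nrm S x \<le> C * nrm X x" using nrm_S_le_X by (intro exI[of _ 1]) simp
  show "\<exists>C. \<forall>y\<in>carrier Y. nrm S y \<le> C * nrm Y y" using nrm_S_le_Y by (intro exI[of _ 1]) simp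
  show "\<exists>C. \<forall>u\<in>carrier S. \<exists>x\<in>carrier X. \<exists>y\<in>carrier Y.
      u = x \<oplus>\<^bsub>S\<^esub> y \<and> nrm X x + nrm Y y \<le> C * nrm S u" using S_decomposition by blast
qed

end

section \<open>Exact rank-one interpolation spaces\<close>

context couple
begin

abbreviation I where "I \<equiv> inter_space H X Y"

lemma I_normed: "normed_space I" and I_subspace: "linear_subspace I H"
proof -
  show sub: "linear_subspace I H"
    by (rule linear_subspace_of_closed) (auto simp: inter_space_simps)
  then have "vec_space I" by (simp add: linear_subspace_def)
  then show "normed_space I"
    unfolding normed_space_def inter_space_simps
  proof (intro conjI ballI allI)
    fix x y assume "x \<in> carrier X \<inter> carrier Y" "y \<in> carrier X \<inter> carrier Y"
    then show "max (nrm X (x \<oplus>\<^bsub>H\<^esub> y)) (nrm Y (x \<oplus>\<^bsub>H\<^esub> y)) \<le> max (nrm X x) (nrm Y x) + max (nrm X y) (nrm Y y)"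
      using X.nrm_add[of x y] Y.nrm_add[of x y] by auto
  next
    fix c x assume "x \<in> carrier X \<inter> carrier Y"
    then show "max (nrm X (c \<odot>\<^bsub>H\<^esub> x)) (nrm Y (c \<odot>\<^bsub>H\<^esub> x)) = norm c * max (nrm X x) (nrm Y x)"
      by (simp add: X.nrm_smul Y.nrm_smul max_mult_distrib_left)
  next
    fix x assume x: "x \<in> carrier X \<inter> carrier Y"
    then show "0 \<le> max (nrm X x) (nrm Y x)" by (simp add: le_max_iff_disj)
    show "(max (nrm X x) (nrm Y x) = 0) = (x = \<zero>\<^bsub>H\<^esub>)"
      using x X.nrm_eq_zero[of x] Y.nrm_eq_zero[of x] X.nrm_nonneg[of x] Y.nrm_nonneg[of x]
      by (auto simp: max_def split: if_splits)
  qed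
qed

lemma intermediateI:
  assumes Z: "banach_space Z" and sub: "linear_subspace Z S" and inter: "carrier X \<inter> carrier Y \<subseteq> carrier Z"
    and le: "\<And>z. z \<in> carrier X \<Longrightarrow> z \<in> carrier Y \<Longrightarrow> nrm Z z \<le> max (nrm X z) (nrm Y z)"
    and S_le: "\<And>z. z \<in> carrier Z \<Longrightarrow> nrm S z \<le> nrm Z z"
  shows "Z \<in> intermediate_spaces H X Y"
proof -
  have normed: "normed_space Z" using Z by (simp add: banach_space_def)
  have SI: "normed_subspace S I"
    using X_subset by (intro S_normed_subspaceI I_normed I_subspace) (auto simp: inter_space_simps)
  have "linear_subspace I Z"
    by (rule SP.linear_subspaceI[OF SI normed_subspaceI[OF normed sub]])
      (use inter in \<open>simp add: inter_space_simps\<close>)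
  then have "I \<hookrightarrow> Z"
    using le by (intro embeddedI[where C = 1] I_normed normed) (auto simp: inter_space_simps)
  moreover have "Z \<hookrightarrow> S"
    using S_le by (intro embeddedI[where C = 1] S_normed normed sub) auto
  ultimately show ?thesis using Z by (simp add: intermediate_spaces_def)
qed

lemma R1_D:
  assumes "T \<in> R1 H X Y"
  shows "\<And>x. x \<in> carrier S \<Longrightarrow> T x \<in> carrier S"
    and "\<And>x y. x \<in> carrier S \<Longrightarrow> y \<in> carrier S \<Longrightarrow> T (x \<oplus>\<^bsub>S\<^esub> y) = T x \<oplus>\<^bsub>S\<^esub> T y"
    and "\<And>c x. x \<in> carrier S \<Longrightarrow> T (c \<odot>\<^bsub>S\<^esub> x) = c \<odot>\<^bsub>S\<^esub> T x"
    and "maps_boundedly X T" "maps_boundedly Y T"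
  using assms by (auto simp: R1_def couple_operators_def linear_operator_def)

lemma X_interpolation: "X \<in> R1_Int_1 H X Y"
proof -
  have "X \<in> intermediate_spaces H X Y"
    using nrm_S_le_X by (intro intermediateI banach SP.X.subspace) auto
  then show ?thesis using R1_D(4) by (simp add: R1_Int_1_def couple_op_norm_def)
qed

lemma Y_interpolation: "Y \<in> R1_Int_1 H X Y"
proof -
  have "Y \<in> intermediate_spaces H X Y"
    using nrm_S_le_Y by (intro intermediateI banach SP.Y.subspace) auto
  then show ?thesis using R1_D(5) by (simp add: R1_Int_1_def couple_op_norm_def)
qed

text \<open>
  Applied to both couples, this shows that \<open>X + Y\<close> and \<open>V + W\<close> are the same space, including the
  addition, although the ambient spaces \<open>H\<close> and \<open>H'\<close> may be unrelated.
\<close>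

lemma S_interpolation: "S \<in> R1_Int_1 H X Y"
proof -
  have inter: "S \<in> intermediate_spaces H X Y"
  proof (rule intermediateI[OF S_banach linear_subspace_refl[OF S_vspace]])
    show "carrier X \<inter> carrier Y \<subseteq> carrier S" using X_subset by blast
    show "nrm S z \<le> max (nrm X z) (nrm Y z)" if "z \<in> carrier X" for z
      using nrm_S_le_X[OF that] by simp
  qed simp
  have "maps_boundedly S T \<and> op_norm S T \<le> couple_op_norm X Y T" if T: "T \<in> R1 H X Y" for T
  proof -
    define N where "N = couple_op_norm X Y T"
    have TX: "T x \<in> carrier X" if "x \<in> carrier X" for x
      using R1_D(4)[OF T] that by (auto simp: maps_boundedly_def)
    have TY: "T y \<in> carrier Y" if "y \<in> carrier Y" for y
      using R1_D(5)[OF T] that by (auto simp: maps_boundedly_def)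
    have N0: "0 \<le> N"
      using SP.X.op_norm_nonneg[OF R1_D(3)[OF T SP.X.mem] R1_D(4)[OF T]]
      by (simp add: N_def couple_op_norm_def)
    have NX: "nrm X (T x) \<le> N * nrm X x" if x: "x \<in> carrier X" for x
    proof -
      have "nrm X (T x) \<le> op_norm X T * nrm X x"
        by (rule SP.X.op_norm_bound[OF R1_D(3)[OF T SP.X.mem] R1_D(4)[OF T] x])
      also have "\<dots> \<le> N * nrm X x"
        using x by (intro mult_right_mono) (simp_all add: N_def couple_op_norm_def)
      finally show ?thesis .
    qed
    have NY: "nrm Y (T y) \<le> N * nrm Y y" if y: "y \<in> carrier Y" for y
    proof -
      have "nrm Y (T y) \<le> op_norm Y T * nrm Y y"
        by (rule SP.Y.op_norm_bound[OF R1_D(3)[OF T SP.Y.mem] R1_D(5)[OF T] y])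
      also have "\<dots> \<le> N * nrm Y y"
        using y by (intro mult_right_mono) (simp_all add: N_def couple_op_norm_def)
      finally show ?thesis .
    qed
    have split: "nrm S (T u) \<le> N * (nrm X x + nrm Y y)"
      if xy: "x \<in> carrier X" "y \<in> carrier Y" "u = x \<oplus>\<^bsub>S\<^esub> y" for u x y
    proof -
      have "T u = T x \<oplus>\<^bsub>S\<^esub> T y" using R1_D(2)[OF T SP.X.mem[OF xy(1)] SP.Y.mem[OF xy(2)]] xy(3) by simp
      then have "nrm S (T u) \<le> nrm X (T x) + 1 * nrm Y (T y)"
        using SP.K_le[OF _ TX[OF xy(1)] TY[OF xy(2)], of 1] by (simp add: nrm_S)
      then show ?thesis using NX[OF xy(1)] NY[OF xy(2)] by (simp add: distrib_left)
    qed
    have bound: "nrm S (T u) \<le> N * nrm S u" if u: "u \<in> carrier S" for u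
    proof (cases "N = 0")
      case True
      obtain x y where "x \<in> carrier X" "y \<in> carrier Y" "u = x \<oplus>\<^bsub>S\<^esub> y" by (rule SP.decompose[OF u])
      then show ?thesis using split[of x y u] True by simp
    next
      case False
      then have pos: "N > 0" using N0 by simp
      have "nrm S (T u) / N \<le> SP.K 1 u"
        by (rule SP.K_greatest[OF u]) (use split pos in \<open>simp add: pos_divide_le_eq mult.commute\<close>)
      then show ?thesis using pos by (simp add: nrm_S pos_divide_le_eq mult.commute)
    qed
    have "op_norm S T \<le> N" by (rule S.op_norm_least[OF N0 bound])
    moreover have "maps_boundedly S T"
      unfolding maps_boundedly_def using R1_D(1)[OF T] bound by blast
    ultimately show ?thesis by (simp add: N_def)
  qed
  with inter show ?thesis by (simp add: R1_Int_1_def)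
qed

lemma interpolation_D:
  assumes "Z \<in> R1_Int_1 H X Y"
  shows "banach_space Z" "carrier X \<inter> carrier Y \<subseteq> carrier Z" "Z \<hookrightarrow> S" "normed_subspace S Z"
    and "\<exists>C. \<forall>z\<in>carrier Z. nrm S z \<le> C * nrm Z z"
    and "T \<in> R1 H X Y \<Longrightarrow> maps_boundedly Z T" "T \<in> R1 H X Y \<Longrightarrow> op_norm Z T \<le> couple_op_norm X Y T"
proof -
  show Z: "banach_space Z" and emb: "Z \<hookrightarrow> S"
    using assms by (auto simp: R1_Int_1_def intermediate_spaces_def)
  have "linear_subspace I Z"
    using assms by (auto simp: R1_Int_1_def intermediate_spaces_def embedded_def)
  then show "carrier X \<inter> carrier Y \<subseteq> carrier Z"
    by (simp add: linear_subspace_def inter_space_simps)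
  have normed: "normed_space Z" using Z by (simp add: banach_space_def)
  show "normed_subspace S Z"
    using emb by (intro normed_subspaceI normed) (simp add: embedded_def)
  show "\<exists>C. \<forall>z\<in>carrier Z. nrm S z \<le> C * nrm Z z"
    using embedded_bound[OF normed S_normed emb] by blast
  have ops: "\<forall>T\<in>R1 H X Y. maps_boundedly Z T \<and> op_norm Z T \<le> couple_op_norm X Y T"
    using assms unfolding R1_Int_1_def by blast
  show "maps_boundedly Z T" if "T \<in> R1 H X Y" using ops that by blast
  show "op_norm Z T \<le> couple_op_norm X Y T" if "T \<in> R1 H X Y" using ops that by blast
qed

text \<open>
  The translation from operators to functionals: \<open>T x = f x \<odot> u\<close> belongs to \<open>R1 H X Y\<close>, its norm on \<open>Z\<close> is
  \<open>dual_norm Z f * nrm Z u\<close>, and \<open>u\<close> is a multiple of \<open>T z\<close>, hence in \<open>Z\<close>.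
\<close>

lemma rank_one_bound:
  assumes Z: "Z \<in> R1_Int_1 H X Y" and f: "bounded_functional S f"
    and u: "u \<in> carrier S" "u \<noteq> \<zero>\<^bsub>S\<^esub>" and c: "0 \<le> c"
    and X: "\<And>x. x \<in> carrier X \<Longrightarrow> f x \<odot>\<^bsub>S\<^esub> u \<in> carrier X \<and> nrm X (f x \<odot>\<^bsub>S\<^esub> u) \<le> c * nrm X x"
    and Y: "\<And>y. y \<in> carrier Y \<Longrightarrow> f y \<odot>\<^bsub>S\<^esub> u \<in> carrier Y \<and> nrm Y (f y \<odot>\<^bsub>S\<^esub> u) \<le> c * nrm Y y"
    and z: "z \<in> carrier Z" "f z \<noteq> 0"
  shows "u \<in> carrier Z \<and> dual_norm Z f * nrm Z u \<le> c"
proof -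
  interpret Z: normed_subspace S Z by (rule interpolation_D(4)[OF Z])
  define T where "T x = f x \<odot>\<^bsub>S\<^esub> u" for x
  have fadd: "f (x \<oplus>\<^bsub>S\<^esub> y) = f x + f y" if "x \<in> carrier S" "y \<in> carrier S" for x y
    using f that by (auto simp: bounded_functional_def linear_functional_def)
  have fmul: "f (a \<odot>\<^bsub>S\<^esub> x) = a * f x" if "x \<in> carrier S" for a x
    using f that by (auto simp: bounded_functional_def linear_functional_def)
  have TS: "T x \<in> carrier S" for x unfolding T_def by (rule SP.smul_closed[OF u(1)])
  have Tmul: "T (a \<odot>\<^bsub>S\<^esub> x) = a \<odot>\<^bsub>S\<^esub> T x" if "x \<in> carrier S" for a x
    unfolding T_def fmul[OF that] by (rule SP.smul_smul[OF u(1), symmetric])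
  have Tadd: "T (x \<oplus>\<^bsub>S\<^esub> y) = T x \<oplus>\<^bsub>S\<^esub> T y" if "x \<in> carrier S" "y \<in> carrier S" for x y
    unfolding T_def fadd[OF that] by (rule SP.smul_distrib(1)[OF u(1)])
  have zS: "z \<in> carrier S" by (rule Z.mem[OF z(1)])
  have lin: "linear_operator S T"
    unfolding linear_operator_def using TS Tadd Tmul by blast
  have XT: "maps_boundedly X T" and YT: "maps_boundedly Y T"
    unfolding maps_boundedly_def T_def using X Y by auto
  have "T ` carrier S = range (\<lambda>a. a \<odot>\<^bsub>S\<^esub> u)"
  proof
    show "T ` carrier S \<subseteq> range (\<lambda>a. a \<odot>\<^bsub>S\<^esub> u)" by (auto simp: T_def)
    show "range (\<lambda>a. a \<odot>\<^bsub>S\<^esub> u) \<subseteq> T ` carrier S"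
    proof
      fix v assume "v \<in> range (\<lambda>a. a \<odot>\<^bsub>S\<^esub> u)"
      then obtain a where "v = a \<odot>\<^bsub>S\<^esub> u" by blast
      then have "v = T ((a / f z) \<odot>\<^bsub>S\<^esub> z)" unfolding T_def fmul[OF zS] using z(2) by simp
      then show "v \<in> T ` carrier S" using SP.smul_closed[OF zS] by blast
    qed
  qed
  then have "rank_one S T" unfolding rank_one_def using u by blast
  then have T: "T \<in> R1 H X Y"
    using lin XT YT by (simp add: R1_def couple_operators_def)
  have ZT: "maps_boundedly Z T" by (rule interpolation_D(6)[OF Z T])
  have "T z \<in> carrier Z" using ZT z(1) by (auto simp: maps_boundedly_def)
  from Z.smul_mem[OF this, of "1 / f z"] have uZ: "u \<in> carrier Z"
    using z(2) SP.smul_smul[OF u(1), of "1 / f z" "f z"] SP.smul_one[OF u(1)] by (simp add: T_def)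
  have "op_norm X T \<le> c" "op_norm Y T \<le> c"
    using X Y by (auto intro!: SP.X.op_norm_least SP.Y.op_norm_least c simp: T_def)
  then have opc: "op_norm Z T \<le> c"
    using interpolation_D(7)[OF Z T] by (simp add: couple_op_norm_def)
  have pos: "0 < nrm Z u" by (rule Z.nrm_pos[OF uZ u(2)])
  have "dual_norm Z f \<le> c / nrm Z u"
  proof (rule Z.dual_norm_least)
    show "0 \<le> c / nrm Z u" using c pos by simp
    fix w assume w: "w \<in> carrier Z"
    have "norm (f w) * nrm Z u = nrm Z (T w)" unfolding T_def by (rule Z.nrm_smul[OF uZ, symmetric])
    also have "\<dots> \<le> op_norm Z T * nrm Z w"
      by (rule Z.op_norm_bound[OF Tmul[OF Z.mem] ZT w])
    also have "\<dots> \<le> c * nrm Z w" using opc w by (intro mult_right_mono) auto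
    finally show "norm (f w) \<le> c / nrm Z u * nrm Z w" using pos by (simp add: pos_le_divide_eq)
  qed
  then show ?thesis using uZ pos by (simp add: pos_le_divide_eq)
qed

lemma stable:
  assumes Z: "Z \<in> R1_Int_1 H X Y"
  shows "rank_one_stable S X Y Z"
proof -
  interpret Z: normed_subspace S Z by (rule interpolation_D(4)[OF Z])
  interpret P: banach_pair S X Y by (rule banach_pair)
  have X_scaled: "f x \<odot>\<^bsub>S\<^esub> u \<in> carrier X \<and> nrm X (f x \<odot>\<^bsub>S\<^esub> u) \<le> c * nrm X x"
    if f: "bounded_functional S f" and u: "u \<in> carrier X" and x: "x \<in> carrier X"
      and c: "dual_norm X f * nrm X u \<le> c" for f u x c
  proof -
    have "norm (f x) * nrm X u \<le> (dual_norm X f * nrm X x) * nrm X u"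
      using P.dual_X_bound[OF f x] u by (intro mult_right_mono) auto
    also have "\<dots> = (dual_norm X f * nrm X u) * nrm X x" by simp
    also have "\<dots> \<le> c * nrm X x" using c x by (intro mult_right_mono) auto
    finally show ?thesis using u by (simp add: SP.X.nrm_smul)
  qed
  have Y_scaled: "f y \<odot>\<^bsub>S\<^esub> u \<in> carrier Y \<and> nrm Y (f y \<odot>\<^bsub>S\<^esub> u) \<le> c * nrm Y y"
    if f: "bounded_functional S f" and u: "u \<in> carrier Y" and y: "y \<in> carrier Y"
      and c: "dual_norm Y f * nrm Y u \<le> c" for f u y c
  proof -
    have "norm (f y) * nrm Y u \<le> (dual_norm Y f * nrm Y y) * nrm Y u"
      using P.dual_Y_bound[OF f y] u by (intro mult_right_mono) auto
    also have "\<dots> = (dual_norm Y f * nrm Y u) * nrm Y y" by simp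
    also have "\<dots> \<le> c * nrm Y y" using c y by (intro mult_right_mono) auto
    finally show ?thesis using u by (simp add: SP.Y.nrm_smul)
  qed
  have "two_sided_stable S X Y Z"
    unfolding two_sided_stable_def
  proof (intro allI impI conjI)
    fix f u assume f: "bounded_functional S f" and u: "u \<in> carrier X" "u \<in> carrier Y"
    show uZ: "u \<in> carrier Z" using interpolation_D(2)[OF Z] u by blast
    let ?c = "max (dual_norm X f * nrm X u) (dual_norm Y f * nrm Y u)"
    have c: "0 \<le> ?c" using P.dual_X_nonneg[OF f] u(1) by (simp add: le_max_iff_disj)
    show "dual_norm Z f * nrm Z u \<le> ?c"
    proof (cases "u = \<zero>\<^bsub>S\<^esub> \<or> (\<forall>z\<in>carrier Z. f z = 0)")
      case True
      then have "dual_norm Z f * nrm Z u \<le> 0"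
      proof
        assume "\<forall>z\<in>carrier Z. f z = 0"
        then have "dual_norm Z f \<le> 0" by (intro Z.dual_norm_least) auto
        then show ?thesis using uZ by (intro mult_nonpos_nonneg) auto
      qed simp
      then show ?thesis using c by linarith
    next
      case False
      then obtain z where z: "z \<in> carrier Z" "f z \<noteq> 0" by blast
      show ?thesis
        using rank_one_bound[OF Z f SP.X.mem[OF u(1)] _ c X_scaled[OF f u(1)] Y_scaled[OF f u(2)] z] False
        by simp
    qed
  qed
  moreover have "one_sided_stable S X Y Z"
    unfolding one_sided_stable_def
  proof (intro allI impI)
    fix f u z assume f: "bounded_functional S f" and fY: "\<forall>y\<in>carrier Y. f y = 0"
      and u: "u \<in> carrier X" and z: "z \<in> carrier Z" "f z \<noteq> 0"
    let ?c = "dual_norm X f * nrm X u"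
    have c: "0 \<le> ?c" using P.dual_X_nonneg[OF f] u by simp
    have "f y \<odot>\<^bsub>S\<^esub> u \<in> carrier Y \<and> nrm Y (f y \<odot>\<^bsub>S\<^esub> u) \<le> ?c * nrm Y y" if "y \<in> carrier Y" for y
      using fY that c SP.X.mem[OF u] by simp
    then show "u \<in> carrier Z \<and> dual_norm Z f * nrm Z u \<le> ?c"
      using rank_one_bound[OF Z f SP.X.mem[OF u] _ c X_scaled[OF f u] _ z]
      by (cases "u = \<zero>\<^bsub>S\<^esub>") auto
  qed
  moreover have "one_sided_stable S Y X Z"
    unfolding one_sided_stable_def
  proof (intro allI impI)
    fix f u z assume f: "bounded_functional S f" and fX: "\<forall>x\<in>carrier X. f x = 0"
      and u: "u \<in> carrier Y" and z: "z \<in> carrier Z" "f z \<noteq> 0"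
    let ?c = "dual_norm Y f * nrm Y u"
    have c: "0 \<le> ?c" using P.dual_Y_nonneg[OF f] u by simp
    have "f x \<odot>\<^bsub>S\<^esub> u \<in> carrier X \<and> nrm X (f x \<odot>\<^bsub>S\<^esub> u) \<le> ?c * nrm X x" if "x \<in> carrier X" for x
      using fX that c SP.Y.mem[OF u] by simp
    then show "u \<in> carrier Z \<and> dual_norm Z f * nrm Z u \<le> ?c"
      using rank_one_bound[OF Z f SP.Y.mem[OF u] _ c _ Y_scaled[OF f u] z]
      by (cases "u = \<zero>\<^bsub>S\<^esub>") auto
  qed
  ultimately show ?thesis by (simp add: rank_one_stable_def)
qed

end

section \<open>Comparison of two couples\<close>

lemma bounded_functional_mono:
  assumes f: "bounded_functional M f" and M: "normed_space M" and sub: "linear_subspace N M"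
    and C: "\<And>x. x \<in> carrier N \<Longrightarrow> nrm M x \<le> C * nrm N x"
  shows "bounded_functional N f"
proof -
  have mem: "x \<in> carrier M" if "x \<in> carrier N" for x
    using sub that unfolding linear_subspace_def by blast
  obtain B where B: "\<And>x. x \<in> carrier M \<Longrightarrow> norm (f x) \<le> B * nrm M x"
    using f unfolding bounded_functional_def by blast
  have "norm (f x) \<le> (\<bar>B\<bar> * C) * nrm N x" if x: "x \<in> carrier N" for x
  proof -
    have nn: "0 \<le> nrm M x" using M mem[OF x] by (simp add: normed_space_def)
    have "norm (f x) \<le> B * nrm M x" using B mem[OF x] by blast
    also have "\<dots> \<le> \<bar>B\<bar> * nrm M x" using nn by (intro mult_right_mono) auto
    also have "\<dots> \<le> \<bar>B\<bar> * (C * nrm N x)" using C[OF x] by (intro mult_left_mono) auto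
    finally show ?thesis by (simp add: mult.assoc)
  qed
  moreover have "linear_functional N f"
    unfolding linear_functional_def
  proof (intro conjI ballI allI)
    fix x y assume xy: "x \<in> carrier N" "y \<in> carrier N"
    then have "x \<oplus>\<^bsub>N\<^esub> y = x \<oplus>\<^bsub>M\<^esub> y" using sub unfolding linear_subspace_def by blast
    then show "f (x \<oplus>\<^bsub>N\<^esub> y) = f x + f y"
      using f mem[OF xy(1)] mem[OF xy(2)] unfolding bounded_functional_def linear_functional_def by simp
  next
    fix c x assume x: "x \<in> carrier N"
    then have "c \<odot>\<^bsub>N\<^esub> x = c \<odot>\<^bsub>M\<^esub> x" using sub unfolding linear_subspace_def by blast
    then show "f (c \<odot>\<^bsub>N\<^esub> x) = c * f x"
      using f mem[OF x] unfolding bounded_functional_def linear_functional_def by simp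
  qed
  ultimately show ?thesis unfolding bounded_functional_def by blast
qed

text \<open>
  Used for \<open>M = X + Y\<close> and \<open>N = V + W\<close>, to regard both couples as pairs in \<open>X + Y\<close>.
\<close>

lemma banach_pair_renorm:
  assumes pair: "banach_pair N V W" and M: "normed_space M"
    and MN: "linear_subspace M N" and NM: "linear_subspace N M"
    and C: "0 < C" "\<And>x. x \<in> carrier M \<Longrightarrow> nrm N x \<le> C * nrm M x"
    and B: "0 < B" "\<And>x. x \<in> carrier N \<Longrightarrow> nrm M x \<le> B * nrm N x"
  shows "banach_pair M V W"
proof -
  interpret N: banach_pair N V W by (rule pair)
  have NMsub: "normed_subspace N M" by (rule normed_subspaceI[OF M MN])
  have carrier: "carrier M = carrier N"
    using MN NM unfolding linear_subspace_def by blast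
  have add: "x \<oplus>\<^bsub>M\<^esub> y = x \<oplus>\<^bsub>N\<^esub> y" if "x \<in> carrier N" "y \<in> carrier N" for x y
    using NM that unfolding linear_subspace_def by metis
  have sub: "normed_subspace M E" if E: "normed_subspace N E" for E
  proof (rule normed_subspaceI)
    show "normed_space E" by (rule normed_subspace.normed[OF E])
    show "linear_subspace E M"
      using normed_subspace.mem[OF E] carrier by (intro N.linear_subspaceI[OF E NMsub]) auto
  qed
  have bound: "\<exists>C. \<forall>x\<in>carrier E. nrm M x \<le> C * nrm E x"
    if E: "normed_subspace N E" and ex: "\<exists>C. \<forall>x\<in>carrier E. nrm N x \<le> C * nrm E x" for E
  proof -
    obtain A where A: "\<And>x. x \<in> carrier E \<Longrightarrow> nrm N x \<le> A * nrm E x" using ex by blast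
    have "nrm M x \<le> (B * A) * nrm E x" if x: "x \<in> carrier E" for x
    proof -
      have "nrm M x \<le> B * nrm N x" using B(2) normed_subspace.mem[OF E x] by blast
      also have "\<dots> \<le> B * (A * nrm E x)" using A[OF x] B(1) by simp
      finally show ?thesis by (simp add: mult.assoc)
    qed
    then show ?thesis by blast
  qed
  have "vspace M" using MN by (simp add: linear_subspace_def vspace_def)
  moreover have "\<exists>A. \<forall>u\<in>carrier M. \<exists>x\<in>carrier V. \<exists>y\<in>carrier W.
      u = x \<oplus>\<^bsub>M\<^esub> y \<and> nrm V x + nrm W y \<le> A * nrm M u"
  proof -
    obtain A where A: "\<And>u. u \<in> carrier N \<Longrightarrow> \<exists>x\<in>carrier V. \<exists>y\<in>carrier W.
      u = x \<oplus>\<^bsub>N\<^esub> y \<and> nrm V x + nrm W y \<le> A * nrm N u" using N.decomposition by blast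
    have "\<exists>x\<in>carrier V. \<exists>y\<in>carrier W. u = x \<oplus>\<^bsub>M\<^esub> y \<and> nrm V x + nrm W y \<le> (\<bar>A\<bar> * C) * nrm M u"
      if u: "u \<in> carrier M" for u
    proof -
      have uN: "u \<in> carrier N" using u carrier by simp
      obtain x y where xy: "x \<in> carrier V" "y \<in> carrier W" "u = x \<oplus>\<^bsub>N\<^esub> y"
        "nrm V x + nrm W y \<le> A * nrm N u" using A[OF uN] by blast
      have "A * nrm N u \<le> \<bar>A\<bar> * nrm N u" using uN by (intro mult_right_mono) auto
      also have "\<dots> \<le> \<bar>A\<bar> * (C * nrm M u)" using C(2)[OF u] by (intro mult_left_mono) auto
      finally have "nrm V x + nrm W y \<le> (\<bar>A\<bar> * C) * nrm M u" using xy(4) by (simp add: mult.assoc)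
      moreover have "u = x \<oplus>\<^bsub>M\<^esub> y" using xy(3) add[OF N.X.mem[OF xy(1)] N.Y.mem[OF xy(2)]] by simp
      ultimately show ?thesis using xy(1,2) by blast
    qed
    then show ?thesis by blast
  qed
  ultimately show ?thesis
    using sub[OF N.X.normed_subspace_axioms] sub[OF N.Y.normed_subspace_axioms]
      bound[OF N.X.normed_subspace_axioms N.X_bound] bound[OF N.Y.normed_subspace_axioms N.Y_bound]
      N.X_banach N.Y_banach normed_subspace_self[OF M]
    by (simp add: banach_pair_def banach_pair_axioms_def)
qed

lemma rank_one_stable_mono:
  assumes "rank_one_stable N V W Z" "\<And>f. bounded_functional M f \<Longrightarrow> bounded_functional N f"
  shows "rank_one_stable M V W Z"
proof -
  have "two_sided_stable M V W Z"
    using assms unfolding rank_one_stable_def two_sided_stable_def by blast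
  moreover have "one_sided_stable M V W Z" "one_sided_stable M W V Z"
    using assms unfolding rank_one_stable_def one_sided_stable_def by blast+
  ultimately show ?thesis by (simp add: rank_one_stable_def)
qed

theorem theorem3p7:
  fixes X Y V W :: "('k::real_or_complex, 'a) nspace"
    and H H' :: "('k, 'a) module"
    and \<tau> \<tau>' :: "'a topology"
  assumes "banach_couple H \<tau> X Y"
    and "banach_couple H' \<tau>' V W"
    and "R1_Int_1 H X Y = R1_Int_1 H' V W"
  shows "(X \<cong>\<^sub>p V \<and> Y \<cong>\<^sub>p W) \<or> (X \<cong>\<^sub>p W \<and> Y \<cong>\<^sub>p V)"
proof -
  interpret XY: couple H \<tau> X Y by (rule couple.intro) fact
  interpret VW: couple H' \<tau>' V W by (rule couple.intro) fact
  let ?M = "sum_space H X Y" and ?N = "sum_space H' V W"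
  have MN: "?M \<hookrightarrow> ?N" using VW.interpolation_D(3) XY.S_interpolation assms(3) by simp
  have NM: "?N \<hookrightarrow> ?M" using XY.interpolation_D(3) VW.S_interpolation assms(3) by simp
  obtain C where C: "0 < C" "\<And>x. x \<in> carrier ?M \<Longrightarrow> nrm ?N x \<le> C * nrm ?M x"
    using embedded_bound[OF XY.S_normed VW.S_normed MN] by blast
  obtain B where B: "0 < B" "\<And>x. x \<in> carrier ?N \<Longrightarrow> nrm ?M x \<le> B * nrm ?N x"
    using embedded_bound[OF VW.S_normed XY.S_normed NM] by blast
  have sub: "linear_subspace ?M ?N" "linear_subspace ?N ?M"
    using MN NM by (simp_all add: embedded_def)
  have "two_pairs ?M X Y V W"
  proof (intro two_pairs.intro two_pairs_axioms.intro)
    show "banach_pair ?M X Y" by (rule XY.banach_pair)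
    show "banach_pair ?M V W"
      by (rule banach_pair_renorm[OF VW.banach_pair XY.S_normed sub C B])
    show "rank_one_stable ?M X Y V" "rank_one_stable ?M X Y W"
      using VW.X_interpolation VW.Y_interpolation assms(3) by (auto intro: XY.stable)
    have "bounded_functional ?N f" if "bounded_functional ?M f" for f
      by (rule bounded_functional_mono[OF that XY.S_normed sub(2) B(2)])
    moreover have "rank_one_stable ?N V W X" "rank_one_stable ?N V W Y"
      using XY.X_interpolation XY.Y_interpolation assms(3) by (auto intro: VW.stable)
    ultimately show "rank_one_stable ?M V W X" "rank_one_stable ?M V W Y"
      using rank_one_stable_mono by blast+
  qed
  then show ?thesis by (rule two_pairs.couple_match)
qed

end
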